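(* Let $q\ge 3$, $n\ge1$ and $0\le r\le n$ be integers, and let $\lambda_0,\ldots,\lambda_n\ge0$ and $\beta>0$ be real numbers. If every code $C\subseteq\mathbb E=[q]^n$ with covering radius $r$ satisfies $(\lambda_0,\ldots,\lambda_n)\beta$, then $$K_q(n,r)^3\ \ge\ \min_x\ q^n\sum_{(i,j,t,p)\in I(q,n)}(q-1)^{i+j-t}(q-2)^{t-p}\binom{n}{p,\,t-p,\,i-t,\,j-t}x_{i,j}^{t,p},$$ where the minimum ranges over all families of real numbers $x=(x_{i,j}^{t,p})_{(i,j,t,p)\in I(q,n)}$ satisfying all of the following constraints. (A) For all $(i,j,t,p)\in I(q,n)$: $0\le x_{i,j}^{t,p}\le x_{i,i}^{i,i}$; $\ x_{i,0}^{0,0}+x_{i+j-t-p,0}^{0,0}-x_{0,0}^{0,0}\le x_{i,j}^{t,p}\le x_{i+j-t-p,0}^{0,0}$; and $x_{i,j}^{t,p}=x_{i',j'}^{t',p'}$ for every $(i',j',t',p')\in I(q,n)$ such that $(i,j,i+j-t-p)$ is a permutation of $(i',j',i'+j'-t'-p')$ and $t-p=t'-p'$. (B) For all integers $a,k$ with $0\le a\le k\le n+a-k$ and $k\ne0$: $\bigl(\sum_{t,p}\alpha(i,j,t,p,a,k)x_{i,j}^{t,p}\bigr)_{i,j=k}^{n+a-k}\succeq0$ and $\bigl(\sum_{t,p}\alpha(i,j,t,p,a,k)(x_{i+j-t-p,0}^{0,0}-x_{i,j}^{t,p})\bigr)_{i,j=k}^{n+a-k}\succeq0$. Moreover $\bigl(\sum_{t,p}\alpha(i,j,t,p,0,0)x_{i,j}^{t,p}\bigr)_{i,j=0}^n\succeq0$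 and $\begin{pmatrix}1-x_{0,0}^{0,0} & y^{\mathsf T} \\ y & L\end{pmatrix}\succeq0$, where $L=\bigl(\sum_{t,p}\alpha(i,j,t,p,0,0)(x_{i+j-t-p,0}^{0,0}-x_{i,j}^{t,p})\bigr)_{i,j=0}^n$ and $y_i=(x_{0,0}^{0,0}-x_{i,i}^{i,i})\binom ni(q-1)^{i/2}$ for $i=0,\ldots,n$. (C) Put $z_{i,j}^{t,p}=\Bigl(\sum_{d=0}^n\sum_{(i',j',t',p')\in I(q,n)}\lambda_d\,\eta_{(i',j',t',p'),d}^{(i,j,t,p)}\,x_{i',j'}^{t',p'}\Bigr)-\beta x_{i+j-t-p,0}^{0,0}$ for $(i,j,t,p)\in I(q,n)$. Then $\bigl(\sum_{t,p}\alpha(i,j,t,p,a,k)z_{i,j}^{t,p}\bigr)_{i,j=k}^{n+a-k}\succeq0$ for all integers $a,k$ with $0\le a\le k\le n+a-k$ and $k\neq0$, and $\begin{pmatrix}\sum_{i=0}^n\binom ni(q-1)^i\lambda_ix_{0,0}^{0,0}-\beta & y^{\mathsf T} \\ y & T\end{pmatrix}\succeq0$, where $T=\bigl(\sum_{t,p}\alpha(i,j,t,p,0,0)z_{i,j}^{t,p}\bigr)_{i,j=0}^n$ and $y_i=\binom ni(q-1)^{i/2}z_{i,i}^{i,i}$ for $i=0,\ldots,n$. (D) For every $(i,j,t,p)\in I(q,n)$, with $\lambda_{(i,j',t',p')}^{(i,j,t,p)}=\sum_{d=0}^n\lambda_d\,\alpha_{(i,j',t',p'),d}^{(i,j,t,p)}$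 and with sums over all $j',t',p'$ such that $(i,j',t',p')\in I(q,n)$: $$\sum_{j',t',p'}x_{i,j'}^{t',p'}\lambda_{(i,j',t',p')}^{(i,j,t,p)}\ge x_{i,0}^{0,0}\beta,$$ $$\sum_{j',t',p'}(x_{j',0}^{0,0}-x_{i,j'}^{t',p'})\lambda_{(i,j',t',p')}^{(i,j,t,p)}\ge(x_{0,0}^{0,0}-x_{i,0}^{0,0})\beta,$$ $$\sum_{j',t',p'}(x_{i+j'-t'-p',0}^{0,0}-x_{i,j'}^{t',p'})\lambda_{(i,j',t',p')}^{(i,j,t,p)}\ge(x_{0,0}^{0,0}-x_{i,0}^{0,0})\beta,$$ $$\sum_{j',t',p'}(x_{0,0}^{0,0}-x_{j',0}^{0,0}-x_{i+j'-t'-p',0}^{0,0}+x_{i,j'}^{t',p'})\lambda_{(i,j',t',p')}^{(i,j,t,p)}\ge(1-2x_{0,0}^{0,0}+x_{i,0}^{0,0})\beta.$$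
   Context: $[q]^n=\{0,\ldots,q-1\}^n$ is identified with $(\mathbb Z/q\mathbb Z)^n$. $d(\cdot,\cdot)$ is the Hamming distance, weight is distance to the zero word $\mathbf 0$, $S_i(\mathbf u)=\{\mathbf v: d(\mathbf u,\mathbf v)=i\}$, $B_r(\mathbf u)=\{\mathbf v:d(\mathbf u,\mathbf v)\le r\}$. The covering radius of $C\subseteq\mathbb E$ is the smallest integer $r$ with $\bigcup_{\mathbf u\in C}B_r(\mathbf u)=\mathbb E$; $K_q(n,r)$ is the minimum of $|C|$ over all $C\subseteq\mathbb E$ with covering radius $r$. $C$ satisfies $(\lambda_0,\ldots,\lambda_n)\beta$ if $\sum_{i=0}^n\lambda_i|C\cap S_i(\mathbf u)|\ge\beta$ for all $\mathbf u\in\mathbb E$. For $\mathbf u,\mathbf v\in\mathbb E$, $\overline d(\mathbf u,\mathbf v)=(i,j,t,p)$ with $i=|\{\ell:\mathbf u_\ell\ne0\}|$, $j=|\{\ell:\mathbf v_\ell\ne0\}|$, $t=|\{\ell:\mathbf u_\ell\ne0,\mathbf v_\ell\ne0\}|$, $p=|\{\ell:\mathbf u_\ell=\mathbf v_\ell\ne0\}|$. $I(q,n)=\{(i,j,t,p):0\le p\le t\le i,j,\ i+j\le n+t\}$ (integers) is the set of tuples that occur. With the convention $\binom st=0$ if $s<t$ or $t<0$, let $\beta_{i,j,k}^{m,t}=\sum_{u=0}^m(-1)^{t-u}\binom ut\binom{m-2k}{u-k}\binom{m-k-u}{i-u}\binom{m-k-u}{j-u}$, and $$\alpha(i,j,t,p,a,k)=\beta_{i-a,j-a,k-a}^{n-a,t-a}\,(q-1)^{\frac12(i+j)-t}\sum_{g=0}^p(-1)^{a-g}\binom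 ag\binom{t-a}{p-g}(q-2)^{t-a-p+g}.$$ Sums $\sum_{t,p}\alpha(i,j,t,p,a,k)(\cdots)$ run over all $t,p$ with $(i,j,t,p)\in I(q,n)$. The multinomial coefficient is $\binom{n}{a,b,c,e}=\frac{n!}{a!\,b!\,c!\,e!\,(n-a-b-c-e)!}$. For $\mathbf u,\mathbf v$ with $\overline d(\mathbf u,\mathbf v)=(i,j,t,p)$: $\eta_{(i',j',t',p'),d}^{(i,j,t,p)}$ is the number of $\mathbf w\in\mathbb E$ of weight $d$ with $\overline d(\mathbf u-\mathbf w,\mathbf v-\mathbf w)=(i',j',t',p')$; and $\alpha_{(i,j',t',p'),d}^{(i,j,t,p)}$ is the number of $\mathbf w\in\mathbb E$ with $\overline d(\mathbf u,\mathbf w)=(i,j',t',p')$ and $d(\mathbf v,\mathbf w)=d$. (Both depend only on $(i,j,t,p)$.) $\succeq0$ means positive semidefinite. *)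

theory Defs
  imports "HOL-Analysis.Analysis" "HOL-Library.FuncSet" "HOL-Library.Multiset"
begin

section \<open>Words and covering codes\<close>

text \<open>Words are extensional functions on the coordinates; the letters are the canonical
  representatives of the residue classes modulo \<open>q\<close>.\<close>

type_synonym word = "nat \<Rightarrow> int"

definition words :: "nat \<Rightarrow> nat \<Rightarrow> word set" where
  "words q n = {..<n} \<rightarrow>\<^sub>E {0..<int q}"

definition zero_word :: "nat \<Rightarrow> word" where
  "zero_word n = restrict (\<lambda>l. 0) {..<n}"

definition word_diff :: "nat \<Rightarrow> nat \<Rightarrow> word \<Rightarrow> word \<Rightarrow> word" where
  "word_diff q n u v = restrict (\<lambda>l. (u l - v l) mod int q) {..<n}"

definition hdist :: "nat \<Rightarrow> word \<Rightarrow> word \<Rightarrow> nat" where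
  "hdist n u v = card {l. l < n \<and> u l \<noteq> v l}"

definition weight :: "nat \<Rightarrow> word \<Rightarrow> nat" where
  "weight n u = hdist n u (zero_word n)"

definition hsphere :: "nat \<Rightarrow> nat \<Rightarrow> nat \<Rightarrow> word \<Rightarrow> word set" where
  "hsphere q n i u = {v \<in> words q n. hdist n u v = i}"

definition hball :: "nat \<Rightarrow> nat \<Rightarrow> nat \<Rightarrow> word \<Rightarrow> word set" where
  "hball q n r u = {v \<in> words q n. hdist n u v \<le> r}"

text \<open>A relation rather than a function of the code, because the empty code has no
  covering radius.\<close>

definition has_covering_radius :: "nat \<Rightarrow> nat \<Rightarrow> word set \<Rightarrow> nat \<Rightarrow> bool" where
  "has_covering_radius q n C r \<longleftrightarrow>
     (\<Union>u\<in>C. hball q n r u) = words q n \<and>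
     (\<forall>s. (\<Union>u\<in>C. hball q n s u) = words q n \<longrightarrow> r \<le> s)"

definition K :: "nat \<Rightarrow> nat \<Rightarrow> nat \<Rightarrow> nat" where
  "K q n r = Min {card C | C. C \<subseteq> words q n \<and> has_covering_radius q n C r}"

definition satisfies_ineq :: "nat \<Rightarrow> nat \<Rightarrow> (nat \<Rightarrow> real) \<Rightarrow> real \<Rightarrow> word set \<Rightarrow> bool" where
  "satisfies_ineq q n lam \<beta> C \<longleftrightarrow>
     (\<forall>u \<in> words q n. (\<Sum>i=0..n. lam i * real (card (C \<inter> hsphere q n i u))) \<ge> \<beta>)"

section \<open>Orbits of pairs of words\<close>

type_synonym tuple = "nat \<times> nat \<times> nat \<times> nat"

definition dbar :: "nat \<Rightarrow> word \<Rightarrow> word \<Rightarrow> tuple" where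
  "dbar n u v =
     (card {l. l < n \<and> u l \<noteq> 0},
      card {l. l < n \<and> v l \<noteq> 0},
      card {l. l < n \<and> u l \<noteq> 0 \<and> v l \<noteq> 0},
      card {l. l < n \<and> u l = v l \<and> v l \<noteq> 0})"

text \<open>For \<open>q \<ge> 3\<close> the set of tuples that occur does not depend on \<open>q\<close>. On this set, the natural
  number subtractions \<open>i + j - t - p\<close> and \<open>t - p\<close> below are not truncated.\<close>

definition I :: "nat \<Rightarrow> tuple set" where
  "I n = {(i,j,t,p). p \<le> t \<and> t \<le> i \<and> t \<le> j \<and> i + j \<le> n + t}"

text \<open>The two counts depend on the pair \<open>(u, v)\<close> only through its tuple, so each definite
  description denotes the common value whenever \<open>\<tau>\<close> occurs.\<close>

definition eta :: "nat \<Rightarrow> nat \<Rightarrow> tuple \<Rightarrow> nat \<Rightarrow> tuple \<Rightarrow> nat" where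
  "eta q n \<tau>' d \<tau> = (THE c. \<forall>u \<in> words q n. \<forall>v \<in> words q n. dbar n u v = \<tau> \<longrightarrow>
     c = card {w \<in> words q n. weight n w = d \<and>
                 dbar n (word_diff q n u w) (word_diff q n v w) = \<tau>'})"

definition pair_count :: "nat \<Rightarrow> nat \<Rightarrow> tuple \<Rightarrow> nat \<Rightarrow> tuple \<Rightarrow> nat" where
  "pair_count q n \<tau>' d \<tau> = (THE c. \<forall>u \<in> words q n. \<forall>v \<in> words q n. dbar n u v = \<tau> \<longrightarrow>
     c = card {w \<in> words q n. dbar n u w = \<tau>' \<and> hdist n v w = d})"

section \<open>Block diagonalisation coefficients\<close>

definition ibinom :: "int \<Rightarrow> int \<Rightarrow> real" where
  "ibinom s t = (if s < t \<or> t < 0 then 0 else real (nat s choose nat t))"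

definition beta_coeff :: "int \<Rightarrow> int \<Rightarrow> int \<Rightarrow> int \<Rightarrow> int \<Rightarrow> real" where
  "beta_coeff m t i j k =
     (\<Sum>u=0..m. (-1) powi (t - u) * ibinom u t * ibinom (m - 2 * k) (u - k) *
        ibinom (m - k - u) (i - u) * ibinom (m - k - u) (j - u))"

text \<open>If an exponent of \<open>q - 2\<close> is negative, the binomial coefficient in front of it vanishes.\<close>

definition alpha_coeff ::
  "int \<Rightarrow> int \<Rightarrow> int \<Rightarrow> int \<Rightarrow> int \<Rightarrow> int \<Rightarrow> int \<Rightarrow> int \<Rightarrow> real" where
  "alpha_coeff q n i j t p a k =
     beta_coeff (n - a) (t - a) (i - a) (j - a) (k - a) *
     (real_of_int q - 1) powr (real_of_int (i + j) / 2 - real_of_int t) *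
     (\<Sum>g=0..p. (-1) powi (a - g) * ibinom a g * ibinom (t - a) (p - g) *
        (real_of_int q - 2) powi (t - a - p + g))"

definition block ::
  "nat \<Rightarrow> nat \<Rightarrow> nat \<Rightarrow> nat \<Rightarrow> (tuple \<Rightarrow> real) \<Rightarrow> nat \<Rightarrow> nat \<Rightarrow> real" where
  "block q n a k f = (\<lambda>i j. \<Sum>(t,p) \<in> {(t,p). (i,j,t,p) \<in> I n}.
     alpha_coeff (int q) (int n) (int i) (int j) (int t) (int p) (int a) (int k) * f (i,j,t,p))"

definition multinom :: "nat \<Rightarrow> nat \<Rightarrow> nat \<Rightarrow> nat \<Rightarrow> nat \<Rightarrow> real" where
  "multinom n a b c e = fact n / (fact a * fact b * fact c * fact e * fact (n - a - b - c - e))"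

section \<open>Positive semidefinite matrices\<close>

text \<open>Matrices have entries indexed by a finite set, since the block sizes vary with \<open>n\<close>, \<open>a\<close>
  and \<open>k\<close>. In a bordered matrix the additional first row and column have index \<open>None\<close>.\<close>

definition psd :: "'i set \<Rightarrow> ('i \<Rightarrow> 'i \<Rightarrow> real) \<Rightarrow> bool" where
  "psd A M \<longleftrightarrow> (\<forall>i\<in>A. \<forall>j\<in>A. M i j = M j i) \<and>
     (\<forall>v :: 'i \<Rightarrow> real. (\<Sum>i\<in>A. \<Sum>j\<in>A. v i * M i j * v j) \<ge> 0)"

fun bordered :: "real \<Rightarrow> ('i \<Rightarrow> real) \<Rightarrow> ('i \<Rightarrow> 'i \<Rightarrow> real) \<Rightarrow> 'i option \<Rightarrow> 'i option \<Rightarrow> real" where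
  "bordered c y M None None = c"
| "bordered c y M None (Some j) = y j"
| "bordered c y M (Some i) None = y i"
| "bordered c y M (Some i) (Some j) = M i j"

definition bordered_index :: "'i set \<Rightarrow> 'i option set" where
  "bordered_index A = insert None (Some ` A)"

section \<open>The semidefinite program\<close>

text \<open>A family indexed by \<open>I n\<close> is a function on all tuples; its values outside \<open>I n\<close> are
  never used.\<close>

definition objective :: "nat \<Rightarrow> nat \<Rightarrow> (tuple \<Rightarrow> real) \<Rightarrow> real" where
  "objective q n x = real q ^ n *
     (\<Sum>(i,j,t,p) \<in> I n. (real q - 1) ^ (i + j - t) * (real q - 2) ^ (t - p) *
        multinom n p (t - p) (i - t) (j - t) * x (i,j,t,p))"

definition constraints_A :: "nat \<Rightarrow> (tuple \<Rightarrow> real) \<Rightarrow> bool" where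
  "constraints_A n x \<longleftrightarrow> (\<forall>(i,j,t,p) \<in> I n.
     0 \<le> x (i,j,t,p) \<and> x (i,j,t,p) \<le> x (i,i,i,i) \<and>
     x (i,0,0,0) + x (i+j-t-p,0,0,0) - x (0,0,0,0) \<le> x (i,j,t,p) \<and>
     x (i,j,t,p) \<le> x (i+j-t-p,0,0,0) \<and>
     (\<forall>(i',j',t',p') \<in> I n.
        {#i, j, i+j-t-p#} = {#i', j', i'+j'-t'-p'#} \<and> t - p = t' - p' \<longrightarrow>
        x (i,j,t,p) = x (i',j',t',p')))"

definition x_compl :: "(tuple \<Rightarrow> real) \<Rightarrow> tuple \<Rightarrow> real" where
  "x_compl x = (\<lambda>(i,j,t,p). x (i+j-t-p,0,0,0) - x (i,j,t,p))"

text \<open>The bound \<open>k \<le> n + a - k\<close> is written without subtraction as \<open>2 * k \<le> n + a\<close>.\<close>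

definition constraints_B :: "nat \<Rightarrow> nat \<Rightarrow> (tuple \<Rightarrow> real) \<Rightarrow> bool" where
  "constraints_B q n x \<longleftrightarrow>
     (\<forall>a k. a \<le> k \<and> 2 * k \<le> n + a \<and> k \<noteq> 0 \<longrightarrow>
        psd {k..n + a - k} (block q n a k x) \<and>
        psd {k..n + a - k} (block q n a k (x_compl x))) \<and>
     psd {0..n} (block q n 0 0 x) \<and>
     psd (bordered_index {0..n})
       (bordered (1 - x (0,0,0,0))
          (\<lambda>i. (x (0,0,0,0) - x (i,i,i,i)) * real (n choose i) * (real q - 1) powr (real i / 2))
          (block q n 0 0 (x_compl x)))"

definition z_fam :: "nat \<Rightarrow> nat \<Rightarrow> (nat \<Rightarrow> real) \<Rightarrow> real \<Rightarrow> (tuple \<Rightarrow> real) \<Rightarrow> tuple \<Rightarrow> real" where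
  "z_fam q n lam \<beta> x = (\<lambda>(i,j,t,p).
     (\<Sum>d=0..n. \<Sum>\<tau>' \<in> I n. lam d * real (eta q n \<tau>' d (i,j,t,p)) * x \<tau>')
       - \<beta> * x (i+j-t-p,0,0,0))"

definition constraints_C ::
  "nat \<Rightarrow> nat \<Rightarrow> (nat \<Rightarrow> real) \<Rightarrow> real \<Rightarrow> (tuple \<Rightarrow> real) \<Rightarrow> bool" where
  "constraints_C q n lam \<beta> x \<longleftrightarrow>
     (\<forall>a k. a \<le> k \<and> 2 * k \<le> n + a \<and> k \<noteq> 0 \<longrightarrow>
        psd {k..n + a - k} (block q n a k (z_fam q n lam \<beta> x))) \<and>
     psd (bordered_index {0..n})
       (bordered ((\<Sum>i=0..n. real (n choose i) * (real q - 1) ^ i * lam i * x (0,0,0,0)) - \<beta>)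
          (\<lambda>i. real (n choose i) * (real q - 1) powr (real i / 2) * z_fam q n lam \<beta> x (i,i,i,i))
          (block q n 0 0 (z_fam q n lam \<beta> x)))"

definition lam_count :: "nat \<Rightarrow> nat \<Rightarrow> (nat \<Rightarrow> real) \<Rightarrow> tuple \<Rightarrow> tuple \<Rightarrow> real" where
  "lam_count q n lam \<tau>' \<tau> = (\<Sum>d=0..n. lam d * real (pair_count q n \<tau>' d \<tau>))"

definition constraints_D ::
  "nat \<Rightarrow> nat \<Rightarrow> (nat \<Rightarrow> real) \<Rightarrow> real \<Rightarrow> (tuple \<Rightarrow> real) \<Rightarrow> bool" where
  "constraints_D q n lam \<beta> x \<longleftrightarrow> (\<forall>(i,j,t,p) \<in> I n.
     (let J = {(j',t',p'). (i,j',t',p') \<in> I n};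
          \<Lambda> = (\<lambda>j' t' p'. lam_count q n lam (i,j',t',p') (i,j,t,p))
      in
        (\<Sum>(j',t',p') \<in> J. x (i,j',t',p') * \<Lambda> j' t' p') \<ge> x (i,0,0,0) * \<beta> \<and>
        (\<Sum>(j',t',p') \<in> J. (x (j',0,0,0) - x (i,j',t',p')) * \<Lambda> j' t' p')
          \<ge> (x (0,0,0,0) - x (i,0,0,0)) * \<beta> \<and>
        (\<Sum>(j',t',p') \<in> J. (x (i+j'-t'-p',0,0,0) - x (i,j',t',p')) * \<Lambda> j' t' p')
          \<ge> (x (0,0,0,0) - x (i,0,0,0)) * \<beta> \<and>
        (\<Sum>(j',t',p') \<in> J.
           (x (0,0,0,0) - x (j',0,0,0) - x (i+j'-t'-p',0,0,0) + x (i,j',t',p')) * \<Lambda> j' t' p')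
          \<ge> (1 - 2 * x (0,0,0,0) + x (i,0,0,0)) * \<beta>))"

definition feasible :: "nat \<Rightarrow> nat \<Rightarrow> (nat \<Rightarrow> real) \<Rightarrow> real \<Rightarrow> (tuple \<Rightarrow> real) \<Rightarrow> bool" where
  "feasible q n lam \<beta> x \<longleftrightarrow>
     constraints_A n x \<and> constraints_B q n x \<and>
     constraints_C q n lam \<beta> x \<and> constraints_D q n lam \<beta> x"

end

(*
  Average a minimum code C over the automorphism group G of the Hamming space, and let x(i,j,t,p) be
  the proportion of g in G for which C contains the images of 0, u and v, where (u,v) is any pair in
  the orbit (i,j,t,p). Then the objective at x equals |C|^3. The linear constraints are expectations
  of pointwise inequalities between indicators, and each semidefinite constraint comes from a matrix
  E[h e(u) e(v)] indexed by words, with h >= 0. Such matrices are positive semidefinite; compressing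
  one to explicit tensor vectors of fixed weight yields the block (a,k) up to a positive factor. That
  factorisation is an identity between generating functions in four variables, two for the weights and
  two for t - p and p. The minimum is attained because the feasible set is closed and every feasible
  family takes values in [0,1].
*)
theory Submission
  imports Defs
begin

text \<open>Each block is a compression of a positive semidefinite matrix, so positivity rests on
  evaluating one quadratic form on explicit vectors. Evaluated directly, this would compare nested
  alternating sums. Attaching a monomial to each orbit of pairs instead turns the sum over pairs of
  words into a product over coordinates, where only a few one-letter values remain to be computed.

  The average runs over the whole automorphism group and not over the stabiliser of the zero word.
  The zero word thereby becomes one of three interchangeable words of a triple, which yields the
  permutation symmetry in (A) and lets the counts \<open>eta\<close> be read as patterns seen from a
  moving base word. The weight h is the indicator that the image of the zero word lies in C, its
  complement, or the slack of the covering inequality at that image. A bordered matrix arises when a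
  constant is added to the test function before squaring.\<close>

section \<open>Generating functions of the block coefficients\<close>

text \<open>The coefficient of x^i in x^s (1 + x)^N. The guard matters: for i < s, truncated
  subtraction would give N choose 0 = 1.\<close>

definition shifted_binom :: "nat \<Rightarrow> nat \<Rightarrow> nat \<Rightarrow> real" where
  "shifted_binom N i s = (if s \<le> i then real (N choose (i - s)) else 0)"

lemma ibinom_of_nat: "ibinom (int a) (int b) = real (a choose b)"
  by (auto simp: ibinom_def binomial_eq_0)

lemma ibinom_eq_0: "t < 0 \<or> s < t \<Longrightarrow> ibinom s t = 0"
  by (auto simp: ibinom_def)

lemma sum_shifted_binom:
  assumes "N + s \<le> n"
  shows "(\<Sum>i\<le>n. shifted_binom N i s * x ^ i) = x ^ s * (1 + x) ^ N"
proof -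
  have "(\<Sum>i\<le>n. shifted_binom N i s * x ^ i) = (\<Sum>i\<in>{s..s+N}. shifted_binom N i s * x ^ i)"
    using assms by (intro sum.mono_neutral_right) (auto simp: shifted_binom_def binomial_eq_0)
  also have "\<dots> = (\<Sum>i\<le>N. real (N choose i) * x ^ (s + i))"
    by (rule sum.reindex_bij_witness[where i="\<lambda>i. s + i" and j="\<lambda>i. i - s"])
       (auto simp: shifted_binom_def)
  also have "\<dots> = x ^ s * (x + 1) ^ N"
    using binomial_ring[of x 1 N] by (simp add: sum_distrib_left power_add mult_ac)
  finally show ?thesis by (simp add: add.commute)
qed

lemma sum_signed_binom:
  fixes x :: real
  assumes "u \<le> n"
  shows "(\<Sum>k\<le>n. (-1) ^ (k + u) * real (u choose k) * x ^ k) = (x - 1) ^ u"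
proof -
  have "(\<Sum>k\<le>n. (-1) ^ (k + u) * real (u choose k) * x ^ k)
      = (\<Sum>k\<le>u. (-1) ^ (k + u) * real (u choose k) * x ^ k)"
    using assms by (intro sum.mono_neutral_right) (auto simp: binomial_eq_0)
  also have "\<dots> = (\<Sum>k\<le>u. real (u choose k) * x ^ k * (-1) ^ (u - k))"
    by (intro sum.cong refl) (auto simp: minus_one_power_iff)
  also have "\<dots> = (x - 1) ^ u"
    using binomial_ring[of x "-1" u] by simp
  finally show ?thesis .
qed

text \<open>Substituting u = k - a + w, the middle binomial vanishes unless 0 \<le> w \<le> n + a -
  2k, and the last two become coefficients of x^i and x^j in x^(k+w) (1 + x)^(n+a-2k-w). For t < a
  every term has a binomial with negative lower index.\<close>

lemma beta_coeff_of_nat: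
  assumes "a \<le> k" "2 * k \<le> n + a"
  shows "beta_coeff (int n - int a) (int t - int a) (int i - int a) (int j - int a) (int k - int a) =
    (if a \<le> t then (\<Sum>w\<le>n+a-2*k. (-1) ^ (t - a + (k - a + w)) * real ((k - a + w) choose (t - a)) *
       real ((n+a-2*k) choose w) * shifted_binom (n+a-2*k-w) i (k+w) * shifted_binom (n+a-2*k-w) j (k+w))
     else 0)"
proof (cases "a \<le> t")
  case False
  then show ?thesis by (simp add: beta_coeff_def ibinom_eq_0)
next
  case True
  define F :: "int \<Rightarrow> real" where "F u = (-1) powi (int t - int a - u) * ibinom u (int t - int a) *
      ibinom (int n - int a - 2 * (int k - int a)) (u - (int k - int a)) *
      ibinom (int n - int a - (int k - int a) - u) (int i - int a - u) *
      ibinom (int n - int a - (int k - int a) - u) (int j - int a - u)" for u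
  have "beta_coeff (int n - int a) (int t - int a) (int i - int a) (int j - int a) (int k - int a)
      = (\<Sum>u\<in>{0..int n - int a}. F u)"
    by (simp add: beta_coeff_def F_def)
  also have "\<dots> = (\<Sum>u\<in>{int k - int a..int n - int k}. F u)"
    using assms by (intro sum.mono_neutral_right) (auto simp: F_def ibinom_def)
  also have "\<dots> = (\<Sum>w\<le>n+a-2*k. F (int (k - a + w)))"
    using assms
    by (intro sum.reindex_bij_witness[where i="\<lambda>w. int (k - a + w)" and j="\<lambda>u. nat (u - (int k - int a))"]) auto
  also have "\<dots> = (\<Sum>w\<le>n+a-2*k. (-1) ^ (t - a + (k - a + w)) * real ((k - a + w) choose (t - a)) *
       real ((n+a-2*k) choose w) * shifted_binom (n+a-2*k-w) i (k+w) * shifted_binom (n+a-2*k-w) j (k+w))"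
  proof (rule sum.cong)
    fix w assume w: "w \<in> {..n+a-2*k}"
    have sb: "ibinom (int n - int a - (int k - int a) - int (k - a + w)) (int i' - int a - int (k - a + w))
       = shifted_binom (n+a-2*k-w) i' (k+w)" for i'
    proof (cases "k + w \<le> i'")
      case True
      have "int n - int a - (int k - int a) - int (k - a + w) = int (n+a-2*k-w)"
        using assms w by auto
      moreover have "int i' - int a - int (k - a + w) = int (i' - (k + w))"
        using assms True by auto
      ultimately show ?thesis using True by (simp only: ibinom_of_nat shifted_binom_def) simp
    next
      case False
      then show ?thesis using assms by (auto simp: ibinom_def shifted_binom_def)
    qed
    have e: "int t - int a = int (t - a)" using True by simp
    \<comment> \<open>Exponents of equal parity give the same sign, so the difference is replaced by
      a sum, which cannot be truncated.\<close>
    have sgn: "(-1::real) powi (int t - int a - int (k - a + w)) = (-1) ^ (t - a + (k - a + w))"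
      unfolding e by (simp add: power_int_diff power_add minus_one_power_iff)
    have f: "int n - int a - 2 * (int k - int a) = int (n+a-2*k)"
      "int (k - a + w) - (int k - int a) = int w"
      using assms by auto
    show "F (int (k - a + w)) = (-1) ^ (t - a + (k - a + w)) * real ((k - a + w) choose (t - a)) *
       real ((n+a-2*k) choose w) * shifted_binom (n+a-2*k-w) i (k+w) * shifted_binom (n+a-2*k-w) j (k+w)"
      unfolding F_def sb sgn f unfolding e ibinom_of_nat ..
  qed simp
  finally show ?thesis using True by simp
qed

text \<open>The matrix on the q - 1 nonzero letters with z on the diagonal and y elsewhere has
  eigenvalues z - y and z + (q - 2) y. For a \<le> t and p \<le> t this is the coefficient of
  y^(t-p) z^p in the product of a copies of the first and t - a copies of the second.\<close>

definition sigma_coeff :: "nat \<Rightarrow> nat \<Rightarrow> nat \<Rightarrow> nat \<Rightarrow> real" where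
  "sigma_coeff q t p a = (\<Sum>g=0..int p. (-1) powi (int a - g) * ibinom (int a) g *
     ibinom (int t - int a) (int p - g) * (real q - 2) powi (int t - int a - int p + g))"

lemma sum_sigma_coeff:
  assumes "a \<le> t"
  shows "(\<Sum>p\<le>t. sigma_coeff q t p a * y ^ (t - p) * z ^ p)
    = (z - y) ^ a * (z + (real q - 2) * y) ^ (t - a)"
proof -
  define Q1 where "Q1 = real q - 2"
  define A where "A g = real (a choose g) * (- y) ^ (a - g)" for g
  define B where "B g = real ((t - a) choose g) * (Q1 * y) ^ (t - a - g)" for g
  have "(z - y) ^ a * (z + Q1 * y) ^ (t - a) = (\<Sum>g\<le>a. A g * z ^ g) * (\<Sum>h\<le>t-a. B h * z ^ h)"
    using binomial_ring[of z "- y" a] binomial_ring[of z "Q1 * y" "t - a"]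
    by (simp add: A_def B_def algebra_simps)
  also have "\<dots> = (\<Sum>r\<le>a + (t - a). (\<Sum>k\<le>r. A k * B (r - k)) * z ^ r)"
    by (rule polynomial_product) (auto simp: A_def B_def)
  also have "\<dots> = (\<Sum>p\<le>t. sigma_coeff q t p a * y ^ (t - p) * z ^ p)"
  proof (rule sum.cong)
    fix p assume "p \<in> {..t}"
    then have p: "p \<le> t" by simp
    have "sigma_coeff q t p a = (\<Sum>g\<le>p. (-1) powi (int a - int g) * ibinom (int a) (int g) *
     ibinom (int t - int a) (int p - int g) * Q1 powi (int t - int a - int p + int g))"
      unfolding sigma_coeff_def Q1_def
      by (rule sum.reindex_bij_witness[where i=int and j=nat]) auto
    moreover have "(-1) powi (int a - int g) * ibinom (int a) (int g) *
     ibinom (int t - int a) (int p - int g) * Q1 powi (int t - int a - int p + int g) * y ^ (t - p)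
       = A g * B (p - g)" if g: "g \<le> p" for g
    \<comment> \<open>Outside this range a binomial vanishes on both sides. Inside it t - a - p + g
      is nonnegative, so no negative power of q - 2 is involved.\<close>
    proof (cases "g \<le> a \<and> p - g \<le> t - a")
      case False
      have e: "int t - int a = int (t - a)" "int p - int g = int (p - g)" using assms g by auto
      have "ibinom (int a) (int g) * ibinom (int t - int a) (int p - int g) = 0"
        using False unfolding e ibinom_of_nat by auto
      moreover have "A g * B (p - g) = 0" using False by (auto simp: A_def B_def)
      ultimately show ?thesis by auto
    next
      case True
      have e: "int t - int a = int (t - a)" "int p - int g = int (p - g)"
        "int (t - a) - int p + int g = int (t - a - (p - g))" "int a - int g = int (a - g)"
        using assms g True by auto
      have "t - p = (a - g) + (t - a - (p - g))" using assms g True p by auto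
      then show ?thesis unfolding e ibinom_of_nat power_int_of_nat A_def B_def
        by (simp add: power_add power_mult_distrib power_minus[of y])
    qed
    ultimately have "sigma_coeff q t p a * y ^ (t - p) = (\<Sum>g\<le>p. A g * B (p - g))"
      by (simp add: sum_distrib_right)
    then show "(\<Sum>k\<le>p. A k * B (p - k)) * z ^ p = sigma_coeff q t p a * y ^ (t - p) * z ^ p" by simp
  qed (use assms in simp)
  finally show ?thesis by (simp add: Q1_def)
qed

text \<open>\<open>alpha_coeff\<close> with row i and column j scaled by (q-1)^(i/2) and
  (q-1)^(j/2): a congruence by a positive diagonal matrix that leaves integral powers of q - 1. The
  quotient form separates i, j and t for the generating function.\<close>

definition int_alpha :: "nat \<Rightarrow> nat \<Rightarrow> nat \<Rightarrow> nat \<Rightarrow> nat \<Rightarrow> nat \<Rightarrow> nat \<Rightarrow> nat \<Rightarrow> real" where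
  "int_alpha q n a k i j t p =
    beta_coeff (int n - int a) (int t - int a) (int i - int a) (int j - int a) (int k - int a) *
    ((real q - 1) ^ i * (real q - 1) ^ j / (real q - 1) ^ t) * sigma_coeff q t p a"

lemma int_alpha_eq:
  assumes "q \<ge> 2"
  shows "int_alpha q n a k i j t p = (real q - 1) powr (real i / 2) * (real q - 1) powr (real j / 2) *
    alpha_coeff (int q) (int n) (int i) (int j) (int t) (int p) (int a) (int k)"
proof -
  define Q where "Q = real q - 1"
  have Q: "Q > 0" using assms by (simp add: Q_def)
  have "Q ^ i * Q ^ j / Q ^ t = Q powr (real i + real j - real t)"
    using Q by (simp add: powr_realpow powr_add powr_diff)
  also have "\<dots> = Q powr (real i / 2) * Q powr (real j / 2) * Q powr ((real i + real j)/2 - real t)"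
  proof -
    have "real i + real j - real t = real i / 2 + real j / 2 + ((real i + real j)/2 - real t)"
      by (simp add: field_simps)
    then show ?thesis by (metis powr_add)
  qed
  finally show ?thesis
    unfolding int_alpha_def alpha_coeff_def sigma_coeff_def Q_def by simp
qed

text \<open>Each summation meets one closed form: p by \<open>sum_sigma_coeff\<close>, t by
  \<open>sum_signed_binom\<close>, i and j by \<open>sum_shifted_binom\<close>, and the index w of
  \<open>beta_coeff_of_nat\<close> by the binomial theorem. Marking t - p rather than t lets s and p
  range independently. T is the row sum of the nonzero-letter matrix with z on the diagonal and y
  elsewhere.\<close>

lemma gf_int_alpha:
  fixes y z \<xi> \<zeta> :: real
  assumes "a \<le> k" "2 * k \<le> n + a" "q \<ge> 2"
  defines "Q \<equiv> real q - 1"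
  defines "T \<equiv> z + (real q - 2) * y"
  shows "(\<Sum>i\<le>n. \<Sum>j\<le>n. \<Sum>s\<le>n. \<Sum>p\<le>n. int_alpha q n a k i j (s + p) p * \<xi> ^ i * \<zeta> ^ j * y ^ s * z ^ p)
   = (\<xi> * \<zeta>) ^ k * (z - y) ^ a * (T - Q) ^ (k - a) * Q ^ k *
     (1 + Q * \<xi> + Q * \<zeta> + Q * \<xi> * \<zeta> * T) ^ (n + a - 2 * k)"
proof -
  have Q: "Q > 0" using assms by (simp add: Q_def)
  define m where "m = n + a - 2 * k"
  define b where "b i j t = beta_coeff (int n - int a) (int t - int a) (int i - int a) (int j - int a) (int k - int a)" for i j t
  \<comment> \<open>The square of pairs (s, p) contains pairs with s + p > n; this removes them, as
    well as the range t < a.\<close>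
  have b0: "b i j t = 0" if "t < a \<or> n < t" for i j t
    using that unfolding b_def beta_coeff_def by (intro sum.neutral) (auto simp: ibinom_def)
  have inner: "(\<Sum>s\<le>n. \<Sum>p\<le>n. int_alpha q n a k i j (s + p) p * y ^ s * z ^ p)
      = Q ^ i * Q ^ j * (\<Sum>t\<in>{a..n}. b i j t / Q ^ t * ((z - y) ^ a * T ^ (t - a)))" for i j
  proof -
    define g where "g s p = int_alpha q n a k i j (s + p) p * y ^ s * z ^ p" for s p
    have g0: "g s p = 0" if "s + p > n" for s p
      using b0[of "s + p" i j] that by (simp add: g_def int_alpha_def b_def)
    have "(\<Sum>s\<le>n. \<Sum>p\<le>n. g s p) = (\<Sum>(p,s)\<in>{..n}\<times>{..n}. g s p)"
      by (subst sum.swap) (simp add: sum.cartesian_product)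
    also have "\<dots> = (\<Sum>(p,s)\<in>{(p,s). p + s \<le> n}. g s p)"
      by (intro sum.mono_neutral_right) (auto intro!: g0)
    also have "\<dots> = (\<Sum>t\<le>n. \<Sum>p\<le>t. g (t - p) p)" by (rule sum.triangle_reindex_eq)
    also have "\<dots> = (\<Sum>t\<in>{a..n}. \<Sum>p\<le>t. g (t - p) p)"
      by (intro sum.mono_neutral_right) (auto simp: g_def int_alpha_def b0[unfolded b_def])
    also have "\<dots> = (\<Sum>t\<in>{a..n}. b i j t * (Q ^ i * Q ^ j / Q ^ t) * ((z - y) ^ a * T ^ (t - a)))"
    proof (intro sum.cong refl)
      fix t assume "t \<in> {a..n}"
      then have "a \<le> t" by simp
      from sum_sigma_coeff[OF this, of q y z]
      have *: "(z - y) ^ a * T ^ (t - a) = (\<Sum>p\<le>t. sigma_coeff q t p a * y ^ (t - p) * z ^ p)"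
        by (simp add: T_def)
      then show "(\<Sum>p\<le>t. g (t - p) p) = b i j t * (Q ^ i * Q ^ j / Q ^ t) * ((z - y) ^ a * T ^ (t - a))"
        unfolding * sum_distrib_left
        by (intro sum.cong refl) (simp add: g_def int_alpha_def b_def Q_def)
    qed
    finally show ?thesis by (simp add: g_def sum_distrib_left mult_ac)
  qed
  \<comment> \<open>X absorbs the factor 1 / Q^t, so that the alternating sum over t becomes (X -
    1)^(k-a+w).\<close>
  define X where "X = T / Q"
  have betat: "(\<Sum>t\<in>{a..n}. b i j t / Q ^ t * ((z - y) ^ a * T ^ (t - a))) =
    (z - y) ^ a / Q ^ a * (\<Sum>w\<le>m. (X - 1) ^ (k - a + w) * real (m choose w) * shifted_binom (m - w) i (k+w) * shifted_binom (m-w) j (k+w))" for i j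
  proof -
    define G where "G w = real (m choose w) * shifted_binom (m - w) i (k+w) * shifted_binom (m-w) j (k+w)" for w
    have "(\<Sum>t\<in>{a..n}. b i j t / Q ^ t * ((z - y) ^ a * T ^ (t - a)))
       = (z - y) ^ a / Q ^ a * (\<Sum>t\<in>{a..n}. b i j t * X ^ (t - a))"
      unfolding sum_distrib_left
    proof (intro sum.cong refl)
      fix t assume "t \<in> {a..n}"
      then have "Q ^ t = Q ^ a * Q ^ (t - a)" by (simp flip: power_add)
      then show "b i j t / Q ^ t * ((z - y) ^ a * T ^ (t - a)) = (z - y) ^ a / Q ^ a * (b i j t * X ^ (t - a))"
        by (simp add: X_def power_divide)
    qed
    also have "(\<Sum>t\<in>{a..n}. b i j t * X ^ (t - a)) = (\<Sum>\<theta>\<le>n-a. b i j (a + \<theta>) * X ^ \<theta>)"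
      using assms by (intro sum.reindex_bij_witness[where i="\<lambda>\<theta>. a + \<theta>" and j="\<lambda>t. t - a"]) auto
    also have "\<dots> = (\<Sum>\<theta>\<le>n-a. \<Sum>w\<le>m. (-1) ^ (\<theta> + (k - a + w)) * real ((k - a + w) choose \<theta>) * X ^ \<theta> * G w)"
      by (simp add: b_def beta_coeff_of_nat[OF assms(1,2)] beta_coeff_of_nat[OF assms(1,2), of "a + _", simplified] G_def m_def sum_distrib_left sum_distrib_right mult_ac
          del: of_nat_add)
    also have "\<dots> = (\<Sum>w\<le>m. (\<Sum>\<theta>\<le>n-a. (-1) ^ (\<theta> + (k - a + w)) * real ((k - a + w) choose \<theta>) * X ^ \<theta>) * G w)"
      by (subst sum.swap) (simp add: sum_distrib_right)
    also have "\<dots> = (\<Sum>w\<le>m. (X - 1) ^ (k - a + w) * G w)"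
      using assms by (intro sum.cong refl, subst sum_signed_binom) (auto simp: m_def)
    finally show ?thesis by (simp add: G_def mult.assoc)
  qed
  define R where "R = (1 + Q * \<xi>) * (1 + Q * \<zeta>)"
  have "(\<Sum>i\<le>n. \<Sum>j\<le>n. \<Sum>s\<le>n. \<Sum>p\<le>n. int_alpha q n a k i j (s + p) p * \<xi> ^ i * \<zeta> ^ j * y ^ s * z ^ p)
    = (\<Sum>i\<le>n. \<Sum>j\<le>n. \<xi> ^ i * \<zeta> ^ j * (\<Sum>s\<le>n. \<Sum>p\<le>n. int_alpha q n a k i j (s + p) p * y ^ s * z ^ p))"
    by (simp add: sum_distrib_left mult_ac)
  also have "\<dots> = (\<Sum>i\<le>n. \<Sum>j\<le>n. \<Sum>w\<le>m. (z - y) ^ a / Q ^ a * (X - 1) ^ (k - a + w) * real (m choose w) *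
      (shifted_binom (m - w) i (k+w) * (Q * \<xi>) ^ i) * (shifted_binom (m-w) j (k+w) * (Q * \<zeta>) ^ j))"
    unfolding inner betat by (simp add: sum_distrib_left power_mult_distrib mult_ac)
  also have "\<dots> = (\<Sum>w\<le>m. (z - y) ^ a / Q ^ a * (X - 1) ^ (k - a + w) * real (m choose w) *
     (\<Sum>i\<le>n. shifted_binom (m - w) i (k+w) * (Q * \<xi>) ^ i) * (\<Sum>j\<le>n. shifted_binom (m-w) j (k+w) * (Q * \<zeta>) ^ j))"
  proof -
    have "(\<Sum>i\<le>n. \<Sum>j\<le>n. \<Sum>w\<le>m. c w * f w i * g w j) = (\<Sum>w\<le>m. c w * (\<Sum>i\<le>n. f w i) * (\<Sum>j\<le>n. g w j))"
      for c :: "nat \<Rightarrow> real" and f g :: "nat \<Rightarrow> nat \<Rightarrow> real"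
    proof -
      have "(\<Sum>i\<le>n. \<Sum>j\<le>n. \<Sum>w\<le>m. c w * f w i * g w j) = (\<Sum>i\<le>n. \<Sum>w\<le>m. \<Sum>j\<le>n. c w * f w i * g w j)"
        by (intro sum.cong refl sum.swap)
      also have "\<dots> = (\<Sum>w\<le>m. \<Sum>i\<le>n. \<Sum>j\<le>n. c w * f w i * g w j)" by (rule sum.swap)
      finally show ?thesis by (simp add: sum_product sum_distrib_left mult_ac)
    qed
    then show ?thesis .
  qed
  also have "\<dots> = (\<Sum>w\<le>m. (z - y) ^ a / Q ^ a * (X - 1) ^ (k - a) * (Q * \<xi> * (Q * \<zeta>)) ^ k *
      (real (m choose w) * ((X - 1) * (Q * \<xi> * (Q * \<zeta>))) ^ w * R ^ (m - w)))"
  proof (intro sum.cong refl)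
    fix w assume "w \<in> {..m}"
    then have "m - w + (k + w) \<le> n" using assms by (auto simp: m_def)
    note * = sum_shifted_binom[OF this]
    show "(z - y) ^ a / Q ^ a * (X - 1) ^ (k - a + w) * real (m choose w) *
     (\<Sum>i\<le>n. shifted_binom (m - w) i (k+w) * (Q * \<xi>) ^ i) * (\<Sum>j\<le>n. shifted_binom (m-w) j (k+w) * (Q * \<zeta>) ^ j)
     = (z - y) ^ a / Q ^ a * (X - 1) ^ (k - a) * (Q * \<xi> * (Q * \<zeta>)) ^ k *
      (real (m choose w) * ((X - 1) * (Q * \<xi> * (Q * \<zeta>))) ^ w * R ^ (m - w))"
      unfolding * by (simp add: R_def power_add power_mult_distrib mult_ac)
  qed
  also have "\<dots> = (z - y) ^ a / Q ^ a * (X - 1) ^ (k - a) * (Q * \<xi> * (Q * \<zeta>)) ^ k *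
      ((X - 1) * (Q * \<xi> * (Q * \<zeta>)) + R) ^ m"
    unfolding binomial_ring by (simp add: sum_distrib_left)
  \<comment> \<open>The two terms Q^2 \<xi> \<zeta> cancel, and Q X = T.\<close>
  also have "(X - 1) * (Q * \<xi> * (Q * \<zeta>)) + R = 1 + Q * \<xi> + Q * \<zeta> + Q * \<xi> * \<zeta> * T"
    using Q by (simp add: X_def R_def field_simps)
  also have "(z - y) ^ a / Q ^ a * (X - 1) ^ (k - a) * (Q * \<xi> * (Q * \<zeta>)) ^ k
     = (\<xi> * \<zeta>) ^ k * (z - y) ^ a * (T - Q) ^ (k - a) * Q ^ k"
  proof -
    have "T - Q = Q * (X - 1)" using Q by (simp add: X_def field_simps)
    then have "(T - Q) ^ (k - a) = Q ^ (k - a) * (X - 1) ^ (k - a)"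
      by (simp only: power_mult_distrib)
    moreover have "Q ^ k = Q ^ a * Q ^ (k - a)" using assms by (simp flip: power_add)
    ultimately show ?thesis using Q by (simp add: power_mult_distrib field_simps)
  qed
  finally show ?thesis by (simp add: m_def)
qed

section \<open>Patterns of triples of words\<close>

text \<open>The tuple of u - a and v - a (see \<open>dbar_word_diff\<close>), stated through
  equalities of letters alone. This suits automorphisms, which in general move the zero
  word.\<close>

definition pattern :: "nat \<Rightarrow> word \<Rightarrow> word \<Rightarrow> word \<Rightarrow> tuple" where
  "pattern n a u v =
     (card {l. l < n \<and> u l \<noteq> a l},
      card {l. l < n \<and> v l \<noteq> a l},
      card {l. l < n \<and> u l \<noteq> a l \<and> v l \<noteq> a l},
      card {l. l < n \<and> u l = v l \<and> v l \<noteq> a l})"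

lemma card_less_split: "card {l. l < (n::nat) \<and> P l} = card {l. l < n \<and> P l \<and> Q l} + card {l. l < n \<and> P l \<and> \<not> Q l}"
  by (subst card_Un_disjoint[symmetric]) (auto intro!: arg_cong[where f=card])

text \<open>The letters of u, v and a at a coordinate satisfy one of five equality patterns; the
  other three of the eight truth assignments contradict transitivity of equality. In terms of the
  five cell sizes, membership in \<open>I\<close>, the distance formula and the comparison of
  patterns become linear arithmetic.\<close>

lemma pattern_cells:
  fixes u v a :: word and n :: nat
  defines "N \<equiv> \<lambda>b c d. card {l. l < n \<and> (u l \<noteq> a l) = b \<and> (v l \<noteq> a l) = c \<and> (u l = v l) = d}"
  shows "pattern n a u v = (N True False False + (N True True True + N True True False),
           N False True False + (N True True True + N True True False),
           N True True True + N True True False, N True True True)"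
    and "hdist n u v = N True False False + N False True False + N True True False"
    and "n = N False False True + N True False False + N False True False + N True True True + N True True False"
    and "card {l. l < n \<and> u l \<noteq> a l \<and> v l \<noteq> a l \<and> u l \<noteq> v l} = N True True False"
proof -
  have t: "card {l. l < n \<and> u l \<noteq> a l \<and> v l \<noteq> a l} = N True True True + N True True False"
    by (subst card_less_split[where Q="\<lambda>l. u l = v l"]) (simp add: N_def conj_assoc)
  have p: "card {l. l < n \<and> u l = v l \<and> v l \<noteq> a l} = N True True True"
    unfolding N_def by (rule arg_cong[where f=card]) auto
  have i: "card {l. l < n \<and> u l \<noteq> a l} = N True False False + (N True True True + N True True False)"
    unfolding t[symmetric]
    by (subst card_less_split[where Q="\<lambda>l. v l \<noteq> a l"])
       (auto simp: N_def intro!: arg_cong[where f=card])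
  have j: "card {l. l < n \<and> v l \<noteq> a l} = N False True False + (N True True True + N True True False)"
    unfolding t[symmetric]
    by (subst card_less_split[where Q="\<lambda>l. u l = a l"], rule arg_cong2[where f="(+)"])
       (auto simp: N_def intro!: arg_cong[where f=card])
  show "pattern n a u v = (N True False False + (N True True True + N True True False),
           N False True False + (N True True True + N True True False),
           N True True True + N True True False, N True True True)"
    unfolding pattern_def t p i j ..
  have d1: "card {l. l < n \<and> u l \<noteq> v l \<and> u l \<noteq> a l} = N True False False + N True True False"
    by (subst card_less_split[where Q="\<lambda>l. v l = a l"], rule arg_cong2[where f="(+)"])
       (auto simp: N_def intro!: arg_cong[where f=card])
  have d2: "card {l. l < n \<and> u l \<noteq> v l \<and> u l = a l} = N False True False"
    unfolding N_def by (rule arg_cong[where f=card]) auto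
  show "hdist n u v = N True False False + N False True False + N True True False"
    unfolding hdist_def by (subst card_less_split[where Q="\<lambda>l. u l \<noteq> a l"]) (simp add: d1 d2)
  have n1: "card {l. l < n \<and> u l = a l \<and> v l = a l} = N False False True"
    unfolding N_def by (rule arg_cong[where f=card]) auto
  have n2: "card {l. l < n \<and> u l = a l \<and> v l \<noteq> a l} = N False True False"
    unfolding N_def by (rule arg_cong[where f=card]) auto
  have n3: "card {l. l < n \<and> u l = a l} = N False False True + N False True False"
    by (subst card_less_split[where Q="\<lambda>l. v l = a l"]) (simp add: n1 n2)
  have "n = card {l. l < n \<and> True}" by simp
  also have "\<dots> = card {l. l < n \<and> u l \<noteq> a l} + card {l. l < n \<and> u l = a l}"
    by (subst card_less_split[where Q="\<lambda>l. u l \<noteq> a l"]) simp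
  finally show "n = N False False True + N True False False + N False True False + N True True True + N True True False"
    unfolding i n3 by simp
  show "card {l. l < n \<and> u l \<noteq> a l \<and> v l \<noteq> a l \<and> u l \<noteq> v l} = N True True False"
    by (simp add: N_def)
qed

lemma pattern_in_I: "pattern n a u v \<in> I n"
  unfolding pattern_cells(1) I_def mem_Collect_eq prod.case
  using pattern_cells(3)[where n=n and u=u and a=a and v=v] by (intro conjI; linarith)

text \<open>This is the third side of the triangle a, u, v, which is why the constraints evaluate x
  at (i+j-t-p,0,0,0).\<close>

lemma pattern_hdist: "pattern n a u v = (i,j,t,p) \<Longrightarrow> hdist n u v = i + j - t - p"
  unfolding pattern_cells(1) pattern_cells(2)[where a=a] prod.inject by linarith

lemma pattern_distinct:
  "pattern n a u v = (i,j,t,p) \<Longrightarrow> card {l. l < n \<and> u l \<noteq> a l \<and> v l \<noteq> a l \<and> u l \<noteq> v l} = t - p"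
  unfolding pattern_cells(1) pattern_cells(4) prod.inject by linarith

lemma dbar_pattern: "dbar n u v = pattern n (zero_word n) u v"
proof -
  have "l < n \<Longrightarrow> zero_word n l = 0" for l by (simp add: zero_word_def)
  then show ?thesis unfolding dbar_def pattern_def by (auto intro!: arg_cong[where f=card])
qed

lemma dbar_in_I: "dbar n u v \<in> I n"
  by (simp add: dbar_pattern pattern_in_I)

lemma hdist_commute: "hdist n u v = hdist n v u"
  unfolding hdist_def by (rule arg_cong[where f=card]) auto

lemma weight_dbar: "dbar n u v = (i,j,t,p) \<Longrightarrow> weight n u = i \<and> weight n v = j"
  by (auto simp: dbar_pattern pattern_def weight_def hdist_def)

lemma finite_words: "finite (words q n)"
  unfolding words_def by (rule finite_PiE) auto

lemma finite_I: "finite (I n)"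
proof (rule finite_subset)
  show "I n \<subseteq> {..n} \<times> {..n} \<times> {..n} \<times> {..n}" by (auto simp: I_def)
qed auto

section \<open>Vectors spanning the blocks\<close>

text \<open>The one-coordinate factor of the monomial \<xi>^i \<zeta>^j y^(t-p) z^p attached to the
  orbit of (u, v). Its multiplicativity over coordinates is what makes the sums over pairs of words
  factor.\<close>

definition letter_kernel :: "real \<Rightarrow> real \<Rightarrow> real \<Rightarrow> real \<Rightarrow> int \<Rightarrow> int \<Rightarrow> real" where
  "letter_kernel \<xi> \<zeta> y z c c' = (if c \<noteq> 0 then \<xi> else 1) * (if c' \<noteq> 0 then \<zeta> else 1) *
     (if c \<noteq> 0 \<and> c' \<noteq> 0 \<and> c \<noteq> c' then y else 1) * (if c = c' \<and> c' \<noteq> 0 then z else 1)"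

lemma prod_if_power:
  fixes x :: "'a :: comm_monoid_mult" and n :: nat
  shows "(\<Prod>l<n. if P l then x else 1) = x ^ card {l. l < n \<and> P l}"
proof -
  have "(\<Prod>l<n. if P l then x else 1) = (\<Prod>l\<in>{l \<in> {..<n}. P l}. x)"
    by (rule prod.inter_filter[symmetric]) simp
  then show ?thesis by simp
qed

lemma prod_letter_kernel:
  assumes "dbar n u v = (i,j,t,p)"
  shows "(\<Prod>l<n. letter_kernel \<xi> \<zeta> y z (u l) (v l)) = \<xi> ^ i * \<zeta> ^ j * y ^ (t - p) * z ^ p"
proof -
  have "card {l. l < n \<and> u l \<noteq> 0 \<and> v l \<noteq> 0 \<and> u l \<noteq> v l} = t - p"
    using pattern_distinct[of n "\<lambda>_. 0" u v i j t p] assms by (simp add: dbar_def pattern_def)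
  then show ?thesis using assms
    unfolding letter_kernel_def prod.distrib prod_if_power dbar_def by auto
qed

lemma sum_words_prod:
  "(\<Sum>u\<in>words q n. \<Sum>v\<in>words q n. \<Prod>l<n. F l (u l) (v l))
     = (\<Prod>l<n. \<Sum>c\<in>{0..<int q}. \<Sum>c'\<in>{0..<int q}. (F l c c' :: real))"
proof -
  have "(\<Sum>u\<in>words q n. \<Sum>v\<in>words q n. \<Prod>l<n. F l (u l) (v l))
     = (\<Sum>u\<in>words q n. \<Prod>l<n. \<Sum>c'\<in>{0..<int q}. F l (u l) c')"
    unfolding words_def by (subst prod_sum_PiE) auto
  also have "\<dots> = (\<Prod>l<n. \<Sum>c\<in>{0..<int q}. \<Sum>c'\<in>{0..<int q}. F l c c')"
    unfolding words_def by (subst prod_sum_PiE) auto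
  finally show ?thesis .
qed

definition zero_letter :: "int \<Rightarrow> real" where "zero_letter c = (if c = 0 then 1 else 0)"
definition nonzero_letter :: "int \<Rightarrow> real" where "nonzero_letter c = (if c = 0 then 0 else 1)"
text \<open>Sum zero on the nonzero letters, hence an eigenvector, for z - y, of the matrix with z
  on the diagonal and y elsewhere. The letters 1 and 2 exist because q \<ge> 3.\<close>

definition diff_letter :: "int \<Rightarrow> real" where
  "diff_letter c = (if c = 1 then 1 else if c = 2 then -1 else 0)"

definition letter_form :: "nat \<Rightarrow> real \<Rightarrow> real \<Rightarrow> real \<Rightarrow> real \<Rightarrow> (int \<Rightarrow> real) \<Rightarrow> (int \<Rightarrow> real) \<Rightarrow> real" where
  "letter_form q \<xi> \<zeta> y z f g = (\<Sum>c\<in>{0..<int q}. \<Sum>c'\<in>{0..<int q}. f c * g c' * letter_kernel \<xi> \<zeta> y z c c')"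

lemma letters_split: "q \<ge> 1 \<Longrightarrow> {0..<int q} = insert 0 {1..<int q}" by auto

lemma letter_form_values:
  fixes \<xi> \<zeta> y z :: real
  assumes "q \<ge> 3"
  defines "Q \<equiv> real q - 1"
  defines "T \<equiv> z + (real q - 2) * y"
  shows "letter_form q \<xi> \<zeta> y z zero_letter zero_letter = 1"
    "letter_form q \<xi> \<zeta> y z zero_letter nonzero_letter = Q * \<zeta>"
    "letter_form q \<xi> \<zeta> y z nonzero_letter zero_letter = Q * \<xi>"
    "letter_form q \<xi> \<zeta> y z nonzero_letter nonzero_letter = Q * \<xi> * \<zeta> * T"
    "letter_form q \<xi> \<zeta> y z (\<lambda>_. 1) (\<lambda>_. 1) = 1 + Q * \<xi> + Q * \<zeta> + Q * \<xi> * \<zeta> * T"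
    "letter_form q \<xi> \<zeta> y z diff_letter diff_letter = 2 * \<xi> * \<zeta> * (z - y)"
proof -
  have q: "q \<ge> 1" using assms by simp
  have real_q: "real (nat (int q - 1)) = Q" using assms by (simp add: Q_def)
  show 1: "letter_form q \<xi> \<zeta> y z zero_letter zero_letter = 1"
    unfolding letter_form_def letters_split[OF q] by (simp add: zero_letter_def letter_kernel_def)
  show 2: "letter_form q \<xi> \<zeta> y z zero_letter nonzero_letter = Q * \<zeta>"
    unfolding letter_form_def letters_split[OF q]
    by (simp add: zero_letter_def nonzero_letter_def letter_kernel_def real_q)
  show 3: "letter_form q \<xi> \<zeta> y z nonzero_letter zero_letter = Q * \<xi>"
    unfolding letter_form_def letters_split[OF q]
    by (simp add: zero_letter_def nonzero_letter_def letter_kernel_def real_q)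
  \<comment> \<open>A row of the nonzero part has one diagonal entry, with z, and q - 2 others, with
    y.\<close>
  have "(\<Sum>c'=1..<int q. letter_kernel \<xi> \<zeta> y z c c') = \<xi> * \<zeta> * T" if "c \<in> {1..<int q}" for c
  proof -
    have "(\<Sum>c'=1..<int q. letter_kernel \<xi> \<zeta> y z c c')
        = letter_kernel \<xi> \<zeta> y z c c + (\<Sum>c'\<in>{1..<int q}-{c}. letter_kernel \<xi> \<zeta> y z c c')"
      using that by (subst sum.remove[of _ c]) auto
    also have "(\<Sum>c'\<in>{1..<int q}-{c}. letter_kernel \<xi> \<zeta> y z c c') = (\<Sum>c'\<in>{1..<int q}-{c}. \<xi> * \<zeta> * y)"
      using that by (intro sum.cong) (auto simp: letter_kernel_def)
    also have "\<dots> = (real q - 2) * (\<xi> * \<zeta> * y)"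
      using that assms by (simp add: card_Diff_singleton)
    finally show ?thesis using that by (simp add: letter_kernel_def T_def algebra_simps)
  qed
  then show 4: "letter_form q \<xi> \<zeta> y z nonzero_letter nonzero_letter = Q * \<xi> * \<zeta> * T"
    unfolding letter_form_def letters_split[OF q]
    by (simp add: nonzero_letter_def real_q)
  have "letter_form q \<xi> \<zeta> y z (\<lambda>_. 1) (\<lambda>_. 1) = letter_form q \<xi> \<zeta> y z
      (\<lambda>c. zero_letter c + nonzero_letter c) (\<lambda>c. zero_letter c + nonzero_letter c)"
    unfolding letter_form_def by (intro sum.cong refl) (simp add: zero_letter_def nonzero_letter_def)
  also have "\<dots> = letter_form q \<xi> \<zeta> y z zero_letter zero_letter +
     letter_form q \<xi> \<zeta> y z nonzero_letter zero_letter + letter_form q \<xi> \<zeta> y z zero_letter nonzero_letter +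
     letter_form q \<xi> \<zeta> y z nonzero_letter nonzero_letter"
    unfolding letter_form_def by (simp add: algebra_simps sum.distrib)
  finally show "letter_form q \<xi> \<zeta> y z (\<lambda>_. 1) (\<lambda>_. 1) = 1 + Q * \<xi> + Q * \<zeta> + Q * \<xi> * \<zeta> * T"
    by (simp only: 1 2 3 4)
  have sum_diff: "(\<Sum>c\<in>{0..<int q}. diff_letter c * h c) = h 1 - h 2" for h
  proof -
    have "(\<Sum>c\<in>{0..<int q}. diff_letter c * h c) = (\<Sum>c\<in>{1,2}. diff_letter c * h c)"
      using assms by (intro sum.mono_neutral_right) (auto simp: diff_letter_def)
    then show ?thesis by (simp add: diff_letter_def)
  qed
  have "letter_form q \<xi> \<zeta> y z diff_letter diff_letter
      = (\<Sum>c\<in>{0..<int q}. diff_letter c * (\<Sum>c'\<in>{0..<int q}. diff_letter c' * letter_kernel \<xi> \<zeta> y z c c'))"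
    unfolding letter_form_def by (simp add: sum_distrib_left mult_ac)
  then show "letter_form q \<xi> \<zeta> y z diff_letter diff_letter = 2 * \<xi> * \<zeta> * (z - y)"
    unfolding sum_diff by (simp add: letter_kernel_def algebra_simps)
qed

definition block_letter :: "nat \<Rightarrow> nat \<Rightarrow> (nat \<Rightarrow> bool) \<Rightarrow> nat \<Rightarrow> int \<Rightarrow> real" where
  "block_letter a b \<epsilon> l = (if l < a then diff_letter
     else if l < a + b then (if \<epsilon> (l - a) then zero_letter else nonzero_letter)
     else if l < a + 2 * b then (if \<epsilon> (l - a - b) then nonzero_letter else zero_letter)
     else (\<lambda>_. 1))"

text \<open>The product of \<open>a\<close> factors \<open>e\<^sub>1 - e\<^sub>2\<close>, of \<open>b\<close> factors \<open>e\<^sub>0 \<otimes> h - h \<otimes> e\<^sub>0\<close> and of factors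
  \<open>e\<^sub>0 + h\<close>, where \<open>h\<close> is the sum of the unit vectors of the nonzero letters. A pair factor
  occupies the coordinates \<open>a + r\<close> and \<open>a + b + r\<close>, and \<open>\<epsilon> r\<close> selects one of its summands. The
  restrictions to words of weight \<open>i\<close> span the block.\<close>

definition block_vec :: "nat \<Rightarrow> nat \<Rightarrow> nat \<Rightarrow> word \<Rightarrow> real" where
  "block_vec n a b u = (\<Sum>\<epsilon>\<in>{..<b} \<rightarrow>\<^sub>E (UNIV :: bool set).
     (\<Prod>r<b. if \<epsilon> r then 1 else -1) * (\<Prod>l<n. block_letter a b \<epsilon> l (u l)))"

lemma block_vec_0: "block_vec n 0 0 u = 1"
  by (simp add: block_vec_def block_letter_def)

lemma prod_lessThan_add:
  fixes F :: "nat \<Rightarrow> 'a :: comm_monoid_mult"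
  shows "(\<Prod>l<a+b. F l) = (\<Prod>l<a. F l) * (\<Prod>l<b. F (a + l))"
  by (induction b) (auto simp: mult_ac)

text \<open>Expanding both vectors over their sign choices makes every term a product over
  coordinates. The first a coordinates each give the value at \<open>diff_letter\<close>, those from
  a + 2b on the value at the all-ones vector, and the two coordinates a + r and a + b + r of a pair
  are summed jointly over \<epsilon> r and \<delta> r.\<close>

lemma gf_block_vec:
  fixes \<xi> \<zeta> y z :: real
  assumes "q \<ge> 3" "a + 2 * b \<le> n"
  defines "Q \<equiv> real q - 1"
  defines "T \<equiv> z + (real q - 2) * y"
  shows "(\<Sum>u\<in>words q n. \<Sum>v\<in>words q n. block_vec n a b u * block_vec n a b v * (\<Prod>l<n. letter_kernel \<xi> \<zeta> y z (u l) (v l)))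
    = (2 * \<xi> * \<zeta> * (z - y)) ^ a * (2 * Q * \<xi> * \<zeta> * (T - Q)) ^ b * (1 + Q * \<xi> + Q * \<zeta> + Q * \<xi> * \<zeta> * T) ^ (n - a - 2 * b)"
proof -
  define E where "E = {..<b} \<rightarrow>\<^sub>E (UNIV :: bool set)"
  define L where "L = letter_form q \<xi> \<zeta> y z"
  define m where "m = n - a - 2 * b"
  define sg :: "bool \<Rightarrow> real" where "sg d = (if d then 1 else -1)" for d
  define P where "P d = (if d then zero_letter else nonzero_letter)" for d
  define R where "R d = (if d then nonzero_letter else zero_letter)" for d
  have n: "n = a + b + b + m" using assms by (simp add: m_def)
  have "(\<Sum>u\<in>words q n. \<Sum>v\<in>words q n. block_vec n a b u * block_vec n a b v * (\<Prod>l<n. letter_kernel \<xi> \<zeta> y z (u l) (v l)))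
    = (\<Sum>u\<in>words q n. \<Sum>v\<in>words q n. \<Sum>\<epsilon>\<in>E. \<Sum>\<delta>\<in>E. (\<Prod>r<b. sg (\<epsilon> r)) * (\<Prod>r<b. sg (\<delta> r)) *
        (\<Prod>l<n. block_letter a b \<epsilon> l (u l) * block_letter a b \<delta> l (v l) * letter_kernel \<xi> \<zeta> y z (u l) (v l)))"
    unfolding block_vec_def E_def[symmetric] sg_def[symmetric]
    unfolding sum_product sum_distrib_right
    by (intro sum.cong refl) (simp add: prod.distrib sum_distrib_left sum_distrib_right mult_ac)
  also have "\<dots> = (\<Sum>\<epsilon>\<in>E. \<Sum>\<delta>\<in>E. \<Sum>u\<in>words q n. \<Sum>v\<in>words q n. (\<Prod>r<b. sg (\<epsilon> r)) * (\<Prod>r<b. sg (\<delta> r)) *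
        (\<Prod>l<n. block_letter a b \<epsilon> l (u l) * block_letter a b \<delta> l (v l) * letter_kernel \<xi> \<zeta> y z (u l) (v l)))"
  proof -
    have "(\<Sum>u\<in>W. \<Sum>v\<in>W. \<Sum>\<epsilon>\<in>E. \<Sum>\<delta>\<in>E. F u v \<epsilon> \<delta>) = (\<Sum>\<epsilon>\<in>E. \<Sum>\<delta>\<in>E. \<Sum>u\<in>W. \<Sum>v\<in>W. F u v \<epsilon> \<delta>)"
      for W :: "word set" and F :: "word \<Rightarrow> word \<Rightarrow> (nat \<Rightarrow> bool) \<Rightarrow> (nat \<Rightarrow> bool) \<Rightarrow> real"
    proof -
      have *: "(\<Sum>u\<in>W. \<Sum>v\<in>W. \<Sum>\<epsilon>\<in>E. G u v \<epsilon>) = (\<Sum>\<epsilon>\<in>E. \<Sum>u\<in>W. \<Sum>v\<in>W. G u v \<epsilon>)"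
        for G :: "word \<Rightarrow> word \<Rightarrow> (nat \<Rightarrow> bool) \<Rightarrow> real"
        by (subst sum.swap[of _ E W]) (rule sum.swap)
      show ?thesis unfolding * ..
    qed
    then show ?thesis .
  qed
  also have "\<dots> = (\<Sum>\<epsilon>\<in>E. \<Sum>\<delta>\<in>E. (\<Prod>r<b. sg (\<epsilon> r)) * (\<Prod>r<b. sg (\<delta> r)) *
        (\<Prod>l<n. L (block_letter a b \<epsilon> l) (block_letter a b \<delta> l)))"
    by (simp add: L_def letter_form_def flip: sum_words_prod sum_distrib_left)
  also have "\<dots> = (\<Sum>\<epsilon>\<in>E. \<Sum>\<delta>\<in>E. L diff_letter diff_letter ^ a * L (\<lambda>_. 1) (\<lambda>_. 1) ^ m *
      (\<Prod>r<b. sg (\<epsilon> r) * sg (\<delta> r) * L (P (\<epsilon> r)) (P (\<delta> r)) * L (R (\<epsilon> r)) (R (\<delta> r))))"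
  proof (intro sum.cong refl)
    fix \<epsilon> \<delta>
    have "(\<Prod>l<n. L (block_letter a b \<epsilon> l) (block_letter a b \<delta> l))
       = (\<Prod>l<a. L diff_letter diff_letter) * (\<Prod>r<b. L (P (\<epsilon> r)) (P (\<delta> r))) * (\<Prod>r<b. L (R (\<epsilon> r)) (R (\<delta> r)))
        * (\<Prod>l<m. L (\<lambda>_. 1) (\<lambda>_. 1))"
      unfolding n prod_lessThan_add
      by (intro arg_cong2[where f="(*)"] prod.cong) (auto simp: block_letter_def P_def R_def)
    then show "(\<Prod>r<b. sg (\<epsilon> r)) * (\<Prod>r<b. sg (\<delta> r)) *
        (\<Prod>l<n. L (block_letter a b \<epsilon> l) (block_letter a b \<delta> l))
       = L diff_letter diff_letter ^ a * L (\<lambda>_. 1) (\<lambda>_. 1) ^ m *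
      (\<Prod>r<b. sg (\<epsilon> r) * sg (\<delta> r) * L (P (\<epsilon> r)) (P (\<delta> r)) * L (R (\<epsilon> r)) (R (\<delta> r)))"
      by (simp add: prod.distrib mult_ac)
  qed
  also have "\<dots> = L diff_letter diff_letter ^ a * L (\<lambda>_. 1) (\<lambda>_. 1) ^ m *
     (\<Sum>\<epsilon>\<in>E. \<Sum>\<delta>\<in>E. \<Prod>r<b. sg (\<epsilon> r) * sg (\<delta> r) * L (P (\<epsilon> r)) (P (\<delta> r)) * L (R (\<epsilon> r)) (R (\<delta> r)))"
    by (simp add: sum_distrib_left)
  also have "(\<Sum>\<epsilon>\<in>E. \<Sum>\<delta>\<in>E. \<Prod>r<b. sg (\<epsilon> r) * sg (\<delta> r) * L (P (\<epsilon> r)) (P (\<delta> r)) * L (R (\<epsilon> r)) (R (\<delta> r)))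
     = (\<Sum>\<epsilon>\<in>E. \<Prod>r<b. \<Sum>d'\<in>UNIV. sg (\<epsilon> r) * sg d' * L (P (\<epsilon> r)) (P d') * L (R (\<epsilon> r)) (R d'))"
    unfolding E_def by (subst prod_sum_PiE) auto
  also have "\<dots> = (\<Prod>r<b. \<Sum>d\<in>UNIV. \<Sum>d'\<in>UNIV. sg d * sg d' * L (P d) (P d') * L (R d) (R d'))"
    unfolding E_def by (subst prod_sum_PiE) auto
  \<comment> \<open>Each pair gives twice the determinant of the 2 x 2 matrix of values on
    \<open>zero_letter\<close> and \<open>nonzero_letter\<close>, namely Q \<xi> \<zeta> T - Q
    \<zeta> * Q \<xi>.\<close>
  also have "\<dots> = (2 * Q * \<xi> * \<zeta> * (T - Q)) ^ b"
    by (simp add: UNIV_bool P_def R_def sg_def L_def letter_form_values[OF assms(1)] flip: Q_def T_def)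
       (simp add: algebra_simps)
  also have "L diff_letter diff_letter = 2 * \<xi> * \<zeta> * (z - y)" by (simp add: L_def letter_form_values[OF assms(1)])
  also have "L (\<lambda>_. 1) (\<lambda>_. 1) = 1 + Q * \<xi> + Q * \<zeta> + Q * \<xi> * \<zeta> * T"
    by (simp add: L_def letter_form_values[OF assms(1)] Q_def T_def)
  finally show ?thesis by (simp add: m_def mult_ac)
qed

text \<open>One variable is removed at a time: the coefficients of its powers are polynomial
  functions of the remaining ones, and equal real polynomial functions have equal
  coefficients.\<close>

lemma polyfun4_eq_coeffs:
  fixes c d :: "nat \<Rightarrow> nat \<Rightarrow> nat \<Rightarrow> nat \<Rightarrow> real"
  assumes "\<And>\<xi> \<zeta> y z. (\<Sum>i\<le>n. \<Sum>j\<le>n. \<Sum>s\<le>n. \<Sum>p\<le>n. c i j s p * \<xi> ^ i * \<zeta> ^ j * y ^ s * z ^ p)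
      = (\<Sum>i\<le>n. \<Sum>j\<le>n. \<Sum>s\<le>n. \<Sum>p\<le>n. d i j s p * \<xi> ^ i * \<zeta> ^ j * y ^ s * z ^ p)"
    and "i \<le> n" "j \<le> n" "s \<le> n" "p \<le> n"
  shows "c i j s p = d i j s p"
proof -
  have step: "f i = g i" if "\<And>x. (\<Sum>i\<le>n. f i * x ^ i) = (\<Sum>i\<le>n. g i * x ^ i)" "i \<le> n"
    for f g :: "nat \<Rightarrow> real" and i
    using polyfun_eq_coeffs[of f n g] that by auto
  have 1: "(\<Sum>j\<le>n. \<Sum>s\<le>n. \<Sum>p\<le>n. c i j s p * \<zeta> ^ j * y ^ s * z ^ p)
      = (\<Sum>j\<le>n. \<Sum>s\<le>n. \<Sum>p\<le>n. d i j s p * \<zeta> ^ j * y ^ s * z ^ p)" for \<zeta> y z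
    by (rule step[where f="\<lambda>i. (\<Sum>j\<le>n. \<Sum>s\<le>n. \<Sum>p\<le>n. c i j s p * \<zeta> ^ j * y ^ s * z ^ p)" and g="\<lambda>i. (\<Sum>j\<le>n. \<Sum>s\<le>n. \<Sum>p\<le>n. d i j s p * \<zeta> ^ j * y ^ s * z ^ p)", OF _ assms(2)]) (use assms(1) in \<open>simp add: sum_distrib_left sum_distrib_right mult_ac\<close>)
  have 2: "(\<Sum>s\<le>n. \<Sum>p\<le>n. c i j s p * y ^ s * z ^ p) = (\<Sum>s\<le>n. \<Sum>p\<le>n. d i j s p * y ^ s * z ^ p)" for y z
    by (rule step[where f="\<lambda>j. (\<Sum>s\<le>n. \<Sum>p\<le>n. c i j s p * y ^ s * z ^ p)" and g="\<lambda>j. (\<Sum>s\<le>n. \<Sum>p\<le>n. d i j s p * y ^ s * z ^ p)", OF _ assms(3)]) (use 1 in \<open>simp add: sum_distrib_left sum_distrib_right mult_ac\<close>)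
  have 3: "(\<Sum>p\<le>n. c i j s p * z ^ p) = (\<Sum>p\<le>n. d i j s p * z ^ p)" for z
    by (rule step[where f="\<lambda>s. (\<Sum>p\<le>n. c i j s p * z ^ p)" and g="\<lambda>s. (\<Sum>p\<le>n. d i j s p * z ^ p)", OF _ assms(4)]) (use 2 in \<open>simp add: sum_distrib_left sum_distrib_right mult_ac\<close>)
  show ?thesis by (rule step[OF 3 assms(5)])
qed

text \<open>Coefficient comparison of \<open>gf_block_vec\<close> with \<open>gf_int_alpha\<close>.
  Each of the a difference factors and k - a pair factors contributes a 2, and the vectors supply
  Q^(k-a) where the coefficients have Q^k; hence 2^k / Q^a.\<close>

lemma sum_block_vec:
  assumes "q \<ge> 3" "a \<le> k" "2 * k \<le> n + a" "(i,j,t,p) \<in> I n"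
  shows "(\<Sum>(u,v) | (u,v) \<in> words q n \<times> words q n \<and> dbar n u v = (i,j,t,p). block_vec n a (k-a) u * block_vec n a (k-a) v)
     = 2 ^ k / (real q - 1) ^ a * int_alpha q n a k i j t p"
proof -
  define W where "W = words q n"
  define Q where "Q = real q - 1"
  define V where "V = block_vec n a (k - a)"
  define c where "c i j s p = (\<Sum>(u,v) | (u,v) \<in> W \<times> W \<and> dbar n u v = (i,j,s+p,p). V u * V v)" for i j s p
  have Q: "Q > 0" using assms by (simp add: Q_def)
  have "c i j (t - p) p = 2 ^ k / Q ^ a * int_alpha q n a k i j (t - p + p) p"
  proof (rule polyfun4_eq_coeffs[where n = n and c = c and d = "\<lambda>i j s p. 2 ^ k / Q ^ a * int_alpha q n a k i j (s + p) p"])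
    fix \<xi> \<zeta> y z :: real
    define T where "T = z + (real q - 2) * y"
    define f where "f = (\<lambda>(i,j,s,p). \<xi> ^ i * \<zeta> ^ j * y ^ s * z ^ p)"
    \<comment> \<open>Replaces t by t - p to match the exponents. On \<open>I n\<close> this is
      injective, since p \<le> t.\<close>
    define h where "h = (\<lambda>(u,v). case dbar n u v of (i,j,t,p) \<Rightarrow> (i,j,t-p,p))"
    have "(\<Sum>i\<le>n. \<Sum>j\<le>n. \<Sum>s\<le>n. \<Sum>p\<le>n. c i j s p * \<xi> ^ i * \<zeta> ^ j * y ^ s * z ^ p)
       = (\<Sum>(i,j,s,p)\<in>{..n}\<times>{..n}\<times>{..n}\<times>{..n}. c i j s p * f (i,j,s,p))"
      by (simp add: sum.cartesian_product f_def mult.assoc)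
    also have "\<dots> = (\<Sum>\<tau>\<in>{..n}\<times>{..n}\<times>{..n}\<times>{..n}. \<Sum>x | x \<in> W \<times> W \<and> h x = \<tau>. V (fst x) * V (snd x) * f (h x))"
    proof (intro sum.cong refl, clarify)
      fix i j s p
      have "{x \<in> W \<times> W. h x = (i,j,s,p)} = {(u,v). (u,v) \<in> W \<times> W \<and> dbar n u v = (i,j,s+p,p)}"
        using dbar_in_I[of n] by (fastforce simp: h_def I_def split: prod.splits)
      note eq = this[symmetric]
      show "c i j s p * f (i,j,s,p) = (\<Sum>x | x \<in> W \<times> W \<and> h x = (i,j,s,p). V (fst x) * V (snd x) * f (h x))"
        unfolding c_def sum_distrib_right by (rule sum.cong[OF eq]) auto
    qed
    also have "\<dots> = (\<Sum>x\<in>W \<times> W. V (fst x) * V (snd x) * f (h x))"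
    proof (rule sum.group)
      show "h ` (W \<times> W) \<subseteq> {..n}\<times>{..n}\<times>{..n}\<times>{..n}"
        using dbar_in_I[of n] by (fastforce simp: h_def I_def split: prod.splits)
    qed (auto simp: W_def finite_words)
    also have "\<dots> = (\<Sum>u\<in>W. \<Sum>v\<in>W. V u * V v * (\<Prod>l<n. letter_kernel \<xi> \<zeta> y z (u l) (v l)))"
      unfolding sum.cartesian_product
    proof (intro sum.cong refl, clarify)
      fix u v
      obtain i j t p where "dbar n u v = (i,j,t,p)" by (metis prod_cases4)
      with prod_letter_kernel[OF this] show "V (fst (u,v)) * V (snd (u,v)) * f (h (u,v))
        = V u * V v * (\<Prod>l<n. letter_kernel \<xi> \<zeta> y z (u l) (v l))"
        by (simp add: f_def h_def)
    qed
    also have "\<dots> = (2 * \<xi> * \<zeta> * (z - y)) ^ a * (2 * Q * \<xi> * \<zeta> * (T - Q)) ^ (k - a) *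
        (1 + Q * \<xi> + Q * \<zeta> + Q * \<xi> * \<zeta> * T) ^ (n - a - 2 * (k - a))"
      unfolding W_def V_def Q_def T_def using assms by (intro gf_block_vec) auto
    also have "n - a - 2 * (k - a) = n + a - 2 * k" using assms by auto
    also have "(2 * \<xi> * \<zeta> * (z - y)) ^ a * (2 * Q * \<xi> * \<zeta> * (T - Q)) ^ (k - a) =
       2 ^ k / Q ^ a * ((\<xi> * \<zeta>) ^ k * (z - y) ^ a * (T - Q) ^ (k - a) * Q ^ k)"
    proof -
      have pk: "x ^ k = x ^ a * x ^ (k - a)" for x :: real using assms by (simp flip: power_add)
      have "(2 * \<xi> * \<zeta> * D) ^ a * (2 * Q * \<xi> * \<zeta> * E) ^ (k - a) =
         2 ^ k / Q ^ a * ((\<xi> * \<zeta>) ^ k * D ^ a * E ^ (k - a) * Q ^ k)" for D E :: real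
        unfolding pk using Q by (simp add: power_mult_distrib mult_ac)
      then show ?thesis .
    qed
    also have "2 ^ k / Q ^ a * ((\<xi> * \<zeta>) ^ k * (z - y) ^ a * (T - Q) ^ (k - a) * Q ^ k) *
        (1 + Q * \<xi> + Q * \<zeta> + Q * \<xi> * \<zeta> * T) ^ (n + a - 2 * k)
       = 2 ^ k / Q ^ a * (\<Sum>i\<le>n. \<Sum>j\<le>n. \<Sum>s\<le>n. \<Sum>p\<le>n. int_alpha q n a k i j (s + p) p * \<xi> ^ i * \<zeta> ^ j * y ^ s * z ^ p)"
      using gf_int_alpha[where z=z and y=y and \<xi>=\<xi> and \<zeta>=\<zeta>, OF assms(2,3), of q] assms by (simp add: Q_def T_def)
    also have "\<dots> = (\<Sum>i\<le>n. \<Sum>j\<le>n. \<Sum>s\<le>n. \<Sum>p\<le>n. 2 ^ k / Q ^ a * int_alpha q n a k i j (s + p) p * \<xi> ^ i * \<zeta> ^ j * y ^ s * z ^ p)"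
      by (simp add: sum_distrib_left mult.assoc)
    finally show "(\<Sum>i\<le>n. \<Sum>j\<le>n. \<Sum>s\<le>n. \<Sum>p\<le>n. c i j s p * \<xi> ^ i * \<zeta> ^ j * y ^ s * z ^ p) =
       (\<Sum>i\<le>n. \<Sum>j\<le>n. \<Sum>s\<le>n. \<Sum>p\<le>n. 2 ^ k / Q ^ a * int_alpha q n a k i j (s + p) p * \<xi> ^ i * \<zeta> ^ j * y ^ s * z ^ p)" .
  qed (use assms in \<open>auto simp: I_def\<close>)
  then show ?thesis using assms by (simp add: c_def I_def W_def V_def Q_def)
qed

section \<open>Sizes of the orbits\<close>

lemma binomial_ring_le:
  fixes x y :: real
  assumes "N \<le> n"
  shows "(x + y) ^ N = (\<Sum>k\<le>n. real (N choose k) * x ^ k * y ^ (N - k))"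
  unfolding binomial_ring
  using assms by (intro sum.mono_neutral_left) (auto simp: binomial_eq_0)

lemma binomial_chain_multinom:
  "real (n choose p) * real (n - p choose s) * real (n - p - s choose b) * real (n - p - s - b choose c)
     = (if p + s + b + c \<le> n then multinom n p s b c else 0)"
proof (cases "p + s + b + c \<le> n")
  case True
  then have "p \<le> n" "s \<le> n - p" "b \<le> n - p - s" "c \<le> n - p - s - b" by auto
  then show ?thesis using True
    by (simp add: binomial_fact multinom_def field_simps)
next
  case False
  then have "n < p \<or> n - p < s \<or> n - p - s < b \<or> n - p - s - b < c" by auto
  then show ?thesis using False by (auto simp: binomial_eq_0)
qed

text \<open>The binomial theorem peels off D, C, A and B in turn. All indices run up to n so that
  \<open>polyfun4_eq_coeffs\<close> applies; the conditional discards combinations with total above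
  n.\<close>

lemma multinomial_expansion:
  fixes A B C D :: real
  shows "(1 + A + B + C + D) ^ n = (\<Sum>b\<le>n. \<Sum>c\<le>n. \<Sum>s\<le>n. \<Sum>p\<le>n.
    (if p + s + b + c \<le> n then multinom n p s b c else 0) * A ^ b * B ^ c * C ^ s * D ^ p)"
proof -
  have 1: "(A + (B + 1)) ^ N = (\<Sum>b\<le>n. \<Sum>c\<le>n. real (N choose b) * real (N - b choose c) * A ^ b * B ^ c)"
    if "N \<le> n" for N
  proof -
    have "(A + (B + 1)) ^ N = (\<Sum>b\<le>n. real (N choose b) * A ^ b * (B + 1) ^ (N - b))"
      by (rule binomial_ring_le[OF that])
    also have "\<dots> = (\<Sum>b\<le>n. real (N choose b) * A ^ b * (\<Sum>c\<le>n. real (N - b choose c) * B ^ c))"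
    proof (intro sum.cong refl)
      fix b
      have "N - b \<le> n" using that by simp
      from binomial_ring_le[OF this, of B 1]
      show "real (N choose b) * A ^ b * (B + 1) ^ (N - b) =
        real (N choose b) * A ^ b * (\<Sum>c\<le>n. real (N - b choose c) * B ^ c)" by simp
    qed
    finally show ?thesis by (simp add: sum_distrib_left mult_ac)
  qed
  have 2: "(C + (A + (B + 1))) ^ N = (\<Sum>s\<le>n. \<Sum>b\<le>n. \<Sum>c\<le>n. real (N choose s) * real (N - s choose b) * real (N - s - b choose c) * A ^ b * B ^ c * C ^ s)"
    if "N \<le> n" for N
  proof -
    have "(C + (A + (B + 1))) ^ N = (\<Sum>s\<le>n. real (N choose s) * C ^ s * (A + (B + 1)) ^ (N - s))"
      by (rule binomial_ring_le[OF that])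
    also have "\<dots> = (\<Sum>s\<le>n. real (N choose s) * C ^ s * (\<Sum>b\<le>n. \<Sum>c\<le>n. real (N - s choose b) * real (N - s - b choose c) * A ^ b * B ^ c))"
      using that by (intro sum.cong refl, subst 1) auto
    finally show ?thesis by (simp add: sum_distrib_left mult_ac)
  qed
  have "(1 + A + B + C + D) ^ n = (D + (C + (A + (B + 1)))) ^ n" by (simp add: algebra_simps)
  also have "\<dots> = (\<Sum>p\<le>n. real (n choose p) * D ^ p * (C + (A + (B + 1))) ^ (n - p))"
    by (rule binomial_ring_le) simp
  also have "\<dots> = (\<Sum>p\<le>n. real (n choose p) * D ^ p * (\<Sum>s\<le>n. \<Sum>b\<le>n. \<Sum>c\<le>n.
      real (n - p choose s) * real (n - p - s choose b) * real (n - p - s - b choose c) * A ^ b * B ^ c * C ^ s))"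
    by (intro sum.cong refl, subst 2) auto
  also have "\<dots> = (\<Sum>p\<le>n. \<Sum>s\<le>n. \<Sum>b\<le>n. \<Sum>c\<le>n.
      (real (n choose p) * real (n - p choose s) * real (n - p - s choose b) * real (n - p - s - b choose c)) * A ^ b * B ^ c * C ^ s * D ^ p)"
    by (simp add: sum_distrib_left mult_ac)
  also have "\<dots> = (\<Sum>(p,s)\<in>{..n}\<times>{..n}. \<Sum>(b,c)\<in>{..n}\<times>{..n}.
      (if p + s + b + c \<le> n then multinom n p s b c else 0) * A ^ b * B ^ c * C ^ s * D ^ p)"
    unfolding binomial_chain_multinom by (simp only: sum.cartesian_product[symmetric])
  also have "\<dots> = (\<Sum>(b,c)\<in>{..n}\<times>{..n}. \<Sum>(p,s)\<in>{..n}\<times>{..n}.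
      (if p + s + b + c \<le> n then multinom n p s b c else 0) * A ^ b * B ^ c * C ^ s * D ^ p)"
    unfolding case_prod_unfold by (rule sum.swap)
  also have "\<dots> = (\<Sum>b\<le>n. \<Sum>c\<le>n. \<Sum>p\<le>n. \<Sum>s\<le>n.
      (if p + s + b + c \<le> n then multinom n p s b c else 0) * A ^ b * B ^ c * C ^ s * D ^ p)"
    by (simp only: sum.cartesian_product[symmetric])
  also have "\<dots> = (\<Sum>b\<le>n. \<Sum>c\<le>n. \<Sum>s\<le>n. \<Sum>p\<le>n.
    (if p + s + b + c \<le> n then multinom n p s b c else 0) * A ^ b * B ^ c * C ^ s * D ^ p)"
    by (rule sum.cong[OF refl], rule sum.cong[OF refl], rule sum.swap)
  finally show ?thesis .
qed

definition orbit_size :: "nat \<Rightarrow> nat \<Rightarrow> tuple \<Rightarrow> real" where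
  "orbit_size q n = (\<lambda>(i,j,t,p). (real q - 1) ^ (i + j - t) * (real q - 2) ^ (t - p) *
        multinom n p (t - p) (i - t) (j - t))"

text \<open>The same method with weights recording only the type of a coordinate: the sum over
  letter pairs is 1 + Q x + Q w + Q (q - 2) y + Q z, and its n-th power is expanded
  multinomially.\<close>

lemma card_dbar_eq:
  assumes "q \<ge> 3" "\<tau> \<in> I n"
  shows "real (card {x \<in> words q n \<times> words q n. dbar n (fst x) (snd x) = \<tau>}) = orbit_size q n \<tau>"
proof -
  define W where "W = words q n"
  define Q where "Q = real q - 1"
  define D where "D = (\<lambda>x. dbar n (fst x) (snd x))"
  define c where "c b c' s p = real (card {x \<in> W \<times> W. D x = (b+s+p,c'+s+p,s+p,p)})" for b c' s p
  define d where "d b c' s p = (if p + s + b + c' \<le> n then multinom n p s b c' else 0) * Q ^ b * Q ^ c' * (Q * (real q - 2)) ^ s * Q ^ p" for b c' s p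
  have eq: "c b c' s p = d b c' s p" if "b \<le> n" "c' \<le> n" "s \<le> n" "p \<le> n" for b c' s p
  proof (rule polyfun4_eq_coeffs[OF _ that])
    fix x w y z :: real
    \<comment> \<open>Here x and w mark coordinates where exactly one letter is nonzero. The
      exponents are therefore i - t, j - t, t - p and p, the lower entries of the multinomial
      coefficient up to order.\<close>
    define F where "F c c' = (if c \<noteq> 0 \<and> c' = 0 then x else 1) * (if c = 0 \<and> c' \<noteq> 0 then w else 1) *
       (if c \<noteq> 0 \<and> c' \<noteq> 0 \<and> c \<noteq> c' then y else 1) * (if c = c' \<and> c' \<noteq> 0 then z else 1)" for c c' :: int
    define f where "f = (\<lambda>(b,c,s,p). x ^ b * w ^ c * y ^ s * z ^ p)"
    define h where "h = (\<lambda>x. case D x of (i,j,t,p) \<Rightarrow> (i-t,j-t,t-p,p))"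
    have D_I: "D x \<in> I n" for x by (simp add: D_def dbar_in_I)
    have "(\<Sum>b\<le>n. \<Sum>c'\<le>n. \<Sum>s\<le>n. \<Sum>p\<le>n. c b c' s p * x ^ b * w ^ c' * y ^ s * z ^ p)
       = (\<Sum>(b,c',s,p)\<in>{..n}\<times>{..n}\<times>{..n}\<times>{..n}. c b c' s p * f (b,c',s,p))"
      by (simp add: sum.cartesian_product f_def mult.assoc)
    also have "\<dots> = (\<Sum>\<tau>\<in>{..n}\<times>{..n}\<times>{..n}\<times>{..n}. \<Sum>x | x \<in> W \<times> W \<and> h x = \<tau>. f (h x))"
    proof (intro sum.cong refl, clarify)
      fix b c' s p
      have "D x = (b+s+p,c'+s+p,s+p,p) \<longleftrightarrow> h x = (b,c',s,p)" for x
        using D_I[of x] by (auto simp: h_def I_def split: prod.splits)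
      then have "{x \<in> W \<times> W. D x = (b+s+p,c'+s+p,s+p,p)} = {x \<in> W \<times> W. h x = (b,c',s,p)}"
        by simp
      then show "c b c' s p * f (b,c',s,p) = (\<Sum>x | x \<in> W \<times> W \<and> h x = (b,c',s,p). f (h x))"
        by (simp add: c_def)
    qed
    also have "\<dots> = (\<Sum>x\<in>W \<times> W. f (h x))"
    proof (rule sum.group)
      show "h ` (W \<times> W) \<subseteq> {..n}\<times>{..n}\<times>{..n}\<times>{..n}"
        using D_I by (fastforce simp: h_def I_def split: prod.splits)
    qed (auto simp: W_def finite_words)
    also have "\<dots> = (\<Sum>u\<in>W. \<Sum>v\<in>W. \<Prod>l<n. F (u l) (v l))"
      unfolding sum.cartesian_product
    proof (intro sum.cong refl, clarify)
      fix u v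
      obtain i j t p where D: "dbar n u v = (i,j,t,p)" by (metis prod_cases4)
      have "card {l. l < n \<and> u l \<noteq> 0 \<and> v l \<noteq> 0 \<and> u l \<noteq> v l} = t - p"
        using pattern_distinct[of n "\<lambda>_. 0" u v i j t p] D by (simp add: dbar_def pattern_def)
      moreover have "card {l. l < n \<and> u l \<noteq> 0 \<and> v l = 0} = i - t"
        using card_less_split[of n "\<lambda>l. u l \<noteq> 0" "\<lambda>l. v l \<noteq> 0"] D
        unfolding dbar_def prod.inject not_not by linarith
      moreover have "card {l. l < n \<and> u l = 0 \<and> v l \<noteq> 0} = j - t"
        using card_less_split[of n "\<lambda>l. v l \<noteq> 0" "\<lambda>l. u l \<noteq> 0"] D
        unfolding dbar_def prod.inject not_not conj_commute[of "v _ \<noteq> 0" "u _ \<noteq> 0"] conj_commute[of "v _ \<noteq> 0" "u _ = 0"]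
        by linarith
      ultimately show "f (h (u,v)) = (\<Prod>l<n. F (u l) (v l))" using D
        unfolding F_def prod.distrib prod_if_power by (simp add: f_def h_def D_def dbar_def)
    qed
    also have "\<dots> = (\<Prod>l<n. \<Sum>c\<in>{0..<int q}. \<Sum>c'\<in>{0..<int q}. F c c')"
      unfolding W_def by (rule sum_words_prod)
    also have "(\<Sum>c\<in>{0..<int q}. \<Sum>c'\<in>{0..<int q}. F c c')
       = letter_form q 1 1 y z zero_letter zero_letter + x * letter_form q 1 1 y z nonzero_letter zero_letter
       + w * letter_form q 1 1 y z zero_letter nonzero_letter + letter_form q 1 1 y z nonzero_letter nonzero_letter"
      unfolding letter_form_def sum_distrib_left sum.distrib[symmetric]
      by (intro sum.cong refl) (auto simp: F_def letter_kernel_def zero_letter_def nonzero_letter_def)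
    also have "\<dots> = 1 + Q * x + Q * w + Q * (real q - 2) * y + Q * z"
      by (simp add: letter_form_values[OF assms(1)] Q_def algebra_simps)
    also have "(\<Prod>l<n. 1 + Q * x + Q * w + Q * (real q - 2) * y + Q * z) = (1 + Q * x + Q * w + Q * (real q - 2) * y + Q * z) ^ n"
      by simp
    also have "\<dots> = (\<Sum>b\<le>n. \<Sum>c'\<le>n. \<Sum>s\<le>n. \<Sum>p\<le>n. d b c' s p * x ^ b * w ^ c' * y ^ s * z ^ p)"
      unfolding multinomial_expansion d_def by (simp add: power_mult_distrib mult_ac)
    finally show "(\<Sum>b\<le>n. \<Sum>c'\<le>n. \<Sum>s\<le>n. \<Sum>p\<le>n. c b c' s p * x ^ b * w ^ c' * y ^ s * z ^ p)
       = (\<Sum>b\<le>n. \<Sum>c'\<le>n. \<Sum>s\<le>n. \<Sum>p\<le>n. d b c' s p * x ^ b * w ^ c' * y ^ s * z ^ p)" .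
  qed
  obtain i j t p where \<tau>: "\<tau> = (i,j,t,p)" by (metis prod_cases4)
  have "p \<le> t" "t \<le> i" "t \<le> j" "i + j \<le> n + t" using assms \<tau> by (auto simp: I_def)
  moreover from this have "Q ^ (i + j - t) = Q ^ (i - t) * Q ^ (j - t) * Q ^ (t - p) * Q ^ p"
    by (simp flip: power_add)
  moreover from calculation have "p + (t - p) + (i - t) + (j - t) \<le> n" "i - t \<le> n" "j - t \<le> n" "t - p \<le> n" "p \<le> n"
    by auto
  ultimately show ?thesis using eq[of "i-t" "j-t" "t-p" p]
    by (simp add: \<tau> c_def d_def D_def W_def orbit_size_def power_mult_distrib flip: Q_def)
qed

lemma zero_word_in_words: "q \<ge> 1 \<Longrightarrow> zero_word n \<in> words q n"
  by (auto simp: zero_word_def words_def)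

lemma weight_zero_word: "weight n (zero_word n) = 0"
  by (simp add: weight_def hdist_def)

lemma words_eqI: "u \<in> words q n \<Longrightarrow> v \<in> words q n \<Longrightarrow> (\<And>l. l < n \<Longrightarrow> u l = v l) \<Longrightarrow> u = v"
  unfolding words_def by (erule (1) PiE_ext) simp

lemma dbar_weight_0: "dbar n u v = (i,0,0,0) \<longleftrightarrow> weight n u = i \<and> weight n v = 0"
proof -
  have "dbar n u v \<in> I n" by (rule dbar_in_I)
  then show ?thesis
    by (cases "dbar n u v") (auto dest: weight_dbar simp: I_def)
qed

lemma weight_eq_0: "v \<in> words q n \<Longrightarrow> q \<ge> 1 \<Longrightarrow> weight n v = 0 \<longleftrightarrow> v = zero_word n"
  by (auto simp: weight_zero_word weight_def hdist_def intro!: words_eqI zero_word_in_words)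

text \<open>A word of weight i corresponds to its pair with the zero word, whose tuple is
  (i,0,0,0).\<close>

lemma card_weight:
  assumes "q \<ge> 3" "i \<le> n"
  shows "real (card {u \<in> words q n. weight n u = i}) = real (n choose i) * (real q - 1) ^ i"
proof -
  have "{x \<in> words q n \<times> words q n. dbar n (fst x) (snd x) = (i,0,0,0)}
      = (\<lambda>u. (u, zero_word n)) ` {u \<in> words q n. weight n u = i}"
    using assms by (auto simp: dbar_weight_0 weight_eq_0 weight_zero_word zero_word_in_words)
  then have "card {x \<in> words q n \<times> words q n. dbar n (fst x) (snd x) = (i,0,0,0)}
     = card {u \<in> words q n. weight n u = i}"
    by (simp add: card_image inj_on_def)
  then show ?thesis using card_dbar_eq[of q "(i,0,0,0)" n] assms
    by (simp add: orbit_size_def I_def multinom_def binomial_fact)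
qed

lemma weight_le: "weight n u \<le> n"
  using card_mono[of "{..<n}" "{l. l < n \<and> u l \<noteq> zero_word n l}"] by (auto simp: weight_def hdist_def)

lemma sum_words_weight:
  assumes "q \<ge> 3"
  shows "(\<Sum>u\<in>words q n. F (weight n u)) = (\<Sum>i\<in>{0..n}. real (n choose i) * (real q - 1) ^ i * F i)"
proof -
  have "(\<Sum>u\<in>words q n. F (weight n u)) = (\<Sum>i\<in>{0..n}. \<Sum>u | u \<in> words q n \<and> weight n u = i. F (weight n u))"
    by (rule sum.group[symmetric]) (auto simp: finite_words weight_le)
  also have "\<dots> = (\<Sum>i\<in>{0..n}. real (n choose i) * (real q - 1) ^ i * F i)"
    using assms by (intro sum.cong refl) (simp add: card_weight)
  finally show ?thesis .
qed

lemma sum_pairs_dbar: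
  "(\<Sum>u\<in>words q n. \<Sum>v\<in>words q n. g u v * f (dbar n u v)) =
   (\<Sum>\<tau>\<in>I n. f \<tau> * (\<Sum>x | x \<in> words q n \<times> words q n \<and> dbar n (fst x) (snd x) = \<tau>. g (fst x) (snd x) :: real))"
proof -
  have "(\<Sum>u\<in>words q n. \<Sum>v\<in>words q n. g u v * f (dbar n u v))
     = (\<Sum>x\<in>words q n \<times> words q n. g (fst x) (snd x) * f (dbar n (fst x) (snd x)))"
    by (simp add: sum.cartesian_product case_prod_unfold)
  also have "\<dots> = (\<Sum>\<tau>\<in>I n. \<Sum>x | x \<in> words q n \<times> words q n \<and> dbar n (fst x) (snd x) = \<tau>. g (fst x) (snd x) * f (dbar n (fst x) (snd x)))"
    by (rule sum.group[symmetric]) (auto simp: finite_words finite_I dbar_in_I)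
  also have "\<dots> = (\<Sum>\<tau>\<in>I n. f \<tau> * (\<Sum>x | x \<in> words q n \<times> words q n \<and> dbar n (fst x) (snd x) = \<tau>. g (fst x) (snd x)))"
    unfolding sum_distrib_left by (intro sum.cong refl) (auto simp: mult.commute)
  finally show ?thesis .
qed

section \<open>Positive semidefinite blocks\<close>

lemma I_Sigma: "I n = (SIGMA i:{0..n}. SIGMA j:{0..n}. {(t,p). (i,j,t,p) \<in> I n})"
  by (auto simp: I_def)

lemma sum_I: "(\<Sum>\<tau>\<in>I n. (h \<tau> :: real)) = (\<Sum>i\<in>{0..n}. \<Sum>j\<in>{0..n}. \<Sum>(t,p)\<in>{(t,p). (i,j,t,p) \<in> I n}. h (i,j,t,p))"
proof -
  have fin: "finite {(t,p). (i,j,t,p) \<in> I n}" for i j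
    by (rule finite_subset[of _ "{..n}\<times>{..n}"]) (auto simp: I_def)
  show ?thesis
    by (subst I_Sigma) (use fin in \<open>simp add: sum.Sigma case_prod_unfold\<close>)
qed

lemma block_commute:
  assumes "\<And>i j t p. (i,j,t,p) \<in> I n \<Longrightarrow> f (i,j,t,p) = f (j,i,t,p)"
  shows "block q n a k f i j = block q n a k f j i"
proof -
  have "alpha_coeff q' n' i' j' t p a' k' = alpha_coeff q' n' j' i' t p a' k'" for q' n' i' j' t p a' k'
    by (simp add: alpha_coeff_def beta_coeff_def mult_ac add.commute)
  moreover have "(i,j,t,p) \<in> I n \<longleftrightarrow> (j,i,t,p) \<in> I n" for t p
    by (auto simp: I_def)
  ultimately show ?thesis unfolding block_def
    by (intro sum.cong) (auto intro!: arg_cong2[where f="(*)"] assms)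
qed

text \<open>The matrix f (dbar u v) is constant on orbits, so its quadratic form on weighted
  restrictions of \<open>block_vec\<close> regroups into the orbit sums of
  \<open>sum_block_vec\<close>. Dividing by (q-1)^(weight/2) undoes the diagonal scaling of
  \<open>int_alpha\<close>.\<close>

lemma quadratic_form_block:
  fixes w :: "nat \<Rightarrow> real"
  assumes "q \<ge> 3" "a \<le> k" "2 * k \<le> n + a"
  defines "X \<equiv> \<lambda>u. w (weight n u) / (real q - 1) powr (real (weight n u) / 2) * block_vec n a (k - a) u"
  shows "(\<Sum>u\<in>words q n. \<Sum>v\<in>words q n. X u * f (dbar n u v) * X v)
      = 2 ^ k / (real q - 1) ^ a * (\<Sum>i\<in>{0..n}. \<Sum>j\<in>{0..n}. w i * block q n a k f i j * w j)"
proof -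
  define Q where "Q = real q - 1"
  define V where "V = block_vec n a (k - a)"
  define r where "r i = Q powr (real i / 2)" for i
  have r: "r i > 0" for i using assms by (simp add: r_def Q_def)
  define g where "g = (\<lambda>(i,j,t,p). w i / r i * (w j / r j) * f (i,j,t,p))"
  have "(\<Sum>u\<in>words q n. \<Sum>v\<in>words q n. X u * f (dbar n u v) * X v)
     = (\<Sum>u\<in>words q n. \<Sum>v\<in>words q n. V u * V v * g (dbar n u v))"
  proof (intro sum.cong refl)
    fix u v
    obtain i j t p where D: "dbar n u v = (i,j,t,p)" by (metis prod_cases4)
    with weight_dbar[OF D] show "X u * f (dbar n u v) * X v = V u * V v * g (dbar n u v)"
      by (simp add: X_def g_def V_def r_def Q_def)
  qed
  also have "\<dots> = (\<Sum>\<tau>\<in>I n. g \<tau> * (\<Sum>x | x \<in> words q n \<times> words q n \<and> dbar n (fst x) (snd x) = \<tau>. V (fst x) * V (snd x)))"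
    by (rule sum_pairs_dbar)
  also have "\<dots> = (\<Sum>(i,j,t,p)\<in>I n. 2 ^ k / Q ^ a * (w i * (alpha_coeff (int q) (int n) (int i) (int j) (int t) (int p) (int a) (int k) * f (i,j,t,p)) * w j))"
  proof (rule sum.cong[OF refl], clarify)
    fix i j t p assume "(i,j,t,p) \<in> I n"
    from sum_block_vec[OF assms(1-3) this]
    have *: "(\<Sum>x | x \<in> words q n \<times> words q n \<and> dbar n (fst x) (snd x) = (i,j,t,p). V (fst x) * V (snd x))
       = 2 ^ k / Q ^ a * (r i * r j * alpha_coeff (int q) (int n) (int i) (int j) (int t) (int p) (int a) (int k))"
      using assms(1) by (simp add: int_alpha_eq V_def Q_def r_def case_prod_unfold mem_Times_iff)
    show "g (i,j,t,p) * (\<Sum>x | x \<in> words q n \<times> words q n \<and> dbar n (fst x) (snd x) = (i,j,t,p). V (fst x) * V (snd x)) =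
       2 ^ k / Q ^ a * (w i * (alpha_coeff (int q) (int n) (int i) (int j) (int t) (int p) (int a) (int k) * f (i,j,t,p)) * w j)"
      unfolding * using r[of i] r[of j] by (simp add: g_def)
  qed
  also have "\<dots> = 2 ^ k / Q ^ a * (\<Sum>i\<in>{0..n}. \<Sum>j\<in>{0..n}. w i * block q n a k f i j * w j)"
    unfolding sum_I block_def prod.case by (simp add: sum_distrib_left sum_distrib_right case_prod_unfold)
  finally show ?thesis by (simp add: Q_def)
qed

lemma psd_block:
  assumes "q \<ge> 3" "a \<le> k" "2 * k \<le> n + a"
    and sym: "\<And>i j t p. (i,j,t,p) \<in> I n \<Longrightarrow> f (i,j,t,p) = f (j,i,t,p)"
    and nonneg: "\<And>X. 0 \<le> (\<Sum>u\<in>words q n. \<Sum>v\<in>words q n. X u * f (dbar n u v) * X v)"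
  shows "psd {k..n + a - k} (block q n a k f)"
  unfolding psd_def
proof (intro conjI ballI allI)
  fix i j
  show "block q n a k f i j = block q n a k f j i" by (rule block_commute) (rule sym)
next
  fix w :: "nat \<Rightarrow> real"
  \<comment> \<open>Extension by zero, because \<open>quadratic_form_block\<close> runs over all
    weights 0..n and the block only over k..n+a-k.\<close>
  define w' where "w' i = (if i \<in> {k..n+a-k} then w i else 0)" for i
  define X where "X = (\<lambda>u. w' (weight n u) / (real q - 1) powr (real (weight n u) / 2) * block_vec n a (k - a) u)"
  have sub: "{k..n+a-k} \<subseteq> {0..n}" using assms by auto
  have "0 \<le> (\<Sum>u\<in>words q n. \<Sum>v\<in>words q n. X u * f (dbar n u v) * X v)" by (rule nonneg)
  also have "\<dots> = 2 ^ k / (real q - 1) ^ a * (\<Sum>i\<in>{0..n}. \<Sum>j\<in>{0..n}. w' i * block q n a k f i j * w' j)"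
    unfolding X_def by (rule quadratic_form_block[OF assms(1-3)])
  finally have *: "0 \<le> 2 ^ k / (real q - 1) ^ a * (\<Sum>i\<in>{0..n}. \<Sum>j\<in>{0..n}. w' i * block q n a k f i j * w' j)" .
  have "0 < 2 ^ k / (real q - 1) ^ a" using assms(1) by simp
  with * have "0 \<le> (\<Sum>i\<in>{0..n}. \<Sum>j\<in>{0..n}. w' i * block q n a k f i j * w' j)"
    by (meson mult_pos_neg not_le)
  also have "\<dots> = (\<Sum>i\<in>{k..n+a-k}. \<Sum>j\<in>{0..n}. w' i * block q n a k f i j * w' j)"
    using sub by (intro sum.mono_neutral_right) (auto simp: w'_def)
  also have "\<dots> = (\<Sum>i\<in>{k..n+a-k}. \<Sum>j\<in>{k..n+a-k}. w' i * block q n a k f i j * w' j)"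
    using sub by (intro sum.cong refl sum.mono_neutral_right) (auto simp: w'_def)
  also have "\<dots> = (\<Sum>i\<in>{k..n+a-k}. \<Sum>j\<in>{k..n+a-k}. w i * block q n a k f i j * w j)"
    by (intro sum.cong refl) (auto simp: w'_def)
  finally show "0 \<le> (\<Sum>i\<in>{k..n+a-k}. \<Sum>j\<in>{k..n+a-k}. w i * block q n a k f i j * w j)" .
qed

text \<open>The border pairs a scalar x with the vector X. For a = k = 0 the vector
  \<open>block_vec\<close> is identically 1, so the mixed term only counts words by weight.\<close>

lemma psd_bordered_block:
  assumes "q \<ge> 3"
    and sym: "\<And>i j t p. (i,j,t,p) \<in> I n \<Longrightarrow> f (i,j,t,p) = f (j,i,t,p)"
    and nonneg: "\<And>x X. 0 \<le> x * c * x + 2 * x * (\<Sum>u\<in>words q n. X u * g (weight n u)) +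
        (\<Sum>u\<in>words q n. \<Sum>v\<in>words q n. X u * f (dbar n u v) * X v)"
  shows "psd (bordered_index {0..n})
     (bordered c (\<lambda>i. real (n choose i) * (real q - 1) powr (real i / 2) * g i) (block q n 0 0 f))"
proof -
  define Q where "Q = real q - 1"
  define y where "y i = real (n choose i) * Q powr (real i / 2) * g i" for i
  define B where "B = block q n 0 0 f"
  have Q: "Q > 0" using assms by (simp add: Q_def)
  have sum_bi: "(\<Sum>i\<in>bordered_index {0..n}. h i) = h None + (\<Sum>i\<in>{0..n}. h (Some i))" for h :: "nat option \<Rightarrow> real"
    by (simp add: bordered_index_def sum.reindex)
  have "psd (bordered_index {0..n}) (bordered c y B)"
    unfolding psd_def
  proof (intro conjI ballI allI)
    fix i j
    have "B k l = B l k" for k l unfolding B_def by (rule block_commute) (rule sym)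
    then show "bordered c y B i j = bordered c y B j i" by (cases i; cases j) auto
  next
    fix w :: "nat option \<Rightarrow> real"
    define X where "X = (\<lambda>u. w (Some (weight n u)) / Q powr (real (weight n u) / 2) * block_vec n 0 (0 - 0) u)"
    have "(\<Sum>u\<in>words q n. X u * g (weight n u)) = (\<Sum>u\<in>words q n. w (Some (weight n u)) / Q powr (real (weight n u) / 2) * g (weight n u))"
      by (simp add: X_def block_vec_0)
    also have "\<dots> = (\<Sum>i\<in>{0..n}. real (n choose i) * Q ^ i * (w (Some i) / Q powr (real i / 2) * g i))"
      unfolding Q_def by (rule sum_words_weight[OF assms(1)])
    also have "\<dots> = (\<Sum>i\<in>{0..n}. w (Some i) * y i)"
    proof (intro sum.cong refl)
      fix i
      \<comment> \<open>Of the Q^i in the number of words of weight i, one factor Q^(i/2) cancels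
        the scaling of X; the other is the (q-1)^(i/2) of the border.\<close>
      have "Q ^ i = Q powr (real i / 2) * Q powr (real i / 2)"
        using Q by (simp add: powr_add[symmetric] powr_realpow)
      then show "real (n choose i) * Q ^ i * (w (Some i) / Q powr (real i / 2) * g i) = w (Some i) * y i"
        using Q by (simp add: y_def)
    qed
    finally have lin: "(\<Sum>u\<in>words q n. X u * g (weight n u)) = (\<Sum>i\<in>{0..n}. w (Some i) * y i)" .
    have quad: "(\<Sum>u\<in>words q n. \<Sum>v\<in>words q n. X u * f (dbar n u v) * X v) = (\<Sum>i\<in>{0..n}. \<Sum>j\<in>{0..n}. w (Some i) * B i j * w (Some j))"
      using quadratic_form_block[of q 0 0 n "\<lambda>i. w (Some i)" f] assms by (simp add: X_def Q_def B_def)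
    have "0 \<le> w None * c * w None + 2 * w None * (\<Sum>u\<in>words q n. X u * g (weight n u)) +
        (\<Sum>u\<in>words q n. \<Sum>v\<in>words q n. X u * f (dbar n u v) * X v)" by (rule nonneg)
    also have "\<dots> = (\<Sum>i\<in>bordered_index {0..n}. \<Sum>j\<in>bordered_index {0..n}. w i * bordered c y B i j * w j)"
      unfolding lin quad sum_bi by (simp add: sum.distrib sum_distrib_left mult_ac)
    finally show "0 \<le> (\<Sum>i\<in>bordered_index {0..n}. \<Sum>j\<in>bordered_index {0..n}. w i * bordered c y B i j * w j)" .
  qed
  then show ?thesis by (simp add: y_def[abs_def] B_def Q_def)
qed

section \<open>Automorphisms of the Hamming space\<close>

text \<open>The condition forces g u l to be an injective function of the letter u (\<rho> l), for
  each l. The set is thus the wreath product of the symmetric groups on letters and on coordinates,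
  described without naming the letter permutations. Extensionality makes it finite.\<close>

definition automs :: "nat \<Rightarrow> nat \<Rightarrow> (word \<Rightarrow> word) set" where
  "automs q n = {g \<in> words q n \<rightarrow>\<^sub>E words q n. \<exists>\<rho>. \<rho> permutes {..<n} \<and>
     (\<forall>u\<in>words q n. \<forall>v\<in>words q n. \<forall>l<n. g u l = g v l \<longleftrightarrow> u (\<rho> l) = v (\<rho> l))}"

lemma finite_automs: "finite (automs q n)"
  by (rule finite_subset[of _ "words q n \<rightarrow>\<^sub>E words q n"]) (auto simp: automs_def intro!: finite_PiE finite_words)

lemma automs_words: "g \<in> automs q n \<Longrightarrow> u \<in> words q n \<Longrightarrow> g u \<in> words q n"
  by (auto simp: automs_def)

lemma automs_nonempty: "automs q n \<noteq> {}"
proof -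
  have "restrict (\<lambda>u. u) (words q n) \<in> automs q n"
    by (auto simp: automs_def intro!: exI[of _ id] permutes_id)
  then show ?thesis by blast
qed

lemma card_permutes_eq:
  assumes "\<rho> permutes {..<n::nat}"
  shows "card {l. l < n \<and> P (\<rho> l)} = card {l. l < n \<and> P l}"
proof -
  have im: "\<rho> ` {..<n} = {..<n}" using assms by (rule permutes_image)
  have "\<rho> ` {l. l < n \<and> P (\<rho> l)} = {l. l < n \<and> P l}"
  proof (intro equalityI subsetI)
    fix x assume "x \<in> \<rho> ` {l. l < n \<and> P (\<rho> l)}"
    then obtain l where "l < n" "P (\<rho> l)" "x = \<rho> l" by blast
    moreover from this im have "\<rho> l \<in> {..<n}" by blast
    ultimately show "x \<in> {l. l < n \<and> P l}" by simp
  next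
    fix x assume x: "x \<in> {l. l < n \<and> P l}"
    then have "x \<in> \<rho> ` {..<n}" unfolding im by simp
    then obtain l where "l < n" "x = \<rho> l" by blast
    with x show "x \<in> \<rho> ` {l. l < n \<and> P (\<rho> l)}" by blast
  qed
  moreover have "inj_on \<rho> {l. l < n \<and> P (\<rho> l)}"
    by (rule inj_on_subset[OF permutes_inj[OF assms]]) simp
  ultimately show ?thesis using card_image by fastforce
qed

lemma automs_pattern:
  assumes "g \<in> automs q n" "a \<in> words q n" "u \<in> words q n" "v \<in> words q n"
  shows "pattern n (g a) (g u) (g v) = pattern n a u v"
proof -
  obtain \<rho> where \<rho>: "\<rho> permutes {..<n}"
    and *: "\<And>u v l. u \<in> words q n \<Longrightarrow> v \<in> words q n \<Longrightarrow> l < n \<Longrightarrow> g u l = g v l \<longleftrightarrow> u (\<rho> l) = v (\<rho> l)"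
    using assms(1) by (auto simp: automs_def)
  show ?thesis
    unfolding pattern_def
    using assms by (simp add: * cong: conj_cong)
      (simp add: card_permutes_eq[OF \<rho>, of "\<lambda>l. u l \<noteq> a l"] card_permutes_eq[OF \<rho>, of "\<lambda>l. v l \<noteq> a l"]
        card_permutes_eq[OF \<rho>, of "\<lambda>l. u l \<noteq> a l \<and> v l \<noteq> a l"] card_permutes_eq[OF \<rho>, of "\<lambda>l. u l = v l \<and> v l \<noteq> a l"])
qed

lemma hdist_pattern: "hdist n a u = fst (pattern n a u v)"
  unfolding hdist_def pattern_def fst_conv by (rule arg_cong[where f=card]) auto

lemma automs_hdist:
  assumes "g \<in> automs q n" "u \<in> words q n" "v \<in> words q n"
  shows "hdist n (g u) (g v) = hdist n u v"
  using automs_pattern[OF assms(1,2,3,3)] by (metis hdist_pattern)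

lemma bij_betw_automs:
  assumes "g \<in> automs q n"
  shows "bij_betw g (words q n) (words q n)"
proof -
  have "inj_on g (words q n)"
  proof (rule inj_onI)
    fix u v assume uv: "u \<in> words q n" "v \<in> words q n" "g u = g v"
    obtain \<rho> where \<rho>: "\<rho> permutes {..<n}" "\<forall>l<n. u (\<rho> l) = v (\<rho> l)"
      using assms uv by (fastforce simp: automs_def)
    show "u = v"
    proof (rule words_eqI[OF uv(1,2)])
      fix l assume "l < n"
      then obtain m where "m < n" "l = \<rho> m"
        using permutes_image[OF \<rho>(1)] by (metis imageE lessThan_iff)
      with \<rho>(2) show "u l = v l" by simp
    qed
  qed
  moreover have "g ` words q n \<subseteq> words q n" using assms by (auto simp: automs_words)
  ultimately show ?thesis using endo_inj_surj[OF finite_words] by (auto simp: bij_betw_def)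
qed

lemma automs_compose:
  assumes "g \<in> automs q n" "h \<in> automs q n"
  shows "compose (words q n) g h \<in> automs q n"
proof -
  obtain \<rho> where \<rho>: "\<rho> permutes {..<n}"
    and *: "\<And>u v l. u \<in> words q n \<Longrightarrow> v \<in> words q n \<Longrightarrow> l < n \<Longrightarrow> g u l = g v l \<longleftrightarrow> u (\<rho> l) = v (\<rho> l)"
    using assms(1) by (auto simp: automs_def)
  obtain \<sigma> where \<sigma>: "\<sigma> permutes {..<n}"
    and **: "\<And>u v l. u \<in> words q n \<Longrightarrow> v \<in> words q n \<Longrightarrow> l < n \<Longrightarrow> h u l = h v l \<longleftrightarrow> u (\<sigma> l) = v (\<sigma> l)"
    using assms(2) by (auto simp: automs_def)
  have "\<sigma> \<circ> \<rho> permutes {..<n}" using \<rho> \<sigma> by (rule permutes_compose)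
  moreover have "\<rho> l < n" if "l < n" for l using that permutes_in_image[OF \<rho>] by auto
  ultimately show ?thesis
    unfolding automs_def using assms
    by (intro CollectI conjI exI[of _ "\<sigma> \<circ> \<rho>"]) (simp_all add: compose_def automs_words * **)
qed

text \<open>Right translation by h is injective because h maps onto all words; on a finite set it is
  then a bijection, and the sum is merely reindexed.\<close>

lemma sum_automs_compose:
  assumes "h \<in> automs q n"
  shows "(\<Sum>g\<in>automs q n. F (compose (words q n) g h)) = (\<Sum>g\<in>automs q n. F g)"
proof (rule sum.reindex_bij_betw)
  have "inj_on (\<lambda>g. compose (words q n) g h) (automs q n)"
  proof (rule inj_onI)
    fix g g' assume g: "g \<in> automs q n" "g' \<in> automs q n"
      and eq: "compose (words q n) g h = compose (words q n) g' h"
    show "g = g'"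
    proof (rule PiE_ext[of g "words q n" "\<lambda>_. words q n" g'])
      fix w assume "w \<in> words q n"
      then obtain u where "u \<in> words q n" "w = h u"
        using bij_betw_automs[OF assms] by (metis bij_betw_imp_surj_on imageE)
      with fun_cong[OF eq, of u] show "g w = g' w" by (simp add: compose_def)
    qed (use g in \<open>auto simp: automs_def\<close>)
  qed
  moreover have "(\<lambda>g. compose (words q n) g h) ` automs q n \<subseteq> automs q n"
    using assms by (auto simp: automs_compose)
  ultimately show "bij_betw (\<lambda>g. compose (words q n) g h) (automs q n) (automs q n)"
    using endo_inj_surj[OF finite_automs] by (auto simp: bij_betw_def)
qed

text \<open>Equal equality patterns make the assignment on the at most three letters well defined
  and injective. The complements of its domain and range have the same size, so it extends.\<close>

lemma extend_to_bij:
  assumes "finite L" "x1 \<in> L" "x2 \<in> L" "x3 \<in> L" "y1 \<in> L" "y2 \<in> L" "y3 \<in> L"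
    and "x2 \<noteq> x1 \<longleftrightarrow> y2 \<noteq> y1" "x3 \<noteq> x1 \<longleftrightarrow> y3 \<noteq> y1" "x2 = x3 \<longleftrightarrow> y2 = y3"
  shows "\<exists>\<pi>. bij_betw \<pi> L L \<and> \<pi> x1 = y1 \<and> \<pi> x2 = y2 \<and> \<pi> x3 = y3"
proof -
  define f where "f z = (if z = x1 then y1 else if z = x2 then y2 else y3)" for z
  define S where "S = {x1,x2,x3}"
  define T where "T = {y1,y2,y3}"
  have f: "f x1 = y1" "f x2 = y2" "f x3 = y3" using assms by (auto simp: f_def)
  have bij: "bij_betw f S T"
    unfolding bij_betw_def S_def T_def using assms by (auto simp: inj_on_def f)
  have "S \<subseteq> L" "T \<subseteq> L" using assms by (auto simp: S_def T_def)
  moreover have "card S = card T" using bij by (rule bij_betw_same_card)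
  ultimately have "card (L - S) = card (L - T)"
    using assms(1) by (simp add: card_Diff_subset finite_subset)
  then obtain h where "bij_betw h (L - S) (L - T)"
    using assms(1) finite_same_card_bij[of "L - S" "L - T"] by auto
  then have "bij_betw (\<lambda>z. if z \<in> S then f z else h z) (S \<union> (L - S)) (T \<union> (L - T))"
    by (intro bij_betw_disjoint_Un bij) auto
  moreover have "S \<union> (L - S) = L" "T \<union> (L - T) = L" using \<open>S \<subseteq> L\<close> \<open>T \<subseteq> L\<close> by auto
  moreover have "x1 \<in> S" "x2 \<in> S" "x3 \<in> S" by (simp_all add: S_def)
  ultimately show ?thesis
    by (intro exI[of _ "\<lambda>z. if z \<in> S then f z else h z"]) (simp add: f)
qed

lemma words_letter: "w \<in> words q n \<Longrightarrow> l < n \<Longrightarrow> w l \<in> {0..<int q}"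
  using PiE_mem[of w "{..<n}" "\<lambda>_. {0..<int q}" l] by (simp add: words_def)

text \<open>Equal patterns mean equally many coordinates of each equality type. A coordinate
  permutation therefore matches the types, and at each coordinate a letter bijection carries one
  triple of letters to the other.\<close>

lemma automs_transitive:
  assumes "a \<in> words q n" "u \<in> words q n" "v \<in> words q n"
    and "a' \<in> words q n" "u' \<in> words q n" "v' \<in> words q n"
    and eq: "pattern n a u v = pattern n a' u' v'"
  obtains g where "g \<in> automs q n" "g a = a'" "g u = u'" "g v = v'"
proof -
  define key where "key a u v l = (u l \<noteq> a l, v l \<noteq> a l, u l = v l)" for a u v :: word and l
  define N where "N a u v = (\<lambda>b c d. card {l. l < n \<and> (u l \<noteq> a l) = b \<and> (v l \<noteq> a l) = c \<and> (u l = v l) = d})" for a u v :: word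
  \<comment> \<open>The truth assignments excluded by transitivity of equality.\<close>
  have zero: "N a u v False False False = 0" "N a u v True False True = 0" "N a u v False True True = 0" for a u v
    unfolding N_def card_eq_0_iff by auto
  have pat: "pattern n a u v = (N a u v True False False + (N a u v True True True + N a u v True True False),
           N a u v False True False + (N a u v True True True + N a u v True True False),
           N a u v True True True + N a u v True True False, N a u v True True True)" for a u v
    unfolding N_def by (fact pattern_cells(1)[where n=n and a=a and u=u and v=v])
  have total: "N a u v False False True + N a u v True False False + N a u v False True False
       + N a u v True True True + N a u v True True False = n" for a u v
    unfolding N_def by (fact pattern_cells(3)[where n=n and a=a and u=u and v=v, symmetric])
  have *: "N a u v True True True = N a' u' v' True True True" "N a u v True True False = N a' u' v' True True False"
    "N a u v True False False = N a' u' v' True False False" "N a u v False True False = N a' u' v' False True False"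
    using eq unfolding pat prod.inject by linarith+
  with total[of a u v] total[of a' u' v'] have "N a u v False False True = N a' u' v' False False True"
    by linarith
  with * have "N a u v b c d = N a' u' v' b c d" for b c d
    by (cases b; cases c; cases d) (simp_all add: zero)
  moreover have count_key: "count (image_mset (key a u v) (mset_set {..<n})) (b,c,d) = N a u v b c d" for a u v b c d
    by (simp only: count_image_mset_eq_card_vimage[OF finite_lessThan] key_def N_def lessThan_iff prod.inject)
  ultimately have "count (image_mset (key a' u' v') (mset_set {..<n})) x = count (image_mset (key a u v) (mset_set {..<n})) x" for x
    by (cases x rule: prod_cases3) (simp only:)
  then have "image_mset (key a' u' v') (mset_set {..<n}) = image_mset (key a u v) (mset_set {..<n})"
    by (rule multiset_eqI)
  then obtain \<rho> where \<rho>: "\<rho> permutes {..<n}" and "\<forall>l\<in>{..<n}. key a' u' v' l = key a u v (\<rho> l)"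
    by (rule image_mset_eq_implies_permutes[OF finite_lessThan])
  then have key: "key a' u' v' l = key a u v (\<rho> l)" if "l < n" for l
    using that by (metis lessThan_iff)
  have \<rho>_less: "\<rho> l < n" if "l < n" for l using that permutes_in_image[OF \<rho>] by auto
  have "\<exists>\<pi>. bij_betw \<pi> {0..<int q} {0..<int q} \<and> \<pi> (a (\<rho> l)) = a' l \<and> \<pi> (u (\<rho> l)) = u' l \<and> \<pi> (v (\<rho> l)) = v' l"
    if "l < n" for l
  proof (rule extend_to_bij)
    show "a (\<rho> l) \<in> {0..<int q}" "u (\<rho> l) \<in> {0..<int q}" "v (\<rho> l) \<in> {0..<int q}"
      using assms(1-3) \<rho>_less[OF that] by (simp_all only: words_letter)
    show "a' l \<in> {0..<int q}" "u' l \<in> {0..<int q}" "v' l \<in> {0..<int q}"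
      using assms(4-6) that by (simp_all only: words_letter)
  qed (use key[OF that] in \<open>simp_all add: key_def\<close>)
  then have "\<forall>l. \<exists>\<pi>. l < n \<longrightarrow> bij_betw \<pi> {0..<int q} {0..<int q} \<and> \<pi> (a (\<rho> l)) = a' l \<and> \<pi> (u (\<rho> l)) = u' l \<and> \<pi> (v (\<rho> l)) = v' l"
    by blast
  from choice[OF this] obtain \<pi> where \<pi>: "\<And>l. l < n \<Longrightarrow> bij_betw (\<pi> l) {0..<int q} {0..<int q}"
    "\<And>l. l < n \<Longrightarrow> \<pi> l (a (\<rho> l)) = a' l" "\<And>l. l < n \<Longrightarrow> \<pi> l (u (\<rho> l)) = u' l" "\<And>l. l < n \<Longrightarrow> \<pi> l (v (\<rho> l)) = v' l"
    by blast
  define g where "g = (\<lambda>w\<in>words q n. \<lambda>l\<in>{..<n}. \<pi> l (w (\<rho> l)))"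
  have g_words: "g w \<in> words q n" if "w \<in> words q n" for w
  proof -
    have "\<pi> l (w (\<rho> l)) \<in> {0..<int q}" if "l < n" for l
      by (rule bij_betw_apply[OF \<pi>(1)[OF that] words_letter[OF \<open>w \<in> words q n\<close> \<rho>_less[OF that]]])
    then have "(\<lambda>l\<in>{..<n}. \<pi> l (w (\<rho> l))) \<in> words q n"
      by (simp add: words_def restrict_PiE_iff)
    then show ?thesis using that by (simp add: g_def)
  qed
  have "g \<in> automs q n"
    unfolding automs_def
  proof (intro CollectI conjI exI[of _ \<rho>] ballI allI impI \<rho>)
    show "g \<in> words q n \<rightarrow>\<^sub>E words q n"
    proof (rule PiE_I)
      show "g w = undefined" if "w \<notin> words q n" for w using that by (simp add: g_def)
    qed (rule g_words)
  next
    fix w w' l assume w: "w \<in> words q n" "w' \<in> words q n" "l < n"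
    have "inj_on (\<pi> l) {0..<int q}" using \<pi>(1)[OF w(3)] by (rule bij_betw_imp_inj_on)
    from inj_on_eq_iff[OF this words_letter[OF w(1) \<rho>_less[OF w(3)]] words_letter[OF w(2) \<rho>_less[OF w(3)]]]
    show "g w l = g w' l \<longleftrightarrow> w (\<rho> l) = w' (\<rho> l)"
      using w by (simp add: g_def)
  qed
  moreover have "g a = a'"
    by (rule words_eqI[OF g_words[OF assms(1)] assms(4)]) (simp add: g_def assms(1) \<pi>(2))
  moreover have "g u = u'"
    by (rule words_eqI[OF g_words[OF assms(2)] assms(5)]) (simp add: g_def assms(2) \<pi>(3))
  moreover have "g v = v'"
    by (rule words_eqI[OF g_words[OF assms(3)] assms(6)]) (simp add: g_def assms(3) \<pi>(4))
  ultimately show thesis by (rule that)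
qed

section \<open>Translations and well-definedness of the orbit counts\<close>

lemma word_diff_words: "q \<ge> 1 \<Longrightarrow> word_diff q n u v \<in> words q n"
  by (auto simp: word_diff_def words_def)

text \<open>Letters are canonical representatives, so subtracting a common residue preserves both
  equality and inequality. This lets \<open>eta\<close>, defined through translated words, be
  counted by patterns seen from w.\<close>

lemma dbar_word_diff:
  assumes "q \<ge> 1" "u \<in> words q n" "v \<in> words q n" "w \<in> words q n"
  shows "dbar n (word_diff q n u w) (word_diff q n v w) = pattern n w u v"
proof -
  have mod_eq: "(u l - w l) mod int q = (v l - w l) mod int q \<longleftrightarrow> u l = v l"
    if "u \<in> words q n" "v \<in> words q n" "l < n" for u v l
  proof -
    have "(u l - w l) mod int q = (v l - w l) mod int q \<longleftrightarrow> u l mod int q = v l mod int q"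
      by (simp add: mod_eq_dvd_iff)
    then show ?thesis using words_letter[OF that(1,3)] words_letter[OF that(2,3)] by simp
  qed
  have "(u l - w l) mod int q = 0 \<longleftrightarrow> u l = w l" if "u \<in> words q n" "l < n" for u l
    using mod_eq[OF that(1) assms(4) that(2)] by simp
  then show ?thesis
    unfolding dbar_def pattern_def word_diff_def using assms
    by (simp add: mod_eq cong: conj_cong)
qed

lemma orbit_size_pos:
  assumes "q \<ge> 3" "\<tau> \<in> I n"
  shows "orbit_size q n \<tau> > 0"
  using assms by (auto simp: orbit_size_def multinom_def I_def)

text \<open>Existence comes from counting: the orbit size is positive, as q \<ge> 3 keeps
  (q-2)^(t-p) positive.\<close>

lemma dbar_surj:
  assumes "q \<ge> 3" "\<tau> \<in> I n"
  obtains u v where "u \<in> words q n" "v \<in> words q n" "dbar n u v = \<tau>"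
proof -
  have "card {x \<in> words q n \<times> words q n. dbar n (fst x) (snd x) = \<tau>} \<noteq> 0"
    using card_dbar_eq[OF assms] orbit_size_pos[OF assms] by linarith
  then have "{x \<in> words q n \<times> words q n. dbar n (fst x) (snd x) = \<tau>} \<noteq> {}" by (metis card.empty)
  then show thesis using that by auto
qed

lemma card_automs_image:
  assumes "g \<in> automs q n" "\<And>w. w \<in> words q n \<Longrightarrow> P w \<longleftrightarrow> Q (g w)"
  shows "card {w \<in> words q n. P w} = card {w \<in> words q n. Q w}"
proof (rule bij_betw_same_card)
  have bij: "bij_betw g (words q n) (words q n)" by (rule bij_betw_automs[OF assms(1)])
  have "g ` {w \<in> words q n. P w} = {w \<in> words q n. Q w}"
  proof (intro equalityI subsetI)
    fix x assume "x \<in> g ` {w \<in> words q n. P w}"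
    then obtain w where "w \<in> words q n" "P w" "x = g w" by blast
    with assms show "x \<in> {w \<in> words q n. Q w}" by (simp add: automs_words)
  next
    fix x assume x: "x \<in> {w \<in> words q n. Q w}"
    then obtain w where "w \<in> words q n" "x = g w" using bij_betw_imp_surj_on[OF bij] by blast
    with x assms(2) show "x \<in> g ` {w \<in> words q n. P w}" by simp
  qed
  moreover have "inj_on g {w \<in> words q n. P w}"
    by (rule inj_on_subset[OF bij_betw_imp_inj_on[OF bij]]) simp
  ultimately show "bij_betw g {w \<in> words q n. P w} {w \<in> words q n. Q w}" by (simp add: bij_betw_def)
qed

text \<open>Two pairs with the same tuple are related by an automorphism fixing the zero word. It
  maps the words counted for one pair onto those counted for the other, preserving weight and
  pattern. The pair (u, v) itself forces uniqueness.\<close>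

lemma eta_dbar:
  assumes "q \<ge> 1" "u \<in> words q n" "v \<in> words q n"
  shows "eta q n \<tau>' d (dbar n u v) = card {w \<in> words q n. weight n w = d \<and> pattern n w u v = \<tau>'}"
  unfolding eta_def
proof (rule the_equality)
  have z: "zero_word n \<in> words q n" using assms by (simp add: zero_word_in_words)
  show "\<forall>u'\<in>words q n. \<forall>v'\<in>words q n. dbar n u' v' = dbar n u v \<longrightarrow>
    card {w \<in> words q n. weight n w = d \<and> pattern n w u v = \<tau>'} = card {w \<in> words q n. weight n w = d \<and>
                 dbar n (word_diff q n u' w) (word_diff q n v' w) = \<tau>'}"
  proof (intro ballI impI)
    fix u' v' assume uv': "u' \<in> words q n" "v' \<in> words q n" "dbar n u' v' = dbar n u v"
    have "pattern n (zero_word n) u v = pattern n (zero_word n) u' v'"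
      using uv'(3) by (simp add: dbar_pattern)
    then obtain g where g: "g \<in> automs q n" "g (zero_word n) = zero_word n" "g u = u'" "g v = v'"
      by (rule automs_transitive[OF z assms(2,3) z uv'(1,2)])
    show "card {w \<in> words q n. weight n w = d \<and> pattern n w u v = \<tau>'} = card {w \<in> words q n. weight n w = d \<and>
                 dbar n (word_diff q n u' w) (word_diff q n v' w) = \<tau>'}"
    proof (rule card_automs_image[OF g(1)])
      fix w assume w: "w \<in> words q n"
      have "weight n (g w) = weight n w"
        unfolding weight_def using automs_hdist[OF g(1) w z] g(2) by simp
      moreover have "dbar n (word_diff q n u' (g w)) (word_diff q n v' (g w)) = pattern n w u v"
        using dbar_word_diff[OF assms(1) uv'(1,2) automs_words[OF g(1) w]] automs_pattern[OF g(1) w assms(2,3)] g(3,4) by simp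
      ultimately show "(weight n w = d \<and> pattern n w u v = \<tau>') = (weight n (g w) = d \<and>
                 dbar n (word_diff q n u' (g w)) (word_diff q n v' (g w)) = \<tau>')" by simp
    qed
  qed
  show "c = card {w \<in> words q n. weight n w = d \<and> pattern n w u v = \<tau>'}"
    if "\<forall>u'\<in>words q n. \<forall>v'\<in>words q n. dbar n u' v' = dbar n u v \<longrightarrow>
      c = card {w \<in> words q n. weight n w = d \<and> dbar n (word_diff q n u' w) (word_diff q n v' w) = \<tau>'}" for c
    using that[rule_format, OF assms(2,3) refl] by (simp add: dbar_word_diff[OF assms(1)] assms(2,3) cong: conj_cong)
qed

lemma pair_count_dbar:
  assumes "q \<ge> 1" "u \<in> words q n" "v \<in> words q n"
  shows "pair_count q n \<tau>' d (dbar n u v) = card {w \<in> words q n. dbar n u w = \<tau>' \<and> hdist n v w = d}"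
  unfolding pair_count_def
proof (rule the_equality)
  have z: "zero_word n \<in> words q n" using assms by (simp add: zero_word_in_words)
  show "\<forall>u'\<in>words q n. \<forall>v'\<in>words q n. dbar n u' v' = dbar n u v \<longrightarrow>
    card {w \<in> words q n. dbar n u w = \<tau>' \<and> hdist n v w = d} = card {w \<in> words q n. dbar n u' w = \<tau>' \<and> hdist n v' w = d}"
  proof (intro ballI impI)
    fix u' v' assume uv': "u' \<in> words q n" "v' \<in> words q n" "dbar n u' v' = dbar n u v"
    have "pattern n (zero_word n) u v = pattern n (zero_word n) u' v'"
      using uv'(3) by (simp add: dbar_pattern)
    then obtain g where g: "g \<in> automs q n" "g (zero_word n) = zero_word n" "g u = u'" "g v = v'"
      by (rule automs_transitive[OF z assms(2,3) z uv'(1,2)])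
    show "card {w \<in> words q n. dbar n u w = \<tau>' \<and> hdist n v w = d} = card {w \<in> words q n. dbar n u' w = \<tau>' \<and> hdist n v' w = d}"
    proof (rule card_automs_image[OF g(1)])
      fix w assume w: "w \<in> words q n"
      show "(dbar n u w = \<tau>' \<and> hdist n v w = d) = (dbar n u' (g w) = \<tau>' \<and> hdist n v' (g w) = d)"
        using automs_hdist[OF g(1) assms(3) w] automs_pattern[OF g(1) z assms(2) w] g by (simp add: dbar_pattern)
    qed
  qed
  show "c = card {w \<in> words q n. dbar n u w = \<tau>' \<and> hdist n v w = d}"
    if "\<forall>u'\<in>words q n. \<forall>v'\<in>words q n. dbar n u' v' = dbar n u v \<longrightarrow>
      c = card {w \<in> words q n. dbar n u' w = \<tau>' \<and> hdist n v' w = d}" for c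
    using that[rule_format, OF assms(2,3) refl] .
qed

section \<open>Averaging a code over the automorphisms\<close>

definition mean :: "nat \<Rightarrow> nat \<Rightarrow> ((word \<Rightarrow> word) \<Rightarrow> real) \<Rightarrow> real" where
  "mean q n F = (\<Sum>g\<in>automs q n. F g) / real (card (automs q n))"

lemma card_automs_pos: "0 < real (card (automs q n))"
  using finite_automs automs_nonempty by (simp add: card_gt_0_iff)

lemma mean_cong: "(\<And>g. g \<in> automs q n \<Longrightarrow> F g = G g) \<Longrightarrow> mean q n F = mean q n G"
  unfolding mean_def by (simp cong: sum.cong)

lemma mean_sum: "mean q n (\<lambda>g. \<Sum>i\<in>A. F i g) = (\<Sum>i\<in>A. mean q n (F i))"
  unfolding mean_def by (subst sum.swap) (simp add: sum_divide_distrib)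

lemma mean_cmult: "mean q n (\<lambda>g. c * F g) = c * mean q n F"
  unfolding mean_def by (simp add: sum_distrib_left)

lemma mean_add: "mean q n (\<lambda>g. F g + G g) = mean q n F + mean q n G"
  unfolding mean_def by (simp add: sum.distrib add_divide_distrib)

lemma mean_diff: "mean q n (\<lambda>g. F g - G g) = mean q n F - mean q n G"
  unfolding mean_def by (simp add: sum_subtractf diff_divide_distrib)

lemma mean_const: "mean q n (\<lambda>_. c) = c"
  unfolding mean_def using card_automs_pos[of q n] by simp

lemma mean_mono: "(\<And>g. g \<in> automs q n \<Longrightarrow> F g \<le> G g) \<Longrightarrow> mean q n F \<le> mean q n G"
  unfolding mean_def by (intro divide_right_mono sum_mono) auto

lemma mean_nonneg: "(\<And>g. g \<in> automs q n \<Longrightarrow> 0 \<le> F g) \<Longrightarrow> 0 \<le> mean q n F"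
  unfolding mean_def by (intro divide_nonneg_nonneg sum_nonneg) auto

definition hits :: "word set \<Rightarrow> (word \<Rightarrow> word) \<Rightarrow> word \<Rightarrow> real" where
  "hits C g w = of_bool (g w \<in> C)"

text \<open>A representative pair is chosen for each tuple; by \<open>x_pattern\<close> the value is
  independent of it, and the zero word may be replaced by any base word.\<close>

definition code_family :: "nat \<Rightarrow> nat \<Rightarrow> word set \<Rightarrow> tuple \<Rightarrow> real" where
  "code_family q n C \<tau> = (let x = SOME x. x \<in> words q n \<times> words q n \<and> dbar n (fst x) (snd x) = \<tau>
     in mean q n (\<lambda>g. hits C g (zero_word n) * hits C g (fst x) * hits C g (snd x)))"

section \<open>Symmetry under permuting the three words of a triple\<close>

lemma mset3_eq_cases:
  fixes a b c x y z :: 'a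
  assumes "{#a, b, c#} = {#x, y, z#}"
  shows "(a = x \<and> b = y \<and> c = z) \<or> (a = x \<and> b = z \<and> c = y) \<or> (a = y \<and> b = x \<and> c = z) \<or>
    (a = y \<and> b = z \<and> c = x) \<or> (a = z \<and> b = x \<and> c = y) \<or> (a = z \<and> b = y \<and> c = x)"
  using assms by (auto simp: add_mset_eq_single add_eq_conv_ex)

text \<open>A tuple is determined by the three distances between 0, u and v together with t - p, the
  number of coordinates where the three letters are pairwise distinct. The two invariance hypotheses
  are the transpositions of u, v and of 0, u, which generate all permutations of the three
  words.\<close>

lemma swap_invariant_family:
  fixes x :: "tuple \<Rightarrow> real"
  assumes swap: "\<And>i j t p. (i,j,t,p) \<in> I n \<Longrightarrow> x (i,j,t,p) = x (j,i,t,p)"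
    and shift: "\<And>i j t p. (i,j,t,p) \<in> I n \<Longrightarrow> x (i,j,t,p) = x (i,i+j-t-p,i-p,i-t)"
    and "(i,j,t,p) \<in> I n" "(i',j',t',p') \<in> I n"
    and "{#i, j, i+j-t-p#} = {#i', j', i'+j'-t'-p'#}" "t - p = t' - p'"
  shows "x (i,j,t,p) = x (i',j',t',p')"
proof -
  define d where "d = i + j - t - p"
  have le: "p \<le> t" "t \<le> i" "t \<le> j" "i + j \<le> n + t" "p' \<le> t'" "t' \<le> i'" "t' \<le> j'" "i' + j' \<le> n + t'"
    using assms(3,4) by (auto simp: I_def)
  have I: "(i,j,t,p) \<in> I n" "(j,i,t,p) \<in> I n" "(i,d,i-p,i-t) \<in> I n" "(j,d,j-p,j-t) \<in> I n"
    using le by (auto simp: I_def d_def)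
  have 1: "x (i,j,t,p) = x (j,i,t,p)" using swap[OF I(1)] .
  have 2: "x (i,j,t,p) = x (i,d,i-p,i-t)" using shift[OF I(1)] by (simp add: d_def)
  have 3: "x (i,j,t,p) = x (d,i,i-p,i-t)" using 2 swap[OF I(3)] by simp
  have 4: "x (i,j,t,p) = x (j,d,j-p,j-t)" using 1 shift[OF I(2)] by (simp add: d_def add.commute)
  have 5: "x (i,j,t,p) = x (d,j,j-p,j-t)" using 4 swap[OF I(4)] by simp
  from mset3_eq_cases[OF assms(5)] consider
     "i' = i" "j' = j" "i'+j'-t'-p' = d" | "i' = i" "j' = d" "i'+j'-t'-p' = j" | "i' = j" "j' = i" "i'+j'-t'-p' = d"
    | "i' = d" "j' = i" "i'+j'-t'-p' = j" | "i' = j" "j' = d" "i'+j'-t'-p' = i" | "i' = d" "j' = j" "i'+j'-t'-p' = i"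
    unfolding d_def by metis
  then show ?thesis
  proof cases
    case 1
    then have "t' = t" "p' = p" using le assms(6) by (auto simp: d_def)
    then show ?thesis using 1 by simp
  next
    case 2
    then have "t' = i - p" "p' = i - t" using le assms(6) by (auto simp: d_def)
    then show ?thesis using 2 \<open>x (i,j,t,p) = x (i,d,i-p,i-t)\<close> by simp
  next
    case 3
    then have "t' = t" "p' = p" using le assms(6) by (auto simp: d_def)
    then show ?thesis using 3 \<open>x (i,j,t,p) = x (j,i,t,p)\<close> by simp
  next
    case 4
    then have "t' = i - p" "p' = i - t" using le assms(6) by (auto simp: d_def)
    then show ?thesis using 4 \<open>x (i,j,t,p) = x (d,i,i-p,i-t)\<close> by simp
  next
    case 5
    then have "t' = j - p" "p' = j - t" using le assms(6) by (auto simp: d_def)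
    then show ?thesis using 5 \<open>x (i,j,t,p) = x (j,d,j-p,j-t)\<close> by simp
  next
    case 6
    then have "t' = j - p" "p' = j - t" using le assms(6) by (auto simp: d_def)
    then show ?thesis using 6 \<open>x (i,j,t,p) = x (d,j,j-p,j-t)\<close> by simp
  qed
qed

lemma pattern_swap: "pattern n a u v = (i,j,t,p) \<Longrightarrow> pattern n a v u = (j,i,t,p)"
  by (auto simp: pattern_def intro!: arg_cong[where f=card])

lemma dbar_swap: "dbar n u v = (i,j,t,p) \<Longrightarrow> dbar n v u = (j,i,t,p)"
  unfolding dbar_pattern by (rule pattern_swap)

text \<open>Seen from u, the distances are i to a and i + j - t - p to v. Among the i coordinates
  with a \<noteq> u, exactly p have v = u and exactly t have v \<noteq> a; the complementary numbers
  are the new t and p.\<close>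

lemma pattern_shift:
  assumes "pattern n a u v = (i,j,t,p)"
  shows "pattern n u a v = (i,i+j-t-p,i-p,i-t)"
proof -
  have i: "card {l. l < n \<and> u l \<noteq> a l} = i" and t: "card {l. l < n \<and> u l \<noteq> a l \<and> v l \<noteq> a l} = t"
    and p: "card {l. l < n \<and> u l = v l \<and> v l \<noteq> a l} = p" using assms by (auto simp: pattern_def)
  have "card {l. l < n \<and> a l \<noteq> u l} = i" unfolding i[symmetric] by (rule arg_cong[where f=card]) auto
  moreover have "card {l. l < n \<and> v l \<noteq> u l} = i + j - t - p"
    unfolding pattern_hdist[OF assms, symmetric] hdist_def by (rule arg_cong[where f=card]) auto
  moreover have "card {l. l < n \<and> a l \<noteq> u l \<and> v l \<noteq> u l} = i - p"
  proof -
    have "{l. l < n \<and> u l \<noteq> a l \<and> v l = u l} = {l. l < n \<and> u l = v l \<and> v l \<noteq> a l}" by auto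
    moreover have "{l. l < n \<and> u l \<noteq> a l \<and> v l \<noteq> u l} = {l. l < n \<and> a l \<noteq> u l \<and> v l \<noteq> u l}" by auto
    ultimately show ?thesis
      using card_less_split[of n "\<lambda>l. u l \<noteq> a l" "\<lambda>l. v l = u l"] i p by simp
  qed
  moreover have "card {l. l < n \<and> a l = v l \<and> v l \<noteq> u l} = i - t"
  proof -
    have "{l. l < n \<and> u l \<noteq> a l \<and> \<not> v l \<noteq> a l} = {l. l < n \<and> a l = v l \<and> v l \<noteq> u l}" by auto
    then show ?thesis
      using card_less_split[of n "\<lambda>l. u l \<noteq> a l" "\<lambda>l. v l \<noteq> a l"] i t by simp
  qed
  ultimately show ?thesis unfolding pattern_def by simp
qed

section \<open>The averaged family: constraints (A) and (B) and the objective\<close>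

locale averaged_code =
  fixes q n :: nat and C :: "word set"
  assumes q: "q \<ge> 3" and C: "C \<subseteq> words q n"
begin

abbreviation "W \<equiv> words q n"
abbreviation "E \<equiv> mean q n"
abbreviation "e \<equiv> hits C"
abbreviation "z0 \<equiv> zero_word n"
abbreviation "x \<equiv> code_family q n C"

lemma z0: "z0 \<in> W" using q by (simp add: zero_word_in_words)

lemma e_idem: "e g w * e g w = e g w" by (simp add: hits_def)

lemma e_range: "0 \<le> e g w" "e g w \<le> 1" by (simp_all add: hits_def)

lemma E_automs:
  assumes "h \<in> automs q n" "a \<in> W" "u \<in> W" "v \<in> W"
  shows "E (\<lambda>g. e g (h a) * e g (h u) * e g (h v)) = E (\<lambda>g. e g a * e g u * e g v)"
proof -
  have "E (\<lambda>g. e g a * e g u * e g v) = E (\<lambda>g. e (compose W g h) a * e (compose W g h) u * e (compose W g h) v)"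
    unfolding mean_def
    by (subst sum_automs_compose[OF assms(1), where F="\<lambda>g. e g a * e g u * e g v"]) simp
  also have "\<dots> = E (\<lambda>g. e g (h a) * e g (h u) * e g (h v))"
    using assms by (simp add: hits_def compose_def)
  finally show ?thesis by simp
qed

text \<open>The chosen pair exists because (u - a, v - a) has the required tuple. Transitivity
  carries its triple with the zero word to (a, u, v) without changing the mean.\<close>

lemma x_pattern:
  assumes "a \<in> W" "u \<in> W" "v \<in> W"
  shows "x (pattern n a u v) = E (\<lambda>g. e g a * e g u * e g v)"
proof -
  define P where "P y \<longleftrightarrow> y \<in> W \<times> W \<and> dbar n (fst y) (snd y) = pattern n a u v" for y
  have q1: "q \<ge> 1" using q by simp
  have "P (word_diff q n u a, word_diff q n v a)"
    unfolding P_def using dbar_word_diff[OF q1 assms(2,3,1)] word_diff_words[OF q1] by simp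
  then have "P (Eps P)" by (rule someI)
  moreover obtain u' v' where y: "Eps P = (u',v')" by (cases "Eps P")
  ultimately have u'v': "u' \<in> W" "v' \<in> W" "pattern n z0 u' v' = pattern n a u v"
    by (auto simp: P_def dbar_pattern)
  then obtain h where h: "h \<in> automs q n" "h z0 = a" "h u' = u" "h v' = v"
    using automs_transitive[OF z0 u'v'(1,2) assms] by blast
  have "x (pattern n a u v) = E (\<lambda>g. e g z0 * e g u' * e g v')"
    by (simp add: code_family_def P_def[symmetric] y)
  also have "\<dots> = E (\<lambda>g. e g (h z0) * e g (h u') * e g (h v'))"
    by (rule E_automs[OF h(1) z0 u'v'(1,2), symmetric])
  finally show ?thesis by (simp add: h)
qed

text \<open>A triple whose third word equals the base has tuple (d,0,0,0), and idempotence of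
  indicators removes the repeated factor.\<close>

lemma x_hdist:
  assumes "a \<in> W" "u \<in> W"
  shows "x (hdist n a u,0,0,0) = E (\<lambda>g. e g a * e g u)"
proof -
  have "pattern n a u a = (hdist n a u,0,0,0)"
    by (auto simp: pattern_def hdist_def intro!: arg_cong[where f=card])
  then have "x (hdist n a u,0,0,0) = E (\<lambda>g. e g a * e g u * e g a)"
    using x_pattern[OF assms(1,2,1)] by simp
  also have "\<dots> = E (\<lambda>g. e g a * e g u)"
    by (rule mean_cong) (use e_idem in \<open>metis mult.assoc mult.commute\<close>)
  finally show ?thesis .
qed

lemma x_0:
  assumes "a \<in> W"
  shows "x (0,0,0,0) = E (\<lambda>g. e g a)"
  using x_hdist[OF assms assms] by (simp add: e_idem hdist_def)

lemma x_dbar: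
  assumes "u \<in> W" "v \<in> W" "dbar n u v = (i,j,t,p)"
  shows "x (i,j,t,p) = E (\<lambda>g. e g z0 * e g u * e g v)"
    and "x (i,0,0,0) = E (\<lambda>g. e g z0 * e g u)"
    and "x (j,0,0,0) = E (\<lambda>g. e g z0 * e g v)"
    and "x (i+j-t-p,0,0,0) = E (\<lambda>g. e g u * e g v)"
    and "x (i,i,i,i) = E (\<lambda>g. e g z0 * e g u)"
proof -
  show "x (i,j,t,p) = E (\<lambda>g. e g z0 * e g u * e g v)"
    using x_pattern[OF z0 assms(1,2)] assms(3) by (simp add: dbar_pattern)
  have w: "hdist n z0 u = i" "hdist n z0 v = j"
    using weight_dbar[OF assms(3)] by (simp_all add: weight_def hdist_commute)
  show "x (i,0,0,0) = E (\<lambda>g. e g z0 * e g u)" using x_hdist[OF z0 assms(1)] w by simp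
  show "x (j,0,0,0) = E (\<lambda>g. e g z0 * e g v)" using x_hdist[OF z0 assms(2)] w by simp
  show "x (i+j-t-p,0,0,0) = E (\<lambda>g. e g u * e g v)"
    using x_hdist[OF assms(1,2)] pattern_hdist[of n z0 u v] assms(3) by (simp add: dbar_pattern)
  have "pattern n z0 u u = (i,i,i,i)" using assms(3) by (simp add: dbar_pattern pattern_def)
  then show "x (i,i,i,i) = E (\<lambda>g. e g z0 * e g u)"
    using x_pattern[OF z0 assms(1,1)] by (simp add: e_idem mult.assoc)
qed

lemma x_swap:
  assumes "(i,j,t,p) \<in> I n"
  shows "x (i,j,t,p) = x (j,i,t,p)"
proof -
  from assms obtain u v where uv: "u \<in> W" "v \<in> W" "dbar n u v = (i,j,t,p)" by (rule dbar_surj[OF q])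
  have "dbar n v u = (j,i,t,p)" using uv(3) by (rule dbar_swap)
  from x_dbar(1)[OF uv] x_dbar(1)[OF uv(2,1) this] show ?thesis by (simp add: mult_ac)
qed

lemma x_shift:
  assumes "(i,j,t,p) \<in> I n"
  shows "x (i,j,t,p) = x (i,i+j-t-p,i-p,i-t)"
proof -
  from assms obtain u v where uv: "u \<in> W" "v \<in> W" "dbar n u v = (i,j,t,p)" by (rule dbar_surj[OF q])
  have "pattern n u z0 v = (i,i+j-t-p,i-p,i-t)" using uv(3) unfolding dbar_pattern by (rule pattern_shift)
  with x_dbar(1)[OF uv] x_pattern[OF uv(1) z0 uv(2)] show ?thesis by (simp add: mult_ac)
qed

lemma constraints_A_x: "constraints_A n x"
  unfolding constraints_A_def
proof (rule ballI)
  fix \<tau> assume "\<tau> \<in> I n"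
  moreover obtain i j t p where \<tau>: "\<tau> = (i,j,t,p)" by (metis prod_cases4)
  ultimately have I: "(i,j,t,p) \<in> I n" by simp
  then obtain u v where uv: "u \<in> W" "v \<in> W" "dbar n u v = (i,j,t,p)" by (rule dbar_surj[OF q])
  have "0 \<le> x (i,j,t,p)"
    unfolding x_dbar(1)[OF uv] by (intro mean_nonneg mult_nonneg_nonneg e_range)
  moreover have "x (i,j,t,p) \<le> x (i,i,i,i)"
    unfolding x_dbar(1)[OF uv] x_dbar(5)[OF uv] by (rule mean_mono) (simp add: hits_def)
  \<comment> \<open>With x(0,0,0,0) read off at the word u, the two sides differ by the mean of e(u)
    (1 - e(0)) (1 - e(v)).\<close>
  moreover have "x (i,0,0,0) + x (i+j-t-p,0,0,0) - x (0,0,0,0) \<le> x (i,j,t,p)"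
    unfolding x_dbar(1)[OF uv] x_dbar(2)[OF uv] x_dbar(4)[OF uv] x_0[OF uv(1)] mean_add[symmetric] mean_diff[symmetric]
    by (rule mean_mono) (simp add: hits_def)
  moreover have "x (i,j,t,p) \<le> x (i+j-t-p,0,0,0)"
    unfolding x_dbar(1)[OF uv] x_dbar(4)[OF uv] by (rule mean_mono) (simp add: hits_def)
  moreover have "\<forall>(i',j',t',p') \<in> I n.
        {#i, j, i+j-t-p#} = {#i', j', i'+j'-t'-p'#} \<and> t - p = t' - p' \<longrightarrow>
        x (i,j,t,p) = x (i',j',t',p')"
    using swap_invariant_family[OF x_swap x_shift I] by blast
  ultimately show "case \<tau> of (i,j,t,p) \<Rightarrow> 0 \<le> x (i,j,t,p) \<and> x (i,j,t,p) \<le> x (i,i,i,i) \<and>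
     x (i,0,0,0) + x (i+j-t-p,0,0,0) - x (0,0,0,0) \<le> x (i,j,t,p) \<and>
     x (i,j,t,p) \<le> x (i+j-t-p,0,0,0) \<and>
     (\<forall>(i',j',t',p') \<in> I n.
        {#i, j, i+j-t-p#} = {#i', j', i'+j'-t'-p'#} \<and> t - p = t' - p' \<longrightarrow>
        x (i,j,t,p) = x (i',j',t',p'))"
    unfolding \<tau> prod.case by (intro conjI)
qed

text \<open>Expansion of the mean of h times the square of y plus a linear combination of
  indicators; y supplies the border.\<close>

lemma E_quadratic_nonneg:
  assumes "\<And>g. g \<in> automs q n \<Longrightarrow> 0 \<le> h g"
  shows "0 \<le> y * E h * y + 2 * y * (\<Sum>u\<in>W. X u * E (\<lambda>g. h g * e g u)) +
      (\<Sum>u\<in>W. \<Sum>v\<in>W. X u * E (\<lambda>g. h g * e g u * e g v) * X v)"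
proof -
  have "0 \<le> E (\<lambda>g. h g * (y + (\<Sum>u\<in>W. X u * e g u))\<^sup>2)"
    using assms by (intro mean_nonneg) simp
  also have "(\<lambda>g. h g * (y + (\<Sum>u\<in>W. X u * e g u))\<^sup>2) = (\<lambda>g. y * y * h g + (\<Sum>u\<in>W. 2 * y * X u * (h g * e g u))
      + (\<Sum>u\<in>W. \<Sum>v\<in>W. X u * X v * (h g * e g u * e g v)))"
  proof
    fix g
    have "(\<Sum>u\<in>W. 2 * y * X u * (h g * e g u)) = 2 * y * h g * (\<Sum>u\<in>W. X u * e g u)"
      by (simp add: sum_distrib_left mult_ac)
    moreover have "(\<Sum>u\<in>W. \<Sum>v\<in>W. X u * X v * (h g * e g u * e g v)) = h g * ((\<Sum>u\<in>W. X u * e g u) * (\<Sum>u\<in>W. X u * e g u))"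
      unfolding sum_product sum_distrib_left
      by (intro sum.cong refl) (simp add: sum_distrib_left mult_ac)
    ultimately show "h g * (y + (\<Sum>u\<in>W. X u * e g u))\<^sup>2 = y * y * h g + (\<Sum>u\<in>W. 2 * y * X u * (h g * e g u))
      + (\<Sum>u\<in>W. \<Sum>v\<in>W. X u * X v * (h g * e g u * e g v))"
      by (simp add: power2_eq_square algebra_simps)
  qed
  also have "E \<dots> = y * y * E h + (\<Sum>u\<in>W. 2 * y * X u * E (\<lambda>g. h g * e g u)) +
      (\<Sum>u\<in>W. \<Sum>v\<in>W. X u * X v * E (\<lambda>g. h g * e g u * e g v))"
    by (simp only: mean_add mean_sum mean_cmult)
  also have "\<dots> = y * E h * y + 2 * y * (\<Sum>u\<in>W. X u * E (\<lambda>g. h g * e g u)) +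
      (\<Sum>u\<in>W. \<Sum>v\<in>W. X u * E (\<lambda>g. h g * e g u * e g v) * X v)"
    by (simp add: sum_distrib_left mult_ac)
  finally show ?thesis .
qed

lemma E_family_swap:
  assumes "\<And>u v. u \<in> W \<Longrightarrow> v \<in> W \<Longrightarrow> f (dbar n u v) = E (\<lambda>g. h g * e g u * e g v)"
    and "(i,j,t,p) \<in> I n"
  shows "f (i,j,t,p) = f (j,i,t,p)"
proof -
  from assms(2) obtain u v where uv: "u \<in> W" "v \<in> W" "dbar n u v = (i,j,t,p)" by (rule dbar_surj[OF q])
  have "dbar n v u = (j,i,t,p)" using uv(3) by (rule dbar_swap)
  with assms(1)[OF uv(1,2)] assms(1)[OF uv(2,1)] uv(3) show ?thesis by (simp add: mult_ac)
qed

lemma psd_block_E: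
  assumes "\<And>g. g \<in> automs q n \<Longrightarrow> 0 \<le> h g"
    and f: "\<And>u v. u \<in> W \<Longrightarrow> v \<in> W \<Longrightarrow> f (dbar n u v) = E (\<lambda>g. h g * e g u * e g v)"
    and "a \<le> k" "2 * k \<le> n + a"
  shows "psd {k..n + a - k} (block q n a k f)"
proof (rule psd_block[OF q assms(3,4)])
  show "f (i,j,t,p) = f (j,i,t,p)" if "(i,j,t,p) \<in> I n" for i j t p
    using f that by (rule E_family_swap)
  show "0 \<le> (\<Sum>u\<in>W. \<Sum>v\<in>W. X u * f (dbar n u v) * X v)" for X
    using E_quadratic_nonneg[of h 0 X, OF assms(1)] by (simp add: f)
qed

lemma psd_bordered_block_E:
  assumes "\<And>g. g \<in> automs q n \<Longrightarrow> 0 \<le> h g"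
    and f: "\<And>u v. u \<in> W \<Longrightarrow> v \<in> W \<Longrightarrow> f (dbar n u v) = E (\<lambda>g. h g * e g u * e g v)"
    and r: "\<And>u. u \<in> W \<Longrightarrow> r (weight n u) = E (\<lambda>g. h g * e g u)"
    and c: "c = E h"
  shows "psd (bordered_index {0..n})
     (bordered c (\<lambda>i. real (n choose i) * (real q - 1) powr (real i / 2) * r i) (block q n 0 0 f))"
proof (rule psd_bordered_block[OF q])
  show "f (i,j,t,p) = f (j,i,t,p)" if "(i,j,t,p) \<in> I n" for i j t p
    using f that by (rule E_family_swap)
  show "0 \<le> y * c * y + 2 * y * (\<Sum>u\<in>W. X u * r (weight n u)) + (\<Sum>u\<in>W. \<Sum>v\<in>W. X u * f (dbar n u v) * X v)" for y X
    using E_quadratic_nonneg[of h y X, OF assms(1)] by (simp add: f r c)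
qed

lemma dbar_self: "dbar n u u = (weight n u, weight n u, weight n u, weight n u)"
  using weight_dbar[of n u u] by (simp add: dbar_def)

lemma x_diag: "u \<in> W \<Longrightarrow> x (weight n u, weight n u, weight n u, weight n u) = E (\<lambda>g. e g z0 * e g u)"
  by (rule x_dbar(5)[OF _ _ dbar_self])

text \<open>The weight is e(0) for x and 1 - e(0) for \<open>x_compl\<close>; the mean of the latter
  is the corner entry of the bordered matrix.\<close>

lemma constraints_B_x: "constraints_B q n x"
proof -
  have x: "x (dbar n u v) = E (\<lambda>g. e g z0 * e g u * e g v)" if "u \<in> W" "v \<in> W" for u v
    using x_pattern[OF z0 that] by (simp add: dbar_pattern)
  have xc: "x_compl x (dbar n u v) = E (\<lambda>g. (1 - e g z0) * e g u * e g v)" if "u \<in> W" "v \<in> W" for u v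
  proof -
    obtain i j t p where d: "dbar n u v = (i,j,t,p)" by (metis prod_cases4)
    show ?thesis unfolding d x_compl_def prod.case x_dbar(1,4)[OF that d]
      by (simp add: mean_diff[symmetric] algebra_simps)
  qed
  have xd: "x (0,0,0,0) - x (weight n u, weight n u, weight n u, weight n u) = E (\<lambda>g. (1 - e g z0) * e g u)"
    if "u \<in> W" for u
    unfolding x_0[OF that] x_diag[OF that] by (simp add: mean_diff[symmetric] algebra_simps)
  have nn: "0 \<le> 1 - e g z0" for g using e_range[of g z0] by simp
  have c: "1 - x (0,0,0,0) = E (\<lambda>g. 1 - e g z0)"
    unfolding mean_diff mean_const x_0[OF z0] ..
  show ?thesis
    unfolding constraints_B_def
  proof (intro conjI allI impI)
    note psd_x = psd_block_E[where h="\<lambda>g. e g z0" and f=x, OF e_range(1) x]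
    note psd_xc = psd_block_E[where h="\<lambda>g. 1 - e g z0" and f="x_compl x", OF nn xc]
    show "psd {k..n + a - k} (block q n a k x)" if "a \<le> k \<and> 2 * k \<le> n + a \<and> k \<noteq> 0" for a k
      using that by (intro psd_x) simp_all
    show "psd {k..n + a - k} (block q n a k (x_compl x))" if "a \<le> k \<and> 2 * k \<le> n + a \<and> k \<noteq> 0" for a k
      using that by (intro psd_xc) simp_all
    show "psd {0..n} (block q n 0 0 x)"
      using psd_x[of 0 0] by simp
    have "psd (bordered_index {0..n}) (bordered (1 - x (0,0,0,0))
        (\<lambda>i. real (n choose i) * (real q - 1) powr (real i / 2) * (x (0,0,0,0) - x (i,i,i,i)))
        (block q n 0 0 (x_compl x)))"
      by (rule psd_bordered_block_E[where h="\<lambda>g. 1 - e g z0" and f="x_compl x", OF nn xc xd c])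
    then show "psd (bordered_index {0..n}) (bordered (1 - x (0,0,0,0))
        (\<lambda>i. (x (0,0,0,0) - x (i,i,i,i)) * real (n choose i) * (real q - 1) powr (real i / 2))
        (block q n 0 0 (x_compl x)))"
      by (simp only: mult_ac)
  qed
qed

lemma sum_hits:
  assumes "g \<in> automs q n"
  shows "(\<Sum>w\<in>W. e g w) = real (card C)"
proof -
  have "(\<Sum>w\<in>W. e g w) = (\<Sum>w\<in>W. of_bool (w \<in> C))"
    unfolding hits_def by (rule sum.reindex_bij_betw[OF bij_betw_automs[OF assms]])
  also have "\<dots> = real (card C)"
    using C by (simp add: finite_words Int_absorb1 flip: of_nat_sum)
  finally show ?thesis .
qed

lemma card_words: "card W = q ^ n"
  by (simp add: words_def card_PiE)

text \<open>Orbit sizes turn the sum over tuples into one over pairs of words. Every automorphism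
  sends exactly |C| words into C, which gives |C|^2 x(0,0,0,0); and q^n x(0,0,0,0) is the mean
  number of words sent into C, again |C|.\<close>

lemma objective_x: "objective q n x = real (card C) ^ 3"
proof -
  have "(\<Sum>(i,j,t,p) \<in> I n. (real q - 1) ^ (i + j - t) * (real q - 2) ^ (t - p) *
        multinom n p (t - p) (i - t) (j - t) * x (i,j,t,p)) = (\<Sum>\<tau>\<in>I n. x \<tau> * orbit_size q n \<tau>)"
    by (intro sum.cong refl) (auto simp: orbit_size_def)
  also have "\<dots> = (\<Sum>\<tau>\<in>I n. x \<tau> * (\<Sum>y | y \<in> W \<times> W \<and> dbar n (fst y) (snd y) = \<tau>. 1))"
    by (intro sum.cong refl) (simp add: card_dbar_eq[OF q, symmetric])
  also have "\<dots> = (\<Sum>u\<in>W. \<Sum>v\<in>W. 1 * x (dbar n u v))"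
    by (rule sum_pairs_dbar[symmetric])
  also have "\<dots> = (\<Sum>u\<in>W. \<Sum>v\<in>W. E (\<lambda>g. e g z0 * e g u * e g v))"
    using x_pattern[OF z0] by (simp add: dbar_pattern)
  also have "\<dots> = E (\<lambda>g. \<Sum>u\<in>W. \<Sum>v\<in>W. e g z0 * e g u * e g v)"
    by (simp only: mean_sum)
  also have "\<dots> = E (\<lambda>g. real (card C) ^ 2 * e g z0)"
  proof (rule mean_cong)
    fix g assume "g \<in> automs q n"
    have "(\<Sum>u\<in>W. \<Sum>v\<in>W. e g z0 * e g u * e g v) = e g z0 * (\<Sum>u\<in>W. e g u) * (\<Sum>v\<in>W. e g v)"
      unfolding sum_distrib_left sum_distrib_right by (rule sum.swap)
    then show "(\<Sum>u\<in>W. \<Sum>v\<in>W. e g z0 * e g u * e g v) = real (card C) ^ 2 * e g z0"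
      by (simp add: sum_hits[OF \<open>g \<in> automs q n\<close>] power2_eq_square)
  qed
  also have "\<dots> = real (card C) ^ 2 * x (0,0,0,0)" by (simp add: mean_cmult x_0[OF z0])
  finally have 1: "objective q n x = real (card C) ^ 2 * (real q ^ n * x (0,0,0,0))"
    by (simp add: objective_def)
  have "real q ^ n * x (0,0,0,0) = (\<Sum>w\<in>W. E (\<lambda>g. e g w))"
    by (simp add: x_0[symmetric] card_words)
  also have "\<dots> = E (\<lambda>g. \<Sum>w\<in>W. e g w)" by (simp only: mean_sum)
  also have "\<dots> = E (\<lambda>g. real (card C))" by (rule mean_cong) (rule sum_hits)
  finally show ?thesis unfolding 1 by (simp add: mean_const power_numeral_reduce)
qed

end

section \<open>Constraints derived from the covering inequality\<close>

locale averaged_covering_code = averaged_code +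
  fixes lam :: "nat \<Rightarrow> real" and \<beta> :: real
  assumes ineq: "satisfies_ineq q n lam \<beta> C"
begin

text \<open>The covering inequality at the word g v, pulled back along g, which preserves distances
  and permutes the words.\<close>

lemma sum_hits_ge:
  assumes g: "g \<in> automs q n" and v: "v \<in> W"
  shows "\<beta> \<le> (\<Sum>w\<in>W. lam (hdist n v w) * e g w)"
proof -
  have gv: "g v \<in> W" using automs_words[OF g v] .
  have "\<beta> \<le> (\<Sum>i=0..n. lam i * real (card (C \<inter> hsphere q n i (g v))))"
    using ineq gv by (simp add: satisfies_ineq_def)
  also have "\<dots> = (\<Sum>i=0..n. \<Sum>w | w \<in> W \<and> hdist n (g v) w = i. lam (hdist n (g v) w) * of_bool (w \<in> C))"
  proof (rule sum.cong[OF refl])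
    fix i
    have "(\<Sum>w | w \<in> W \<and> hdist n (g v) w = i. lam (hdist n (g v) w) * of_bool (w \<in> C))
      = (\<Sum>w\<in>hsphere q n i (g v). lam i * of_bool (w \<in> C))"
      by (rule sum.cong) (auto simp: hsphere_def)
    also have "\<dots> = lam i * real (card (C \<inter> hsphere q n i (g v)))"
      by (simp add: sum_distrib_left[symmetric] hsphere_def finite_words Int_commute flip: of_nat_sum)
    finally show "lam i * real (card (C \<inter> hsphere q n i (g v))) =
      (\<Sum>w | w \<in> W \<and> hdist n (g v) w = i. lam (hdist n (g v) w) * of_bool (w \<in> C))" by simp
  qed
  also have "\<dots> = (\<Sum>w\<in>W. lam (hdist n (g v) w) * of_bool (w \<in> C))"
  proof (rule sum.group)
    have "hdist n u w \<le> n" for u w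
      using card_mono[of "{..<n}" "{l. l < n \<and> u l \<noteq> w l}"] by (auto simp: hdist_def)
    then show "hdist n (g v) ` W \<subseteq> {0..n}" by auto
  qed (auto simp: finite_words)
  also have "\<dots> = (\<Sum>w\<in>W. lam (hdist n (g v) (g w)) * of_bool (g w \<in> C))"
    by (rule sum.reindex_bij_betw[OF bij_betw_automs[OF g], symmetric])
  also have "\<dots> = (\<Sum>w\<in>W. lam (hdist n v w) * e g w)"
    by (intro sum.cong refl) (simp add: automs_hdist[OF g v] hits_def)
  finally show ?thesis .
qed

text \<open>The slack of the covering inequality at the image of the zero word, written as a sum
  over preimages; this is the weight behind (C).\<close>

definition excess :: "(word \<Rightarrow> word) \<Rightarrow> real" where
  "excess g = (\<Sum>w\<in>W. lam (weight n w) * e g w) - \<beta>"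

lemma excess_nonneg: "g \<in> automs q n \<Longrightarrow> 0 \<le> excess g"
  using sum_hits_ge[OF _ z0, of g] by (simp add: excess_def weight_def hdist_commute)

text \<open>\<open>eta\<close> counts words w by their weight and by the pattern of (u, v) seen from
  w, at which x is the mean of e(w) e(u) e(v). Summing over weights and tuples is summing over all
  w, which reproduces the sum in \<open>excess\<close>; the subtracted term is \<beta> times the
  mean of e(u) e(v).\<close>

lemma z_fam_dbar:
  assumes uv: "u \<in> W" "v \<in> W"
  shows "z_fam q n lam \<beta> x (dbar n u v) = E (\<lambda>g. excess g * e g u * e g v)"
proof -
  obtain i j t p where d: "dbar n u v = (i,j,t,p)" by (metis prod_cases4)
  have q1: "q \<ge> 1" using q by simp
  have "(\<Sum>d=0..n. \<Sum>\<tau>' \<in> I n. lam d * real (eta q n \<tau>' d (i,j,t,p)) * x \<tau>')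
      = (\<Sum>(d,\<tau>')\<in>{0..n} \<times> I n. \<Sum>w | w \<in> W \<and> (weight n w, pattern n w u v) = (d,\<tau>'). lam (weight n w) * x (pattern n w u v))"
    unfolding sum.cartesian_product d[symmetric] eta_dbar[OF q1 uv]
    by (intro sum.cong refl) (auto cong: conj_cong)
  also have "\<dots> = (\<Sum>w\<in>W. lam (weight n w) * x (pattern n w u v))"
    unfolding case_prod_unfold prod.collapse
    by (rule sum.group) (simp_all add: finite_words finite_I weight_le pattern_in_I image_subset_iff)
  also have "\<dots> = (\<Sum>w\<in>W. lam (weight n w) * E (\<lambda>g. e g w * e g u * e g v))"
    by (intro sum.cong refl) (simp add: x_pattern uv)
  also have "\<dots> = E (\<lambda>g. \<Sum>w\<in>W. lam (weight n w) * (e g w * e g u * e g v))"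
    by (simp only: mean_sum mean_cmult)
  finally have 1: "(\<Sum>d=0..n. \<Sum>\<tau>' \<in> I n. lam d * real (eta q n \<tau>' d (i,j,t,p)) * x \<tau>') = \<dots>" .
  show ?thesis
    unfolding d z_fam_def prod.case 1 x_dbar(4)[OF uv d] mean_cmult[symmetric] mean_diff[symmetric]
    by (rule mean_cong) (simp add: excess_def sum_distrib_left algebra_simps)
qed

lemma constraints_C_x: "constraints_C q n lam \<beta> x"
  unfolding constraints_C_def
proof (intro conjI allI impI)
  show "psd {k..n + a - k} (block q n a k (z_fam q n lam \<beta> x))" if "a \<le> k \<and> 2 * k \<le> n + a \<and> k \<noteq> 0" for a k
    using that by (intro psd_block_E[where h=excess, OF excess_nonneg z_fam_dbar]) simp_all
  show "psd (bordered_index {0..n})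
       (bordered ((\<Sum>i=0..n. real (n choose i) * (real q - 1) ^ i * lam i * x (0,0,0,0)) - \<beta>)
          (\<lambda>i. real (n choose i) * (real q - 1) powr (real i / 2) * z_fam q n lam \<beta> x (i,i,i,i))
          (block q n 0 0 (z_fam q n lam \<beta> x)))"
  proof (rule psd_bordered_block_E[where h=excess and r="\<lambda>i. z_fam q n lam \<beta> x (i,i,i,i)", OF excess_nonneg z_fam_dbar])
    show "z_fam q n lam \<beta> x (weight n u, weight n u, weight n u, weight n u) = E (\<lambda>g. excess g * e g u)" if "u \<in> W" for u
      using z_fam_dbar[OF that that] by (simp add: dbar_self mult.assoc e_idem)
    \<comment> \<open>The corner entry is the mean of the weight itself, with words grouped by
      weight.\<close>
    have "E excess = (\<Sum>w\<in>W. lam (weight n w) * E (\<lambda>g. e g w)) - \<beta>"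
      unfolding excess_def mean_diff mean_const mean_sum mean_cmult ..
    also have "(\<Sum>w\<in>W. lam (weight n w) * E (\<lambda>g. e g w)) = (\<Sum>w\<in>W. lam (weight n w) * x (0,0,0,0))"
      by (intro sum.cong refl) (simp add: x_0)
    also have "\<dots> = (\<Sum>i=0..n. real (n choose i) * (real q - 1) ^ i * (lam i * x (0,0,0,0)))"
      by (rule sum_words_weight[OF q])
    finally show "(\<Sum>i=0..n. real (n choose i) * (real q - 1) ^ i * lam i * x (0,0,0,0)) - \<beta> = E excess"
      by (simp add: mult.assoc)
  qed
qed

text \<open>Each word w is counted once, under the tuple of (u, w) and its distance to v. The first
  entry of that tuple is always the weight i of u, so only the other three vary.\<close>

lemma sum_lam_count:
  assumes uv: "u \<in> W" "v \<in> W" "dbar n u v = (i,j,t,p)"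
  shows "(\<Sum>s\<in>{(j',t',p'). (i,j',t',p') \<in> I n}. Y s * lam_count q n lam (i,s) (i,j,t,p))
    = (\<Sum>w\<in>W. lam (hdist n v w) * Y (snd (dbar n u w)))"
proof -
  define J where "J = {(j',t',p'). (i,j',t',p') \<in> I n}"
  have q1: "q \<ge> 1" using q by simp
  have fin: "finite J" by (rule finite_subset[of _ "{..n}\<times>{..n}\<times>{..n}"]) (auto simp: I_def J_def)
  have fst: "fst (dbar n u w) = i" for w using uv(3) by (auto simp: dbar_def)
  have dJ: "snd (dbar n u w) \<in> J" for w
  proof -
    obtain j' t' p' where d: "dbar n u w = (i,j',t',p')" using fst[of w] by (metis prod.collapse)
    with dbar_in_I[of n u w] show ?thesis by (simp add: J_def)
  qed
  have hd: "hdist n v w \<le> n" for w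
    using card_mono[of "{..<n}" "{l. l < n \<and> v l \<noteq> w l}"] by (auto simp: hdist_def)
  have "(\<Sum>s\<in>J. Y s * lam_count q n lam (i,s) (i,j,t,p))
     = (\<Sum>(s,d)\<in>J\<times>{0..n}. Y s * (lam d * real (card {w \<in> W. dbar n u w = (i,s) \<and> hdist n v w = d})))"
    unfolding lam_count_def uv(3)[symmetric] pair_count_dbar[OF q1 uv(1,2)] sum_distrib_left sum.cartesian_product ..
  also have "\<dots> = (\<Sum>(s,d)\<in>J\<times>{0..n}. \<Sum>w | w \<in> W \<and> (snd (dbar n u w), hdist n v w) = (s,d). lam (hdist n v w) * Y (snd (dbar n u w)))"
  proof (rule sum.cong[OF refl], clarify)
    fix j' t' p' d
    have "{w \<in> W. dbar n u w = (i,j',t',p') \<and> hdist n v w = d} = {w \<in> W. (snd (dbar n u w), hdist n v w) = ((j',t',p'),d)}"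
      using fst by (metis (no_types, lifting) prod.collapse prod.inject snd_conv)
    then show "Y (j',t',p') * (lam d * real (card {w \<in> W. dbar n u w = (i,j',t',p') \<and> hdist n v w = d}))
      = (\<Sum>w | w \<in> W \<and> (snd (dbar n u w), hdist n v w) = ((j',t',p'),d). lam (hdist n v w) * Y (snd (dbar n u w)))"
      by simp
  qed
  also have "\<dots> = (\<Sum>w\<in>W. lam (hdist n v w) * Y (snd (dbar n u w)))"
    unfolding case_prod_unfold prod.collapse
    by (rule sum.group) (simp_all add: finite_words fin dJ hd image_subset_iff)
  finally show ?thesis by (simp add: J_def)
qed

text \<open>The covering inequality at g v is multiplied by the nonnegative h g and averaged. The
  word v enters only through the coefficients \<open>lam_count\<close>.\<close>

lemma sum_lam_count_ge:
  assumes uv: "u \<in> W" "v \<in> W" "dbar n u v = (i,j,t,p)"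
    and h: "\<And>g. g \<in> automs q n \<Longrightarrow> 0 \<le> h g"
    and Y: "\<And>w j' t' p'. w \<in> W \<Longrightarrow> dbar n u w = (i,j',t',p') \<Longrightarrow> Y j' t' p' = E (\<lambda>g. h g * e g w)"
  shows "E h * \<beta> \<le> (\<Sum>(j',t',p')\<in>{(j',t',p'). (i,j',t',p') \<in> I n}. Y j' t' p' * lam_count q n lam (i,j',t',p') (i,j,t,p))"
proof -
  have "E h * \<beta> = E (\<lambda>g. \<beta> * h g)" by (simp add: mean_cmult)
  also have "\<dots> \<le> E (\<lambda>g. (\<Sum>w\<in>W. lam (hdist n v w) * e g w) * h g)"
    by (intro mean_mono mult_right_mono sum_hits_ge uv h)
  also have "\<dots> = E (\<lambda>g. \<Sum>w\<in>W. lam (hdist n v w) * (h g * e g w))"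
    by (rule mean_cong) (simp add: sum_distrib_left sum_distrib_right mult_ac)
  also have "\<dots> = (\<Sum>w\<in>W. lam (hdist n v w) * E (\<lambda>g. h g * e g w))"
    by (simp only: mean_sum mean_cmult)
  also have "\<dots> = (\<Sum>w\<in>W. lam (hdist n v w) * (case snd (dbar n u w) of (j',t',p') \<Rightarrow> Y j' t' p'))"
  proof (intro sum.cong refl)
    fix w assume w: "w \<in> W"
    have "fst (dbar n u w) = i" using uv(3) by (auto simp: dbar_def)
    then obtain j' t' p' where d: "dbar n u w = (i,j',t',p')" by (metis prod.collapse)
    show "lam (hdist n v w) * E (\<lambda>g. h g * e g w) = lam (hdist n v w) * (case snd (dbar n u w) of (j',t',p') \<Rightarrow> Y j' t' p')"
      by (simp add: d Y[OF w d])
  qed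
  also have "\<dots> = (\<Sum>s\<in>{(j',t',p'). (i,j',t',p') \<in> I n}. (case s of (j',t',p') \<Rightarrow> Y j' t' p') * lam_count q n lam (i,s) (i,j,t,p))"
    by (rule sum_lam_count[OF uv, symmetric])
  also have "\<dots> = (\<Sum>(j',t',p')\<in>{(j',t',p'). (i,j',t',p') \<in> I n}. Y j' t' p' * lam_count q n lam (i,j',t',p') (i,j,t,p))"
    by (intro sum.cong refl) auto
  finally show ?thesis .
qed

text \<open>The weights are e(0) e(u), e(0) (1 - e(u)), (1 - e(0)) e(u) and (1 - e(0)) (1 - e(u)):
  one for each way in which the images of 0 and u can lie in C or not.\<close>

lemma constraints_D_x: "constraints_D q n lam \<beta> x"
  unfolding constraints_D_def Let_def
proof (rule ballI, goal_cases)
  case (1 \<tau>)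
  obtain i j t p where \<tau>: "\<tau> = (i,j,t,p)" by (metis prod_cases4)
  have "(i,j,t,p) \<in> I n" using 1 unfolding \<tau> .
  then obtain u v where uv: "u \<in> W" "v \<in> W" "dbar n u v = (i,j,t,p)" by (rule dbar_surj[OF q])
  have e1: "0 \<le> 1 - e g w" for g w using e_range[of g w] by simp
  have 1: "x (i,j',t',p') = E (\<lambda>g. e g z0 * e g u * e g w)"
    if "w \<in> W" "dbar n u w = (i,j',t',p')" for w j' t' p'
    by (rule x_dbar(1)[OF uv(1) that])
  have h2: "x (0,0,0,0) - x (i,0,0,0) = E (\<lambda>g. e g z0 * (1 - e g u))"
    unfolding x_0[OF z0] x_dbar(2)[OF uv] mean_diff[symmetric] by (simp add: algebra_simps)
  have 2: "x (j',0,0,0) - x (i,j',t',p') = E (\<lambda>g. e g z0 * (1 - e g u) * e g w)"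
    if "w \<in> W" "dbar n u w = (i,j',t',p')" for w j' t' p'
    unfolding x_dbar(1)[OF uv(1) that] x_dbar(3)[OF uv(1) that] mean_diff[symmetric] by (simp add: algebra_simps)
  \<comment> \<open>Here x(0,0,0,0) is evaluated at u instead of the zero word, so two different
    weights have the same mean.\<close>
  have h3: "x (0,0,0,0) - x (i,0,0,0) = E (\<lambda>g. (1 - e g z0) * e g u)"
    unfolding x_0[OF uv(1)] x_dbar(2)[OF uv] mean_diff[symmetric] by (simp add: algebra_simps)
  have 3: "x (i+j'-t'-p',0,0,0) - x (i,j',t',p') = E (\<lambda>g. (1 - e g z0) * e g u * e g w)"
    if "w \<in> W" "dbar n u w = (i,j',t',p')" for w j' t' p'
    unfolding x_dbar(1)[OF uv(1) that] x_dbar(4)[OF uv(1) that] mean_diff[symmetric] by (simp add: algebra_simps)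
  have "E (\<lambda>g. (1 - e g z0) * (1 - e g u)) = E (\<lambda>g. 1 - e g z0 - e g u + e g z0 * e g u)"
    by (simp add: algebra_simps)
  then have h4: "1 - 2 * x (0,0,0,0) + x (i,0,0,0) = E (\<lambda>g. (1 - e g z0) * (1 - e g u))"
    using x_0[OF z0] x_0[OF uv(1)] x_dbar(2)[OF uv] by (simp add: mean_diff mean_add mean_const)
  have 4: "x (0,0,0,0) - x (j',0,0,0) - x (i+j'-t'-p',0,0,0) + x (i,j',t',p') = E (\<lambda>g. (1 - e g z0) * (1 - e g u) * e g w)"
    if "w \<in> W" "dbar n u w = (i,j',t',p')" for w j' t' p'
    unfolding x_0[OF that(1)] x_dbar(1)[OF uv(1) that] x_dbar(3)[OF uv(1) that] x_dbar(4)[OF uv(1) that]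
      mean_diff[symmetric] mean_add[symmetric]
    by (simp add: algebra_simps)
  note ge1 = sum_lam_count_ge[where h="\<lambda>g. e g z0 * e g u" and Y="\<lambda>j' t' p'. x (i,j',t',p')", OF uv _ 1, folded x_dbar(2)[OF uv]]
  note ge2 = sum_lam_count_ge[where h="\<lambda>g. e g z0 * (1 - e g u)" and Y="\<lambda>j' t' p'. x (j',0,0,0) - x (i,j',t',p')", OF uv _ 2, folded h2]
  note ge3 = sum_lam_count_ge[where h="\<lambda>g. (1 - e g z0) * e g u" and Y="\<lambda>j' t' p'. x (i+j'-t'-p',0,0,0) - x (i,j',t',p')", OF uv _ 3, folded h3]
  note ge4 = sum_lam_count_ge[where h="\<lambda>g. (1 - e g z0) * (1 - e g u)"
      and Y="\<lambda>j' t' p'. x (0,0,0,0) - x (j',0,0,0) - x (i+j'-t'-p',0,0,0) + x (i,j',t',p')", OF uv _ 4, folded h4]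
  show ?case
    unfolding \<tau> prod.case
    by (intro conjI ge1 ge2 ge3 ge4 mult_nonneg_nonneg e_range e1)
qed

lemma feasible_x: "feasible q n lam \<beta> x"
  unfolding feasible_def using constraints_A_x constraints_B_x constraints_C_x constraints_D_x by blast

end

section \<open>Existence of covering codes\<close>

text \<open>In the code of words vanishing on the first r coordinates, zeroing those coordinates
  moves a word by at most r, while the all-one word differs from every codeword in all of
  them.\<close>

lemma covering_code_exists:
  assumes "q \<ge> 2" "r \<le> n"
  shows "\<exists>C \<subseteq> words q n. has_covering_radius q n C r"
proof (intro exI conjI)
  define C where "C = {u \<in> words q n. \<forall>l<r. u l = 0}"
  show "C \<subseteq> words q n" by (auto simp: C_def)
  show "has_covering_radius q n C r"
    unfolding has_covering_radius_def
  proof (intro conjI allI impI)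
    show "(\<Union>u\<in>C. hball q n r u) = words q n"
    proof (intro equalityI subsetI)
      fix v assume v: "v \<in> words q n"
      define u where "u = (\<lambda>l\<in>{..<n}. if l < r then 0 else v l)"
      have "u \<in> C"
        using assms words_letter[OF v] by (auto simp: C_def u_def words_def restrict_PiE_iff)
      moreover have "hdist n u v \<le> card {..<r}"
        unfolding hdist_def by (rule card_mono) (auto simp: u_def split: if_splits)
      ultimately show "v \<in> (\<Union>u\<in>C. hball q n r u)" using v by (auto simp: hball_def)
    qed (auto simp: hball_def)
    fix s assume s: "(\<Union>u\<in>C. hball q n s u) = words q n"
    define v where "v = (\<lambda>l\<in>{..<n}. 1 :: int)"
    have "v \<in> words q n" using assms by (auto simp: v_def words_def)
    then obtain u where u: "u \<in> C" "hdist n u v \<le> s" using s by (auto simp: hball_def)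
    have "card {..<r} \<le> hdist n u v"
      unfolding hdist_def using u(1) assms by (intro card_mono) (auto simp: v_def C_def)
    with u(2) show "r \<le> s" by simp
  qed
qed

text \<open>\<open>Min\<close> is informative only on a finite nonempty set, so a code of exactly
  this radius must exist first.\<close>

lemma K_attained:
  assumes "q \<ge> 2" "r \<le> n"
  obtains C where "C \<subseteq> words q n" "has_covering_radius q n C r" "card C = K q n r"
proof -
  define S where "S = {card C | C. C \<subseteq> words q n \<and> has_covering_radius q n C r}"
  have "S \<subseteq> card ` Pow (words q n)" by (auto simp: S_def)
  then have "finite S" by (rule finite_subset) (simp add: finite_words)
  moreover have "S \<noteq> {}" using covering_code_exists[OF assms] by (auto simp: S_def)
  ultimately have "Min S \<in> S" by (rule Min_in)
  then show thesis using that by (auto simp: S_def K_def)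
qed

section \<open>Attainment of the minimum\<close>

lemma I_values:
  assumes "(i,j,t,p) \<in> I n"
  shows "(i,i,i,i) \<in> I n" "(i,0,0,0) \<in> I n" "(j,0,0,0) \<in> I n" "(i+j-t-p,0,0,0) \<in> I n" "(0,0,0,0) \<in> I n"
  using assms by (auto simp: I_def)

lemma psd_cong:
  assumes "\<And>i j. i \<in> A \<Longrightarrow> j \<in> A \<Longrightarrow> M i j = N i j"
  shows "psd A M \<longleftrightarrow> psd A N"
  unfolding psd_def using assms by (simp cong: sum.cong)

lemma psd_bordered_cong:
  assumes "c = c'" "\<And>i. i \<in> A \<Longrightarrow> y i = y' i" "M = M'"
  shows "psd (bordered_index A) (bordered c y M) \<longleftrightarrow> psd (bordered_index A) (bordered c' y' M')"
  by (rule psd_cong) (use assms in \<open>auto simp: bordered_index_def\<close>)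

lemma block_cong:
  assumes "\<And>\<tau>. \<tau> \<in> I n \<Longrightarrow> f \<tau> = g \<tau>"
  shows "block q n a k f = block q n a k g"
  unfolding block_def by (intro ext sum.cong refl) (auto simp: assms)

lemma objective_cong:
  assumes "\<And>\<tau>. \<tau> \<in> I n \<Longrightarrow> x \<tau> = y \<tau>"
  shows "objective q n x = objective q n y"
  unfolding objective_def by (intro arg_cong2[where f="(*)"] refl sum.cong) (auto simp: assms)

lemma x_compl_cong:
  assumes "\<And>\<tau>. \<tau> \<in> I n \<Longrightarrow> x \<tau> = y \<tau>" "\<tau> \<in> I n"
  shows "x_compl x \<tau> = x_compl y \<tau>"
proof -
  obtain i j t p where \<tau>: "\<tau> = (i,j,t,p)" by (metis prod_cases4)
  have "x (i+j-t-p,0,0,0) = y (i+j-t-p,0,0,0)" using assms(2) unfolding \<tau> by (intro assms(1) I_values)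
  then show ?thesis using assms by (simp add: \<tau> x_compl_def)
qed

lemma z_fam_cong:
  assumes "\<And>\<tau>. \<tau> \<in> I n \<Longrightarrow> x \<tau> = y \<tau>" "\<tau> \<in> I n"
  shows "z_fam q n lam \<beta> x \<tau> = z_fam q n lam \<beta> y \<tau>"
proof -
  obtain i j t p where \<tau>: "\<tau> = (i,j,t,p)" by (metis prod_cases4)
  have "x (i+j-t-p,0,0,0) = y (i+j-t-p,0,0,0)" using assms(2) unfolding \<tau> by (intro assms(1) I_values)
  moreover have "(\<Sum>d=0..n. \<Sum>\<tau>' \<in> I n. lam d * real (eta q n \<tau>' d (i,j,t,p)) * x \<tau>')
     = (\<Sum>d=0..n. \<Sum>\<tau>' \<in> I n. lam d * real (eta q n \<tau>' d (i,j,t,p)) * y \<tau>')"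
    by (intro sum.cong refl) (simp add: assms(1))
  ultimately show ?thesis by (simp add: \<tau> z_fam_def)
qed

lemma constraints_A_cong:
  assumes eq: "\<And>\<tau>. \<tau> \<in> I n \<Longrightarrow> x \<tau> = y \<tau>" and "constraints_A n x"
  shows "constraints_A n y"
  unfolding constraints_A_def
proof (rule ballI, goal_cases)
  case (1 \<tau>)
  obtain i j t p where \<tau>: "\<tau> = (i,j,t,p)" by (metis prod_cases4)
  have I: "(i,j,t,p) \<in> I n" using 1 unfolding \<tau> .
  have "\<forall>(i',j',t',p') \<in> I n.
        {#i, j, i+j-t-p#} = {#i', j', i'+j'-t'-p'#} \<and> t - p = t' - p' \<longrightarrow>
        y (i,j,t,p) = x (i',j',t',p')"
    using bspec[OF assms(2)[unfolded constraints_A_def] I] unfolding prod.case eq[OF I] by blast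
  then have "\<forall>(i',j',t',p') \<in> I n.
        {#i, j, i+j-t-p#} = {#i', j', i'+j'-t'-p'#} \<and> t - p = t' - p' \<longrightarrow>
        y (i,j,t,p) = y (i',j',t',p')"
    by (auto simp: eq split: prod.splits)
  then show ?case
    using bspec[OF assms(2)[unfolded constraints_A_def] I]
    unfolding \<tau> prod.case eq[OF I] eq[OF I_values(1)[OF I]] eq[OF I_values(2)[OF I]] eq[OF I_values(4)[OF I]]
      eq[OF I_values(5)[OF I]]
    by (intro conjI) blast+
qed

lemma constraints_B_cong:
  assumes eq: "\<And>\<tau>. \<tau> \<in> I n \<Longrightarrow> x \<tau> = y \<tau>"
  shows "constraints_B q n x \<longleftrightarrow> constraints_B q n y"
proof -
  have b: "block q n a k x = block q n a k y" for a k by (rule block_cong) (rule eq)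
  have bc: "block q n a k (x_compl x) = block q n a k (x_compl y)" for a k
    by (rule block_cong) (rule x_compl_cong[where x=x and y=y, OF eq])
  have "psd (bordered_index {0..n})
       (bordered (1 - x (0,0,0,0))
          (\<lambda>i. (x (0,0,0,0) - x (i,i,i,i)) * real (n choose i) * (real q - 1) powr (real i / 2))
          (block q n 0 0 (x_compl x))) \<longleftrightarrow> psd (bordered_index {0..n})
       (bordered (1 - y (0,0,0,0))
          (\<lambda>i. (y (0,0,0,0) - y (i,i,i,i)) * real (n choose i) * (real q - 1) powr (real i / 2))
          (block q n 0 0 (x_compl y)))"
    by (rule psd_bordered_cong) (auto simp: bc eq I_def)
  then show ?thesis by (simp add: constraints_B_def b bc)
qed

lemma constraints_C_cong:
  assumes eq: "\<And>\<tau>. \<tau> \<in> I n \<Longrightarrow> x \<tau> = y \<tau>"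
  shows "constraints_C q n lam \<beta> x \<longleftrightarrow> constraints_C q n lam \<beta> y"
proof -
  have b: "block q n a k (z_fam q n lam \<beta> x) = block q n a k (z_fam q n lam \<beta> y)" for a k
    by (rule block_cong) (rule z_fam_cong[where x=x and y=y, OF eq])
  have z: "z_fam q n lam \<beta> x (i,i,i,i) = z_fam q n lam \<beta> y (i,i,i,i)" if "i \<in> {0..n}" for i
    by (rule z_fam_cong[where x=x and y=y, OF eq]) (use that in \<open>auto simp: I_def\<close>)
  have 0: "x (0,0,0,0) = y (0,0,0,0)" by (rule eq) (simp add: I_def)
  have "psd (bordered_index {0..n})
       (bordered ((\<Sum>i=0..n. real (n choose i) * (real q - 1) ^ i * lam i * x (0,0,0,0)) - \<beta>)
          (\<lambda>i. real (n choose i) * (real q - 1) powr (real i / 2) * z_fam q n lam \<beta> x (i,i,i,i))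
          (block q n 0 0 (z_fam q n lam \<beta> x))) \<longleftrightarrow> psd (bordered_index {0..n})
       (bordered ((\<Sum>i=0..n. real (n choose i) * (real q - 1) ^ i * lam i * y (0,0,0,0)) - \<beta>)
          (\<lambda>i. real (n choose i) * (real q - 1) powr (real i / 2) * z_fam q n lam \<beta> y (i,i,i,i))
          (block q n 0 0 (z_fam q n lam \<beta> y)))"
    by (rule psd_bordered_cong) (simp_all only: b z 0)
  then show ?thesis by (simp only: constraints_C_def b)
qed

lemma constraints_D_cong:
  assumes eq: "\<And>\<tau>. \<tau> \<in> I n \<Longrightarrow> x \<tau> = y \<tau>" and "constraints_D q n lam \<beta> x"
  shows "constraints_D q n lam \<beta> y"
  unfolding constraints_D_def Let_def
proof (rule ballI, goal_cases)
  case (1 \<tau>)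
  obtain i j t p where \<tau>: "\<tau> = (i,j,t,p)" by (metis prod_cases4)
  have I: "(i,j,t,p) \<in> I n" using 1 unfolding \<tau> .
  define J where "J = {(j',t',p'). (i,j',t',p') \<in> I n}"
  define L where "L j' t' p' = lam_count q n lam (i,j',t',p') (i,j,t,p)" for j' t' p'
  have s: "(\<Sum>(j',t',p')\<in>J. F j' t' p' * L j' t' p') = (\<Sum>(j',t',p')\<in>J. G j' t' p' * L j' t' p')"
    if "\<And>j' t' p'. (i,j',t',p') \<in> I n \<Longrightarrow> F j' t' p' = G j' t' p'" for F G
    by (intro sum.cong refl) (auto simp: J_def that)
  have v': "y (i,j',t',p') = x (i,j',t',p') \<and> y (j',0,0,0) = x (j',0,0,0) \<and>
      y (i+j'-t'-p',0,0,0) = x (i+j'-t'-p',0,0,0) \<and> y (0,0,0,0) = x (0,0,0,0)"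
    if "(i,j',t',p') \<in> I n" for j' t' p'
    using eq[OF that] eq[OF I_values(3)[OF that]] eq[OF I_values(4)[OF that]] eq[OF I_values(5)[OF that]] by simp
  have sums:
    "(\<Sum>(j',t',p')\<in>J. y (i,j',t',p') * L j' t' p') = (\<Sum>(j',t',p')\<in>J. x (i,j',t',p') * L j' t' p')"
    "(\<Sum>(j',t',p')\<in>J. (y (j',0,0,0) - y (i,j',t',p')) * L j' t' p') = (\<Sum>(j',t',p')\<in>J. (x (j',0,0,0) - x (i,j',t',p')) * L j' t' p')"
    "(\<Sum>(j',t',p')\<in>J. (y (i+j'-t'-p',0,0,0) - y (i,j',t',p')) * L j' t' p') = (\<Sum>(j',t',p')\<in>J. (x (i+j'-t'-p',0,0,0) - x (i,j',t',p')) * L j' t' p')"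
    "(\<Sum>(j',t',p')\<in>J. (y (0,0,0,0) - y (j',0,0,0) - y (i+j'-t'-p',0,0,0) + y (i,j',t',p')) * L j' t' p')
      = (\<Sum>(j',t',p')\<in>J. (x (0,0,0,0) - x (j',0,0,0) - x (i+j'-t'-p',0,0,0) + x (i,j',t',p')) * L j' t' p')"
    by (rule s; drule v'; simp)+
  have v: "y (i,0,0,0) = x (i,0,0,0)" "y (0,0,0,0) = x (0,0,0,0)"
    using I by (simp_all add: eq I_values)
  show ?case
    using bspec[OF assms(2)[unfolded constraints_D_def Let_def] I]
    unfolding \<tau> prod.case J_def[symmetric] L_def[symmetric] unfolding sums unfolding v .
qed

lemma feasible_cong:
  assumes "\<And>\<tau>. \<tau> \<in> I n \<Longrightarrow> x \<tau> = y \<tau>" "feasible q n lam \<beta> x"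
  shows "feasible q n lam \<beta> y"
  using assms(2) constraints_A_cong[where x=x and y=y, OF assms(1)]
    constraints_B_cong[where x=x and y=y, OF assms(1)] constraints_C_cong[where x=x and y=y, OF assms(1)]
    constraints_D_cong[where x=x and y=y, OF assms(1)]
  unfolding feasible_def by blast

section \<open>Boundedness and closedness of the feasible set\<close>

lemma psd_diag_nonneg:
  assumes "psd A M" "finite A" "a \<in> A"
  shows "0 \<le> M a a"
proof -
  have "0 \<le> (\<Sum>i\<in>A. \<Sum>j\<in>A. (if i = a then 1 else 0) * M i j * (if j = a then 1 else 0))"
    using assms(1)[unfolded psd_def, THEN conjunct2, THEN spec[of _ "\<lambda>i. if i = a then 1 else 0"]] .
  also have "\<dots> = (\<Sum>i\<in>A. \<Sum>j\<in>A. if j = a then if i = a then M i j else 0 else 0)"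
    by (intro sum.cong refl) simp
  also have "\<dots> = M a a" using assms by simp
  finally show ?thesis .
qed

text \<open>The chain is x(i,j,t,p) \<le> x(i,i,i,i) \<le> x(0,0,0,0) \<le> 1. Its middle step is
  the bound by x(i+j-t-p,0,0,0) at the tuple (i,i,i,i), its last one the corner entry of the
  bordered matrix in (B).\<close>

lemma feasible_bounds:
  assumes "feasible q n lam \<beta> x" "\<tau> \<in> I n"
  shows "x \<tau> \<in> {0..1}"
proof -
  obtain i j t p where \<tau>: "\<tau> = (i,j,t,p)" by (metis prod_cases4)
  have I: "(i,j,t,p) \<in> I n" "(i,i,i,i) \<in> I n" using assms(2) I_values unfolding \<tau> by auto
  have A: "constraints_A n x" and B: "constraints_B q n x" using assms(1) by (auto simp: feasible_def)
  have "0 \<le> x (i,j,t,p)" "x (i,j,t,p) \<le> x (i,i,i,i)"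
    using bspec[OF A[unfolded constraints_A_def] I(1)] by simp_all
  moreover have "x (i,i,i,i) \<le> x (0,0,0,0)"
    using bspec[OF A[unfolded constraints_A_def] I(2)] by simp
  moreover have "0 \<le> 1 - x (0,0,0,0)"
  proof -
    have "psd (bordered_index {0..n}) (bordered (1 - x (0,0,0,0))
          (\<lambda>i. (x (0,0,0,0) - x (i,i,i,i)) * real (n choose i) * (real q - 1) powr (real i / 2))
          (block q n 0 0 (x_compl x)))"
      using B unfolding constraints_B_def by blast
    from psd_diag_nonneg[OF this, of None] show ?thesis by (simp add: bordered_index_def)
  qed
  ultimately show ?thesis by (simp add: \<tau>)
qed

lemma continuous_coord: "continuous_on UNIV (\<lambda>x :: tuple \<Rightarrow> real. x \<tau>)"
  by (rule continuous_on_product_coordinates)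

lemma closed_Collect_ball:
  assumes "\<And>i. i \<in> A \<Longrightarrow> closed {x. P i x}"
  shows "closed {x. \<forall>i\<in>A. P i x}"
  unfolding Collect_ball_eq using assms by (intro closed_INT) auto

lemma closed_Collect_imp_const: "(P \<Longrightarrow> closed {x. Q x}) \<Longrightarrow> closed {x. P \<longrightarrow> Q x}"
  by (cases P) simp_all

lemma closed_psd:
  fixes M :: "'a :: topological_space \<Rightarrow> 'i \<Rightarrow> 'i \<Rightarrow> real"
  assumes "\<And>i j. i \<in> A \<Longrightarrow> j \<in> A \<Longrightarrow> continuous_on UNIV (\<lambda>x. M x i j)"
  shows "closed {x. psd A (M x)}"
  unfolding psd_def
  by (intro closed_Collect_conj closed_Collect_ball closed_Collect_all closed_Collect_eq closed_Collect_le
      continuous_intros assms)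

lemma continuous_block:
  assumes "\<And>\<tau>. continuous_on UNIV (\<lambda>x. F x \<tau>)"
  shows "continuous_on UNIV (\<lambda>x. block q n a k (F x) i j)"
  unfolding block_def case_prod_unfold by (intro continuous_intros assms)

lemma closed_psd_bordered_block:
  assumes "continuous_on UNIV c" "\<And>i. continuous_on UNIV (\<lambda>x. y x i)" "\<And>\<tau>. continuous_on UNIV (\<lambda>x. F x \<tau>)"
  shows "closed {x. psd (bordered_index A) (bordered (c x) (y x) (block q n a k (F x)))}"
proof (rule closed_psd)
  show "continuous_on UNIV (\<lambda>x. bordered (c x) (y x) (block q n a k (F x)) i j)" for i j
    using assms continuous_block[OF assms(3)] by (cases i; cases j) simp_all
qed

lemma continuous_x_compl: "continuous_on UNIV (\<lambda>x. x_compl x \<tau>)"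
  unfolding x_compl_def case_prod_unfold by (intro continuous_intros continuous_coord)

lemma continuous_z_fam: "continuous_on UNIV (\<lambda>x. z_fam q n lam \<beta> x \<tau>)"
  unfolding z_fam_def case_prod_unfold by (intro continuous_intros continuous_coord)

lemma continuous_objective: "continuous_on UNIV (\<lambda>x. objective q n x)"
  unfolding objective_def case_prod_unfold by (intro continuous_intros continuous_coord)

text \<open>Every condition is an equality or a non-strict inequality between continuous functions;
  positive semidefiniteness is an intersection of such conditions over all test vectors.\<close>

lemma closed_feasible: "closed {x. feasible q n lam \<beta> x}"
proof -
  have "closed {x. constraints_A n x}"
    unfolding constraints_A_def case_prod_unfold
    by (intro closed_Collect_conj closed_Collect_ball closed_Collect_imp_const closed_Collect_eq closed_Collect_le
      continuous_intros continuous_coord)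
  moreover have "closed {x. constraints_B q n x}"
    unfolding constraints_B_def
    by (intro closed_Collect_conj closed_Collect_all closed_Collect_imp_const closed_psd_bordered_block closed_psd
      continuous_block continuous_x_compl continuous_coord continuous_intros)
  moreover have "closed {x. constraints_C q n lam \<beta> x}"
    unfolding constraints_C_def
    by (intro closed_Collect_conj closed_Collect_all closed_Collect_imp_const closed_psd_bordered_block closed_psd
      continuous_block continuous_z_fam continuous_coord continuous_intros)
  moreover have "closed {x. constraints_D q n lam \<beta> x}"
    unfolding constraints_D_def Let_def case_prod_unfold
    by (intro closed_Collect_conj closed_Collect_ball closed_Collect_le continuous_intros continuous_coord)
  ultimately show ?thesis unfolding feasible_def by (intro closed_Collect_conj)
qed

text \<open>Families are functions on infinitely many tuples, so bounds on \<open>I n\<close> alone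
  give no compactness. Resetting all other values to 0 changes neither feasibility nor the
  objective, so a minimum over the resulting compact set is a global one.\<close>

lemma minimum_exists:
  assumes "feasible q n lam \<beta> x0"
  shows "\<exists>x. is_arg_min (objective q n) (feasible q n lam \<beta>) x"
proof -
  define B where "B = PiE UNIV (\<lambda>\<tau>. if \<tau> \<in> I n then {0..1::real} else {0})"
  define S where "S = B \<inter> {x. feasible q n lam \<beta> x}"
  define cut where "cut x = (\<lambda>\<tau>. if \<tau> \<in> I n then x \<tau> else 0)" for x :: "tuple \<Rightarrow> real"
  have cut: "feasible q n lam \<beta> (cut x)" "objective q n (cut x) = objective q n x" "cut x \<in> B"
    if "feasible q n lam \<beta> x" for x
  proof -
    show "feasible q n lam \<beta> (cut x)" by (rule feasible_cong[OF _ that]) (simp add: cut_def)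
    show "objective q n (cut x) = objective q n x" by (rule objective_cong) (simp add: cut_def)
    show "cut x \<in> B" using feasible_bounds[OF that] by (auto simp: cut_def B_def)
  qed
  \<comment> \<open>Tychonoff, with the one-point factor {0} at each tuple outside
    \<open>I n\<close>.\<close>
  have "compactin (product_topology (\<lambda>_. euclidean) UNIV) B"
    unfolding B_def compactin_PiE by auto
  then have "compact B" by (simp add: euclidean_product_topology)
  then have "compact S" unfolding S_def using closed_feasible by (rule compact_Int_closed)
  moreover have "S \<noteq> {}" using cut[OF assms] by (auto simp: S_def)
  moreover have "continuous_on S (objective q n)"
    using continuous_objective by (rule continuous_on_subset) simp
  ultimately obtain x where x: "x \<in> S" "\<And>y. y \<in> S \<Longrightarrow> objective q n x \<le> objective q n y"
    using continuous_attains_inf by metis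
  have "objective q n x \<le> objective q n y" if "feasible q n lam \<beta> y" for y
    using x(2)[of "cut y"] cut[OF that] by (simp add: S_def)
  then show ?thesis using x(1) by (force simp: is_arg_min_def S_def)
qed

theorem theorem4p18:
  fixes q n r :: nat and lam :: "nat \<Rightarrow> real" and \<beta> :: real
  assumes "q \<ge> 3" and "n \<ge> 1" and "r \<le> n"
    and "\<And>i. i \<le> n \<Longrightarrow> lam i \<ge> 0" and "\<beta> > 0"
    and "\<And>C. C \<subseteq> words q n \<Longrightarrow> has_covering_radius q n C r \<Longrightarrow> satisfies_ineq q n lam \<beta> C"
  shows "\<exists>x. is_arg_min (objective q n) (feasible q n lam \<beta>) x \<and>
             real (K q n r) ^ 3 \<ge> objective q n x"
proof -
  have "q \<ge> 2" using assms(1) by simp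
  then obtain D where D: "D \<subseteq> words q n" "has_covering_radius q n D r" "card D = K q n r"
    using assms(3) by (rule K_attained)
  interpret averaged_covering_code q n D lam \<beta>
    using assms(1) D(1) assms(6)[OF D(1,2)] by unfold_locales
  obtain x' where x': "is_arg_min (objective q n) (feasible q n lam \<beta>) x'"
    using minimum_exists[OF feasible_x] by blast
  then have "objective q n x' \<le> objective q n x"
    using feasible_x by (force simp: is_arg_min_def)
  with x' show ?thesis unfolding objective_x D(3) by blast
qed

end
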